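(* In the setting of the context, let $\{w^k\}_{k\ge 1}$, $w^k=(\mathbf{x}^k,y^k,\lambda^k)$, be generated by the iteration SPG-ADMM from $w^0=(\mathbf{x}^0,y^0,\lambda^0)$ with $-\sum_{i=1}^N B_i^\top\lambda_i^0\in\partial g(y^0)$, and let $\bar u^t=(\bar{\mathbf{x}}^t,\bar y^t)$ with $\bar{\mathbf{x}}^t=\frac1t\sum_{k=1}^t\mathbf{x}^k$, $\bar y^t=\frac1t\sum_{k=1}^t y^k$ for $t\ge 1$. Fix an arbitrary $(u^*,\lambda_1^*,\dots,\lambda_N^* )\in\chi^*$, $u^*=(\mathbf{x}^*,y^* )$. For $c_1,\dots,c_N>0$ put $Q_i=I-c_i\gamma_iA_i^\top A_i$ and $$C(c_1,\dots,c_N)=\sum_{i=1}^N\Big(\tfrac{1}{\gamma_i}\big(4\|\lambda_i^*\|^2+\|\lambda_i^0\|^2\big)+\tfrac{1}{2c_i}\|x_i^*-x_i^0\|_{Q_i}^2\Big)+\tfrac12\|y^*-y^0\|^2_{\sum_{i=1}^N\gamma_iB_i^\top B_i}.$$ (i) Suppose $\sigma=0$, i.e. $G_i(x_i,\nu_i)=\nabla f_i(x_i)$ with probability 1 for all $x_i$ and $i\in\mathcal N$. If $c_i^k=c_i$ for all $k\ge 0$ for some $c_i\in\big(0,\frac{1}{L_i+\gamma_i\|A_i\|^2}\big)$, $i\in\mathcal N$, then for all $t\ge 1$ $$|F(\bar u^t)-F(u^* )|\le \frac{C(c_1,\dots,c_N)}{t},\qquad \sum_{i=1}^N\|\lambda_i^*\|\,\|A_i\bar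 x_i^t+B_i\bar y^t-b_i\|\le\frac{C(c_1,\dots,c_N)}{t}.$$ Moreover, if the matrix $B$ obtained by vertically concatenating $B_1,\dots,B_N$ has full column rank, then both $\{w^k\}$ and the averaged sequence $\{\bar w^k\}$, $\bar w^k=\frac1k\sum_{\ell=1}^k w^\ell$, converge to a primal-dual optimal point (an element of $\chi^*$). (ii) Suppose $\sigma>0$ and $D=\max_{i\in\mathcal N}\sup_{x,x'\in\operatorname{dom}\xi_i}\|x-x'\|<\infty$. Fix $c_i=(L_i+\gamma_i\|A_i\|^2+1)^{-1}$ for $i\in\mathcal N$, and set $C=C(c_1,\dots,c_N)$, $C'=N(D^2/2+\sigma^2)$. If $c_i^k=\big(\frac1{c_i}+\sqrt k\big)^{-1}$ for all $i\in\mathcal N$, $k\ge0$, then for all $t\ge1$ $$\mathbb{E}\big[|F(\bar u^t)-F(u^* )|\big]\le\frac{C'}{\sqrt t}+\frac Ct,\qquad \sum_{i=1}^N\|\lambda_i^*\|\,\mathbb{E}\big[\|A_i\bar x_i^t+B_i\bar y^t-b_i\|\big]\le\frac{C'}{\sqrt t}+\frac Ct.$$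
   Context: Let $\mathcal N=\{1,\dots,N\}$. For each $i\in\mathcal N$, $\xi_i:\mathbb R^{n_i}\to\mathbb R\cup\{+\infty\}$ and $f_i:\mathbb R^{n_i}\to\mathbb R$ are closed convex functions, $f_i$ is differentiable on an open set $U_i\supseteq\operatorname{dom}\xi_i$, and $\nabla f_i$ is Lipschitz on $U_i$ with constant $L_i$. Let $\Phi_i=\xi_i+f_i$, and let $g:\mathbb R^{n_y}\to\mathbb R\cup\{+\infty\}$ be a proper closed convex function. Let $A_i\in\mathbb R^{m_i\times n_i}$, $B_i\in\mathbb R^{m_i\times n_y}$, $b_i\in\mathbb R^{m_i}$, $\gamma_i>0$. Consider $$\min_{\mathbf{x},y}\ F(\mathbf{x},y)=g(y)+\sum_{i=1}^N\Phi_i(x_i)\quad\text{s.t. } A_ix_i+B_iy=b_i,\ i\in\mathcal N,\qquad \mathbf{x}=(x_i)_{i\in\mathcal N}.$$ Its Lagrangian is $\mathcal L(\mathbf{x},y,\lambda)=F(\mathbf{x},y)+\sum_i\lambda_i^\top(A_ix_i+B_iy-b_i)$, $\lambda=(\lambda_i)_{i\in\mathcal N}$, $\lambda_i\in\mathbb R^{m_i}$. $\chi^*$ is the set of primal-dual optimal points, i.e. of $(\mathbf{x}^*,y^*,\lambda^* )$ with $\mathcal L(\mathbf{x},y,\lambda^* )\ge\mathcal L(\mathbf{x}^*,y^*,\lambda^* )\ge\mathcal L(\mathbf{x}^*,y^*,\lambda)$ for all $\mathbf{x},y,\lambda$; assume $\chi^*\ne\emptyset$. Stochastic first-order oracle (SFO):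 for each $i$, $G_i:\mathbb R^{n_i}\times\Xi\to\mathbb R^{n_i}$ satisfies, with a common $\sigma\in[0,\infty)$, $\mathbb E_\nu[G_i(x,\nu)]=\nabla f_i(x)$ and $\mathbb E_\nu[\|G_i(x,\nu)-\nabla f_i(x)\|^2]\le\sigma^2$ for all $x\in U_i$. The random variables $\{\nu_i^k\in\Xi:i\in\mathcal N,k\ge0\}$ are i.i.d. SPG-ADMM: given $w^0=(\mathbf{x}^0,y^0,\lambda^0)$ and step sizes $c_i^k>0$, for $k\ge0$, $$x_i^{k+1}=\mathbf{prox}_{c_i^k\xi_i}\Big(x_i^k-c_i^k\big[G_i(x_i^k,\nu_i^k)+A_i^\top(\lambda_i^k+\gamma_i(A_ix_i^k+B_iy^k-b_i))\big]\Big),\ i\in\mathcal N,$$ $$y^{k+1}\in\operatorname{argmin}_y\ g(y)+\tfrac12\sum_{i=1}^N\gamma_i\big\|A_ix_i^{k+1}+B_iy-b_i+\tfrac1{\gamma_i}\lambda_i^k\big\|^2,$$ $$\lambda_i^{k+1}=\lambda_i^k+\gamma_i(A_ix_i^{k+1}+B_iy^{k+1}-b_i),\ i\in\mathcal N,$$ where the minimizer in the $y$-step is assumed to exist. The initial points $x_i^0\in U_i$ are such that $U_i$ contains all segments joining $x_i^0$ to points of $\operatorname{dom}\xi_i$ (automatic if $x_i^0\in\operatorname{dom}\xi_i$ or $U_i=\mathbb R^{n_i}$). Notation: $\mathbf{prox}_{\xi}(x)=\operatorname{argmin}_z\{\xi(z)+\frac12\|z-x\|^2\}$; $\|\cdot\|$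 is the Euclidean norm for vectors and the spectral norm for matrices; $\|v\|_Q^2=v^\top Qv$ for symmetric positive semidefinite $Q$. *)

theory Defs
  imports "HOL-Probability.Probability"
begin

text \<open>
  The blocks \<open>x\<^sub>i\<close> and \<open>\<lambda>\<^sub>i\<close> live in spaces whose dimensions \<open>n\<^sub>i\<close> and \<open>m\<^sub>i\<close> vary with \<open>i\<close>.
  The space of real vectors with a finite coordinate set \<open>J\<close> (dimension \<open>card J\<close>) is
  represented as a coordinate subspace of \<open>real^'n\<close>: coordinates outside \<open>J\<close> are zero. A matrix
  with rows \<open>K\<close> and columns \<open>J\<close> has zero entries outside \<open>K \<times> J\<close>. This zero extension
  preserves inner products, Euclidean norms, matrix products and spectral norms. The index set
  of the blocks is a finite type \<open>'i\<close>, so the number of blocks is \<open>CARD('i)\<close>.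
\<close>

definition coords :: "'n set \<Rightarrow> (real^'n) set" where
  "coords J = {x. \<forall>j. j \<notin> J \<longrightarrow> x $ j = 0}"

definition block_coords :: "('i \<Rightarrow> 'n set) \<Rightarrow> (real^'n^'i) set" where
  "block_coords J = {x. \<forall>i. x $ i \<in> coords (J i)}"

definition matrix_on :: "'m set \<Rightarrow> 'n set \<Rightarrow> real^'n^'m \<Rightarrow> bool" where
  "matrix_on K J M \<longleftrightarrow> (\<forall>r s. r \<notin> K \<or> s \<notin> J \<longrightarrow> M $ r $ s = 0)"

text \<open>
  Extended-real-valued convex analysis on a space \<open>E\<close> (a linear subspace of the ambient type);
  only the values of \<open>\<phi>\<close> on \<open>E\<close> matter.
\<close>

definition ereal_epigraph :: "'a set \<Rightarrow> ('a \<Rightarrow> ereal) \<Rightarrow> ('a \<times> real) set" where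
  "ereal_epigraph E \<phi> = {(x, r). x \<in> E \<and> \<phi> x \<le> ereal r}"

definition closed_convex_fun :: "'a::euclidean_space set \<Rightarrow> ('a \<Rightarrow> ereal) \<Rightarrow> bool" where
  "closed_convex_fun E \<phi> \<longleftrightarrow>
     (\<forall>x\<in>E. \<phi> x \<noteq> -\<infinity>) \<and> convex (ereal_epigraph E \<phi>) \<and> closed (ereal_epigraph E \<phi>)"

definition edom :: "'a set \<Rightarrow> ('a \<Rightarrow> ereal) \<Rightarrow> 'a set" where
  "edom E \<phi> = {x\<in>E. \<phi> x < \<infinity>}"

definition subdiff :: "('a::real_inner \<Rightarrow> ereal) \<Rightarrow> 'a \<Rightarrow> 'a set" where
  "subdiff \<phi> y = {v. \<forall>z. \<phi> z \<ge> \<phi> y + ereal (v \<bullet> (z - y))}"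

definition prox :: "'a::real_inner set \<Rightarrow> ('a \<Rightarrow> ereal) \<Rightarrow> 'a \<Rightarrow> 'a" where
  "prox E \<phi> v = arg_min (\<lambda>z. \<phi> z + ereal (1/2 * (norm (z - v))\<^sup>2)) (\<lambda>z. z \<in> E)"

text \<open>
  The gradient relative to \<open>E\<close>. On a subspace \<open>E\<close> the derivative within \<open>E\<close> is determined only in
  directions in \<open>E\<close>; requiring the representing vector to lie in \<open>E\<close> makes it unique.
\<close>

definition grad_on :: "'a::real_inner set \<Rightarrow> ('a \<Rightarrow> real) \<Rightarrow> 'a \<Rightarrow> 'a" where
  "grad_on E f x = (THE v. v \<in> E \<and> (f has_derivative (\<lambda>h. v \<bullet> h)) (at x within E))"

definition spectral_norm :: "real^'n^'m \<Rightarrow> real" where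
  "spectral_norm M = onorm (\<lambda>v. M *v v)"

definition qform :: "real^'n^'n \<Rightarrow> real^'n \<Rightarrow> real" where
  "qform Q v = v \<bullet> (Q *v v)"

definition stacked :: "('i::finite \<Rightarrow> real^'y^'m) \<Rightarrow> real^'y^('i \<times> 'm)" where
  "stacked B = (\<chi> p. B (fst p) $ snd p)"

definition objective ::
  "(real^'y \<Rightarrow> ereal) \<Rightarrow> ('i \<Rightarrow> real^'n \<Rightarrow> ereal) \<Rightarrow> ('i \<Rightarrow> real^'n \<Rightarrow> real) \<Rightarrow>
   real^'n^'i \<Rightarrow> real^'y \<Rightarrow> ereal" where
  "objective g \<xi> f x y = g y + (\<Sum>i\<in>UNIV. \<xi> i (x $ i) + ereal (f i (x $ i)))"

definition residual ::
  "('i \<Rightarrow> real^'n^'m) \<Rightarrow> ('i \<Rightarrow> real^'y^'m) \<Rightarrow> ('i \<Rightarrow> real^'m) \<Rightarrow>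
   'i \<Rightarrow> real^'n \<Rightarrow> real^'y \<Rightarrow> real^'m" where
  "residual A B b i v y = A i *v v + B i *v y - b i"

definition lagrangian ::
  "(real^'y \<Rightarrow> ereal) \<Rightarrow> ('i \<Rightarrow> real^'n \<Rightarrow> ereal) \<Rightarrow> ('i \<Rightarrow> real^'n \<Rightarrow> real) \<Rightarrow>
   ('i \<Rightarrow> real^'n^'m) \<Rightarrow> ('i \<Rightarrow> real^'y^'m) \<Rightarrow> ('i \<Rightarrow> real^'m) \<Rightarrow>
   real^'n^'i \<Rightarrow> real^'y \<Rightarrow> real^'m^'i \<Rightarrow> ereal" where
  "lagrangian g \<xi> f A B b x y l =
     objective g \<xi> f x y + ereal (\<Sum>i\<in>UNIV. (l $ i) \<bullet> residual A B b i (x $ i) y)"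

definition primal_dual_optimal ::
  "('i \<Rightarrow> 'n set) \<Rightarrow> ('i \<Rightarrow> 'm set) \<Rightarrow>
   (real^'y \<Rightarrow> ereal) \<Rightarrow> ('i \<Rightarrow> real^'n \<Rightarrow> ereal) \<Rightarrow> ('i \<Rightarrow> real^'n \<Rightarrow> real) \<Rightarrow>
   ('i \<Rightarrow> real^'n^'m) \<Rightarrow> ('i \<Rightarrow> real^'y^'m) \<Rightarrow> ('i \<Rightarrow> real^'m) \<Rightarrow>
   ((real^'n^'i) \<times> (real^'y) \<times> (real^'m^'i)) set" where
  "primal_dual_optimal J K g \<xi> f A B b =
     {(xs, ys, ls). xs \<in> block_coords J \<and> ls \<in> block_coords K \<and>
        (\<forall>x\<in>block_coords J. \<forall>y. \<forall>l\<in>block_coords K.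
           lagrangian g \<xi> f A B b x y ls \<ge> lagrangian g \<xi> f A B b xs ys ls \<and>
           lagrangian g \<xi> f A B b xs ys ls \<ge> lagrangian g \<xi> f A B b xs ys l)}"

text \<open>One sample path of the method: \<open>\<nu> i k\<close> is the sample drawn by block \<open>i\<close> at iteration \<open>k\<close>.\<close>

definition spg_admm_path ::
  "('i \<Rightarrow> 'n set) \<Rightarrow> (real^'y \<Rightarrow> ereal) \<Rightarrow> ('i \<Rightarrow> real^'n \<Rightarrow> ereal) \<Rightarrow>
   ('i \<Rightarrow> real^'n^'m) \<Rightarrow> ('i \<Rightarrow> real^'y^'m) \<Rightarrow> ('i \<Rightarrow> real^'m) \<Rightarrow> ('i \<Rightarrow> real) \<Rightarrow>
   ('i \<Rightarrow> nat \<Rightarrow> real) \<Rightarrow> ('i \<Rightarrow> real^'n \<Rightarrow> 's \<Rightarrow> real^'n) \<Rightarrow> ('i \<Rightarrow> nat \<Rightarrow> 's) \<Rightarrow>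
   (nat \<Rightarrow> real^'n^'i) \<Rightarrow> (nat \<Rightarrow> real^'y) \<Rightarrow> (nat \<Rightarrow> real^'m^'i) \<Rightarrow> bool" where
  "spg_admm_path J g \<xi> A B b \<gamma> c G \<nu> x y l \<longleftrightarrow>
     (\<forall>k.
        (\<forall>i. x (Suc k) $ i =
           prox (coords (J i)) (\<lambda>z. ereal (c i k) * \<xi> i z)
             (x k $ i - c i k *\<^sub>R
               (G i (x k $ i) (\<nu> i k) +
                transpose (A i) *v (l k $ i + \<gamma> i *\<^sub>R residual A B b i (x k $ i) (y k))))) \<and>
        is_arg_min
          (\<lambda>z. g z + ereal (1/2 * (\<Sum>i\<in>UNIV. \<gamma> i *
             (norm (residual A B b i (x (Suc k) $ i) z + (1 / \<gamma> i) *\<^sub>R (l k $ i)))\<^sup>2)))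
          (\<lambda>z. True) (y (Suc k)) \<and>
        (\<forall>i. l (Suc k) $ i =
           l k $ i + \<gamma> i *\<^sub>R residual A B b i (x (Suc k) $ i) (y (Suc k))))"

definition avg :: "(nat \<Rightarrow> 'a::real_vector) \<Rightarrow> nat \<Rightarrow> 'a" where
  "avg s t = (1 / real t) *\<^sub>R (\<Sum>k=1..t. s k)"

definition rate_const ::
  "('i \<Rightarrow> real^'n^'m) \<Rightarrow> ('i \<Rightarrow> real^'y^'m) \<Rightarrow> ('i \<Rightarrow> real) \<Rightarrow>
   real^'n^'i \<Rightarrow> real^'y \<Rightarrow> real^'m^'i \<Rightarrow> real^'n^'i \<Rightarrow> real^'y \<Rightarrow> real^'m^'i \<Rightarrow>
   ('i \<Rightarrow> real) \<Rightarrow> real" where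
  "rate_const A B \<gamma> x0 y0 l0 xs ys ls c =
     (\<Sum>i\<in>UNIV. 1 / \<gamma> i * (4 * (norm (ls $ i))\<^sup>2 + (norm (l0 $ i))\<^sup>2) +
        1 / (2 * c i) *
          qform (mat 1 - (c i * \<gamma> i) *\<^sub>R (transpose (A i) ** A i)) (xs $ i - x0 $ i)) +
     1/2 * qform (\<Sum>i\<in>UNIV. \<gamma> i *\<^sub>R (transpose (B i) ** B i)) (ys - y0)"

end

theory Submission
  imports Defs
begin

text \<open>
  Combining the optimality conditions of the two minimization steps with the descent lemma gives,
  for every saddle point and \<^emph>\<open>every\<close> multiplier \<open>\<lambda>\<close>, a one-step bound on
  \<open>F(u\<^sup>k\<^sup>+\<^sup>1) - F(u\<^sup>*) + \<lambda> \<bullet> r(u\<^sup>k\<^sup>+\<^sup>1)\<close> (with \<open>r\<close> the constraint residual) by the decrease of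
  a quadratic potential plus a noise term that does not depend on \<open>\<lambda>\<close>. After summation the choice
  \<open>\<lambda>\<^sub>i = 2 \<parallel>\<lambda>\<^sub>i\<^sup>*\<parallel> r\<^sub>i / \<parallel>r\<^sub>i\<parallel>\<close> at the averaged point, which may depend on the sample path, bounds both
  the objective gap and the residuals. Without noise the potential is Fejer monotone, whence
  convergence. With noise, the linear part of the error has mean zero because the iterates depend
  only on earlier samples, and its quadratic part is absorbed by the growing \<open>1 / c\<^sub>i\<^sup>k\<close>.
\<close>

subsection \<open>Closed convex functions on a subspace\<close>

text \<open>The multiplier may depend on the sample path because the error terms do not contain it:
  it is eliminated path by path, and only then is the expectation taken. Its factor 2 pays for the
  lower bound from the saddle inequality and leaves one copy of the weighted residual; squared, it
  is the 4 in \<open>rate_const\<close>. In C' the term D^2/2 is the price of the growing inverse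
  steps, and sigma^2 arises as half the variance bound times the 2 in the estimate of the sum of
  1/(1 + sqrt k). Two obstacles shape the details. The y-minimizer is an arbitrary selection, so
  adaptedness to the samples is available only for its images under the \<open>B i\<close>. And U_i
  need not be closed, so the gradients along a convergent subsequence must be controlled before the
  limit is known to lie in U_i.\<close>

lemma subspace_coords: "subspace (coords J)"
  by (auto simp: subspace_def coords_def)

lemma closed_coords: "closed (coords J)"
  by (rule closed_subspace[OF subspace_coords])

lemma closed_convex_fun_finite:
  assumes "closed_convex_fun E \<phi>" "x \<in> edom E \<phi>"
  shows "\<phi> x = ereal (real_of_ereal (\<phi> x))"
  using assms by (cases "\<phi> x") (auto simp: closed_convex_fun_def edom_def)

text \<open>Closedness of the epigraph, used as lower semicontinuity. The upper bounds may vary with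
  the index, which is the form in which the subgradient inequalities of the iterates pass to the
  limit.\<close>

lemma closed_convex_fun_lsc:
  assumes "closed_convex_fun E \<phi>" "\<And>n::nat. u n \<in> E" "\<And>n. \<phi> (u n) \<le> ereal (r n)"
    and "u \<longlonglongrightarrow> p" "r \<longlonglongrightarrow> s"
  shows "p \<in> E" "\<phi> p \<le> ereal s"
proof -
  have "(p, s) \<in> ereal_epigraph E \<phi>"
  proof (rule closed_sequentially[where f = "\<lambda>n. (u n, r n)"])
    show "closed (ereal_epigraph E \<phi>)" using assms(1) by (simp add: closed_convex_fun_def)
    show "(u n, r n) \<in> ereal_epigraph E \<phi>" for n
      using assms(2,3) by (simp add: ereal_epigraph_def)
    show "(\<lambda>n. (u n, r n)) \<longlonglongrightarrow> (p, s)" by (intro tendsto_Pair assms)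
  qed
  then show "p \<in> E" "\<phi> p \<le> ereal s" by (auto simp: ereal_epigraph_def)
qed

lemma edomI: "x \<in> E \<Longrightarrow> \<phi> x \<le> ereal r \<Longrightarrow> x \<in> edom E \<phi>"
  by (auto simp: edom_def)

text \<open>Jensen's inequality: the pairs of a point and its value lie in the convex epigraph,
  hence so does their convex combination.\<close>

lemma closed_convex_fun_sum:
  assumes cc: "closed_convex_fun E \<phi>" and "finite S" "(\<Sum>k\<in>S. a k) = 1"
    and "\<And>k. k \<in> S \<Longrightarrow> a k \<ge> 0" "\<And>k. k \<in> S \<Longrightarrow> u k \<in> edom E \<phi>"
  shows "(\<Sum>k\<in>S. a k *\<^sub>R u k) \<in> edom E \<phi>"
    "real_of_ereal (\<phi> (\<Sum>k\<in>S. a k *\<^sub>R u k)) \<le> (\<Sum>k\<in>S. a k * real_of_ereal (\<phi> (u k)))"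
proof -
  let ?r = "\<lambda>k. real_of_ereal (\<phi> (u k))"
  have "(\<Sum>k\<in>S. a k *\<^sub>R (u k, ?r k)) \<in> ereal_epigraph E \<phi>"
  proof (rule convex_sum)
    show "convex (ereal_epigraph E \<phi>)" using cc by (simp add: closed_convex_fun_def)
    fix k assume "k \<in> S"
    then show "(u k, ?r k) \<in> ereal_epigraph E \<phi>"
      using closed_convex_fun_finite[OF cc assms(5)[of k]] assms(5)[of k]
      by (auto simp: ereal_epigraph_def edom_def)
  qed (use assms in auto)
  moreover have "(\<Sum>k\<in>S. a k *\<^sub>R (u k, ?r k)) = (\<Sum>k\<in>S. a k *\<^sub>R u k, \<Sum>k\<in>S. a k * ?r k)"
    by (induct S rule: infinite_finite_induct) (auto simp: zero_prod_def)
  ultimately have *: "(\<Sum>k\<in>S. a k *\<^sub>R u k) \<in> E"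
    "\<phi> (\<Sum>k\<in>S. a k *\<^sub>R u k) \<le> ereal (\<Sum>k\<in>S. a k * ?r k)"
    by (auto simp: ereal_epigraph_def)
  show d: "(\<Sum>k\<in>S. a k *\<^sub>R u k) \<in> edom E \<phi>" using * by (rule edomI)
  show "real_of_ereal (\<phi> (\<Sum>k\<in>S. a k *\<^sub>R u k)) \<le> (\<Sum>k\<in>S. a k * ?r k)"
    using closed_convex_fun_finite[OF cc d] *(2) by (metis ereal_less_eq(3))
qed

lemma closed_convex_fun_segment:
  assumes cc: "closed_convex_fun E \<phi>" and "x \<in> edom E \<phi>" "z \<in> edom E \<phi>" "0 \<le> t" "t \<le> 1"
  shows "x + t *\<^sub>R (z - x) \<in> edom E \<phi>"
    "real_of_ereal (\<phi> (x + t *\<^sub>R (z - x)))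
       \<le> real_of_ereal (\<phi> x) + t * (real_of_ereal (\<phi> z) - real_of_ereal (\<phi> x))"
proof -
  \<comment> \<open>A point of the segment is a convex combination indexed by \<open>bool\<close>,
    so Jensen applies to it.\<close>
  have eq: "x + t *\<^sub>R (z - x) = (\<Sum>k\<in>UNIV. (if k then t else 1 - t) *\<^sub>R (if k then z else x))"
    by (simp add: UNIV_bool algebra_simps)
  show "x + t *\<^sub>R (z - x) \<in> edom E \<phi>"
    unfolding eq using assms by (intro closed_convex_fun_sum[OF cc]) (auto simp: UNIV_bool)
  have "real_of_ereal (\<phi> (x + t *\<^sub>R (z - x))) \<le>
     (\<Sum>k\<in>UNIV. (if k then t else 1 - t) * real_of_ereal (\<phi> (if k then z else x)))"
    unfolding eq using assms by (intro closed_convex_fun_sum[OF cc]) (auto simp: UNIV_bool)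
  then show "real_of_ereal (\<phi> (x + t *\<^sub>R (z - x)))
       \<le> real_of_ereal (\<phi> x) + t * (real_of_ereal (\<phi> z) - real_of_ereal (\<phi> x))"
    by (simp add: UNIV_bool algebra_simps)
qed

lemma convex_edom:
  assumes cc: "closed_convex_fun E \<phi>"
  shows "convex (edom E \<phi>)"
proof (rule convexI)
  fix x y u v assume *: "x \<in> edom E \<phi>" "y \<in> edom E \<phi>" "0 \<le> u" "0 \<le> v" "u + v = (1::real)"
  have "x + v *\<^sub>R (y - x) = u *\<^sub>R x + v *\<^sub>R y"
    using *(5) by (simp add: algebra_simps flip: scaleR_add_left)
  then show "u *\<^sub>R x + v *\<^sub>R y \<in> edom E \<phi>"
    using closed_convex_fun_segment(1)[OF cc *(1,2,4)] * by simp
qed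

lemma nonneg_of_quadratic_nonneg:
  fixes a q :: real
  assumes "\<And>t. 0 < t \<Longrightarrow> t \<le> 1 \<Longrightarrow> 0 \<le> a + t * q"
  shows "0 \<le> a"
proof (rule ccontr)
  assume a: "\<not> 0 \<le> a"
  \<comment> \<open>With this choice \<open>t * q \<le> - a / 2\<close>, so \<open>a + t * q\<close>
    would be negative. The cap at 1 respects the range of the hypothesis, and the added 1 keeps the
    denominator positive.\<close>
  define t where "t = min 1 (- a / (2 * (\<bar>q\<bar> + 1)))"
  have t: "0 < t" "t \<le> 1" using a by (auto simp: t_def divide_less_0_iff zero_less_divide_iff)
  have "t * q \<le> t * (\<bar>q\<bar> + 1)" using t by (intro mult_left_mono) auto
  also have "\<dots> \<le> (- a / (2 * (\<bar>q\<bar> + 1))) * (\<bar>q\<bar> + 1)"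
    by (intro mult_right_mono) (auto simp: t_def)
  also have "\<dots> = - a / 2" by (simp add: field_simps)
  finally show False using assms[OF t] a by simp
qed

text \<open>First-order optimality at a minimizer of \<open>\<phi> + h\<close>: compare p with
  \<open>p + t *\<^sub>R (z - p)\<close>, bound \<open>\<phi>\<close> there by convexity, divide by
  t and let t tend to 0. Here a is the slope of h at p in direction \<open>z - p\<close>. Both
  minimization steps of the method are instances.\<close>

lemma variational_inequality:
  assumes cc: "closed_convex_fun E \<phi>" and E: "p \<in> edom E \<phi>" "z \<in> edom E \<phi>"
    and opt: "\<And>w. w \<in> edom E \<phi> \<Longrightarrow> real_of_ereal (\<phi> p) + h p \<le> real_of_ereal (\<phi> w) + h w"
    and h: "\<And>t. h (p + t *\<^sub>R (z - p)) = h p + t * a + t\<^sup>2 * q"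
  shows "real_of_ereal (\<phi> p) \<le> real_of_ereal (\<phi> z) + (a::real)"
proof -
  let ?r = "\<lambda>x. real_of_ereal (\<phi> x)"
  have "0 \<le> (?r z + a - ?r p) + t * q" if t: "0 < t" "t \<le> 1" for t
  proof -
    note s = closed_convex_fun_segment[OF cc E, of t]
    have "?r p + h p \<le> ?r p + t * (?r z - ?r p) + (h p + t * a + t\<^sup>2 * q)"
      using opt[OF s(1)] s(2) t by (simp add: h)
    then have "0 \<le> t * ((?r z + a - ?r p) + t * q)"
      by (simp add: algebra_simps power2_eq_square)
    then show ?thesis using t by (simp add: zero_le_mult_iff)
  qed
  from nonneg_of_quadratic_nonneg[OF this] show ?thesis by simp
qed

lemma norm_add_scaleR_power2:
  fixes x y :: "'a::real_inner"
  shows "(norm (x + t *\<^sub>R y))\<^sup>2 = (norm x)\<^sup>2 + t * (2 * (x \<bullet> y)) + t\<^sup>2 * (norm y)\<^sup>2"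
  unfolding power2_norm_eq_inner by (simp add: inner_simps inner_commute algebra_simps power2_eq_square)

subsection \<open>The proximal map\<close>

text \<open>The direct method. Continuity of h moves it to the other side: along a minimizing
  subsequence \<open>\<phi>\<close> stays below a level \<open>c - h\<close>, and these levels
  converge.\<close>

lemma lsc_attains_on_compact:
  assumes cc: "closed_convex_fun E \<phi>" and S: "compact S" "S \<inter> edom E \<phi> \<noteq> {}"
    and h: "continuous_on UNIV h"
  obtains p where "p \<in> S \<inter> edom E \<phi>"
    "\<And>w. w \<in> S \<inter> edom E \<phi> \<Longrightarrow> real_of_ereal (\<phi> p) + h p \<le> real_of_ereal (\<phi> w) + h w"
proof -
  let ?r = "\<lambda>x. real_of_ereal (\<phi> x) + h x"
  let ?V = "?r ` (S \<inter> edom E \<phi>)"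
  obtain z0 where z0: "z0 \<in> S \<inter> edom E \<phi>" using S by auto
  define m where "m = (INF w\<in>S \<inter> edom E \<phi>. ereal (?r w))"
  have m_le: "m \<le> ereal (?r w)" if "w \<in> S \<inter> edom E \<phi>" for w
    unfolding m_def using that by (rule INF_lower)
  obtain v where v: "\<And>n. v n \<in> (\<lambda>w. ereal (?r w)) ` (S \<inter> edom E \<phi>)" "v \<longlonglongrightarrow> m"
    using Inf_as_limit[of "(\<lambda>w. ereal (?r w)) ` (S \<inter> edom E \<phi>)"] S unfolding m_def by blast
  then have "\<forall>n. \<exists>w. w \<in> S \<inter> edom E \<phi> \<and> v n = ereal (?r w)" by auto
  then obtain w where w: "\<And>n::nat. w n \<in> S \<inter> edom E \<phi>" "\<And>n. v n = ereal (?r (w n))" by metis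
  obtain p \<tau> where p: "p \<in> S" "strict_mono \<tau>" "(w \<circ> \<tau>) \<longlonglongrightarrow> p"
    using S(1) w(1) unfolding compact_def by blast
  have lim: "(\<lambda>n. ereal (?r (w (\<tau> n)))) \<longlonglongrightarrow> m"
    using LIMSEQ_subseq_LIMSEQ[OF v(2) p(2)] by (simp add: o_def w(2))
  have hlim: "(\<lambda>n. h (w (\<tau> n))) \<longlonglongrightarrow> h p"
    using isCont_tendsto_compose[OF _ p(3), of h] h by (simp add: continuous_on_eq_continuous_at o_def)
  \<comment> \<open>A priori the infimum m could be minus infinity, so p is compared with every real
    c above m rather than with m.\<close>
  have bnd: "p \<in> edom E \<phi> \<and> real_of_ereal (\<phi> p) + h p \<le> c" if c: "m < ereal c" for c
  proof -
    from order_tendstoD(2)[OF lim c] obtain N where N: "\<And>n. n \<ge> N \<Longrightarrow> ?r (w (\<tau> n)) < c"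
      by (auto simp: eventually_sequentially)
    have a: "w (\<tau> (n + N)) \<in> E" "\<phi> (w (\<tau> (n + N))) \<le> ereal (c - h (w (\<tau> (n + N))))" for n
    proof -
      have d: "w (\<tau> (n + N)) \<in> edom E \<phi>" using w(1) by auto
      then show "w (\<tau> (n + N)) \<in> E" by (auto simp: edom_def)
      have "real_of_ereal (\<phi> (w (\<tau> (n + N)))) \<le> c - h (w (\<tau> (n + N)))" using N[of "n+N"] by simp
      then show "\<phi> (w (\<tau> (n + N))) \<le> ereal (c - h (w (\<tau> (n + N))))"
        using closed_convex_fun_finite[OF cc d] by (metis ereal_less_eq(3))
    qed
    have l: "(\<lambda>n. w (\<tau> (n + N))) \<longlonglongrightarrow> p"
      using p(3) LIMSEQ_ignore_initial_segment[of "w \<circ> \<tau>" p N] by (simp add: o_def)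
    have l': "(\<lambda>n. c - h (w (\<tau> (n + N)))) \<longlonglongrightarrow> c - h p"
      by (intro tendsto_intros LIMSEQ_ignore_initial_segment[OF hlim])
    have *: "p \<in> E" "\<phi> p \<le> ereal (c - h p)"
      using closed_convex_fun_lsc[OF cc a l l'] by auto
    then have d: "p \<in> edom E \<phi>" by (rule edomI)
    with * closed_convex_fun_finite[OF cc d] have "real_of_ereal (\<phi> p) \<le> c - h p"
      by (metis ereal_less_eq(3))
    with d show ?thesis by simp
  qed
  show thesis
  proof (rule that[of p])
    have "m < ereal (?r z0 + 1)" using m_le[OF z0] by (rule le_less_trans) simp
    from bnd[OF this] p(1) show "p \<in> S \<inter> edom E \<phi>" by auto
    fix w assume w: "w \<in> S \<inter> edom E \<phi>"
    show "?r p \<le> ?r w"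
    proof (rule field_le_epsilon)
      fix e :: real assume "e > 0"
      then have "m < ereal (?r w + e)" using m_le[OF w] by (intro le_less_trans[of m "ereal (?r w)"]) auto
      from bnd[OF this] show "?r p \<le> ?r w + e" by auto
    qed
  qed
qed

text \<open>On the unit ball around a point of the domain the function is bounded below; convexity
  turns this into a linear lower bound outside, so that the quadratic makes the sublevel sets
  compact.\<close>

lemma prox_exists:
  assumes cc: "closed_convex_fun E \<phi>" and ne: "edom E \<phi> \<noteq> {}" and c: "c > 0"
  obtains p where "p \<in> edom E \<phi>"
    "\<And>w. w \<in> edom E \<phi> \<Longrightarrow> c * real_of_ereal (\<phi> p) + 1/2 * (norm (p - v))\<^sup>2
        \<le> c * real_of_ereal (\<phi> w) + 1/2 * (norm (w - v))\<^sup>2"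
proof -
  let ?r = "\<lambda>x. real_of_ereal (\<phi> x)"
  let ?h = "\<lambda>w. 1/(2*c) * (norm (w - v))\<^sup>2"
  let ?d = "edom E \<phi>"
  obtain z0 where z0: "z0 \<in> ?d" using ne by auto
  have "z0 \<in> cball z0 1" by simp
  then have ne1: "cball z0 1 \<inter> ?d \<noteq> {}" using z0 by blast
  obtain q where q: "q \<in> cball z0 1 \<inter> ?d" "\<And>w. w \<in> cball z0 1 \<inter> ?d \<Longrightarrow> ?r q + 0 \<le> ?r w + 0"
    by (rule lsc_attains_on_compact[OF cc compact_cball ne1 continuous_on_const[of _ 0]]) blast
  define \<kappa> where "\<kappa> = ?r z0 - ?r q"
  have \<kappa>: "\<kappa> \<ge> 0" using q(2)[of z0] z0 by (simp add: \<kappa>_def)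
  have low: "?r w \<ge> ?r z0 - norm (w - z0) * \<kappa>" if w: "w \<in> ?d" "norm (w - z0) \<ge> 1" for w
  proof -
    define s where "s = norm (w - z0)"
    have s: "s \<ge> 1" using w by (simp add: s_def)
    note sg = closed_convex_fun_segment[OF cc z0 w(1), of "1/s"]
    have "z0 + (1/s) *\<^sub>R (w - z0) \<in> cball z0 1"
      using s by (simp add: dist_norm s_def)
    then have "?r q \<le> ?r (z0 + (1/s) *\<^sub>R (w - z0))" using q(2) sg(1) s by auto
    also have "\<dots> \<le> ?r z0 + 1/s * (?r w - ?r z0)" using sg(2) s by auto
    finally have "- \<kappa> * s \<le> ?r w - ?r z0" using s by (simp add: \<kappa>_def field_simps)
    then show ?thesis by (simp add: s_def mult.commute)
  qed
  \<comment> \<open>For \<open>s > R\<close> one has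
    \<open>s - 2 * norm (z0 - v) \<ge> 2 * c * \<kappa>\<close>, so the growth of the quadratic
    outweighs the possible decrease \<open>s * \<kappa>\<close> and no point outside the ball beats
    z0.\<close>
  define R where "R = 1 + 2 * (c * \<kappa> + norm (z0 - v)) "
  have R: "R \<ge> 1" using \<kappa> c by (simp add: R_def)
  have "z0 \<in> cball z0 R" using R by simp
  then have neR: "cball z0 R \<inter> ?d \<noteq> {}" using z0 by blast
  obtain p where p: "p \<in> cball z0 R \<inter> ?d"
    "\<And>w. w \<in> cball z0 R \<inter> ?d \<Longrightarrow> ?r p + ?h p \<le> ?r w + ?h w"
    by (rule lsc_attains_on_compact[OF cc compact_cball neR, of ?h]) (use c in \<open>auto intro!: continuous_intros\<close>)
  have all: "?r p + ?h p \<le> ?r w + ?h w" if w: "w \<in> ?d" for w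
  proof (cases "w \<in> cball z0 R")
    case False
    define s where "s = norm (w - z0)"
    have s: "s > R" using False by (simp add: s_def dist_norm norm_minus_commute)
    have "?r z0 + ?h z0 \<le> ?r w + ?h w"
    proof -
      have 1: "?r w \<ge> ?r z0 - s * \<kappa>" using low[OF w] s R by (simp add: s_def)
      have "s - norm (z0 - v) \<le> norm (w - v)"
        using norm_triangle_ineq[of "w - v" "v - z0"] by (simp add: s_def norm_minus_commute)
      moreover have "0 \<le> s - norm (z0 - v)" using s c \<kappa> by (simp add: R_def) (smt (verit) mult_nonneg_nonneg norm_ge_zero)
      ultimately have "(s - norm (z0 - v))\<^sup>2 \<le> (norm (w - v))\<^sup>2" by (intro power_mono)
      moreover have "(s - norm (z0 - v))\<^sup>2 = s * (s - 2 * norm (z0 - v)) + (norm (z0 - v))\<^sup>2"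
        by (simp add: power2_eq_square algebra_simps)
      moreover have "s * (2 * c * \<kappa>) \<le> s * (s - 2 * norm (z0 - v))"
        using s R by (intro mult_left_mono) (auto simp: R_def)
      ultimately have "s * (2 * c * \<kappa>) + (norm (z0 - v))\<^sup>2 \<le> (norm (w - v))\<^sup>2" by linarith
      then have "1/(2*c) * (s * (2 * c * \<kappa>) + (norm (z0 - v))\<^sup>2) \<le> ?h w"
        using c by (intro mult_left_mono) auto
      moreover have "1/(2*c) * (s * (2 * c * \<kappa>) + (norm (z0 - v))\<^sup>2) = s * \<kappa> + ?h z0"
        using c by (simp add: field_simps)
      ultimately show ?thesis using 1 by linarith
    qed
    moreover have "?r p + ?h p \<le> ?r z0 + ?h z0" using p(2) z0 R by auto
    ultimately show ?thesis by simp
  qed (use p w in auto)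
  show thesis
  proof (rule that[of p])
    show "p \<in> ?d" using p by auto
    fix w assume "w \<in> ?d"
    from mult_left_mono[OF all[OF this], of c] c
    show "c * ?r p + 1/2 * (norm (p - v))\<^sup>2 \<le> c * ?r w + 1/2 * (norm (w - v))\<^sup>2"
      by (simp add: distrib_left)
  qed
qed

text \<open>\<open>prox\<close> is a choice operator and carries information only once a minimizer
  is known to exist. Points of E outside the domain have infinite value, so minimizing over E in the
  extended reals and over the domain in the reals is the same.\<close>

lemma prox_minimizes:
  assumes cc: "closed_convex_fun E \<phi>" and ne: "edom E \<phi> \<noteq> {}" and c: "c > 0"
  shows prox_edom: "prox E (\<lambda>z. ereal c * \<phi> z) v \<in> edom E \<phi>"
    and "z \<in> edom E \<phi> \<Longrightarrow>
      c * real_of_ereal (\<phi> (prox E (\<lambda>z. ereal c * \<phi> z) v)) + 1/2 * (norm (prox E (\<lambda>z. ereal c * \<phi> z) v - v))\<^sup>2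
        \<le> c * real_of_ereal (\<phi> z) + 1/2 * (norm (z - v))\<^sup>2"
proof -
  let ?F = "\<lambda>z. ereal c * \<phi> z + ereal (1/2 * (norm (z - v))\<^sup>2)"
  let ?p = "prox E (\<lambda>z. ereal c * \<phi> z) v"
  have val: "?F w = ereal (c * real_of_ereal (\<phi> w) + 1/2 * (norm (w - v))\<^sup>2)" if "w \<in> edom E \<phi>" for w
    by (subst closed_convex_fun_finite[OF cc that]) simp
  have inf: "?F w = \<infinity>" if "w \<in> E" "w \<notin> edom E \<phi>" for w
    using that c by (auto simp: edom_def)
  obtain p where p: "p \<in> edom E \<phi>" "\<And>w. w \<in> edom E \<phi> \<Longrightarrow>
     c * real_of_ereal (\<phi> p) + 1/2 * (norm (p - v))\<^sup>2 \<le> c * real_of_ereal (\<phi> w) + 1/2 * (norm (w - v))\<^sup>2"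
    using prox_exists[OF cc ne c] by blast
  have le: "?F p \<le> ?F w" if "w \<in> E" for w
  proof (cases "w \<in> edom E \<phi>")
    case True then show ?thesis using p(2)[OF True] by (simp only: val p(1) ereal_less_eq)
  next
    case False then show ?thesis unfolding inf[OF that False] by simp
  qed
  have "is_arg_min ?F (\<lambda>z. z \<in> E) p"
    using p(1) le by (auto simp: is_arg_min_linorder edom_def)
  then have am: "is_arg_min ?F (\<lambda>z. z \<in> E) ?p"
    unfolding prox_def arg_min_def by (rule someI)
  then have pE: "?p \<in> E" and "?F ?p \<le> ?F p" using p(1) by (auto simp: is_arg_min_linorder edom_def)
  then show d: "?p \<in> edom E \<phi>" using inf[of ?p] val[OF p(1)] by force
  assume z: "z \<in> edom E \<phi>"
  then have "?F ?p \<le> ?F z" using am by (auto simp: is_arg_min_linorder edom_def)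
  then show "c * real_of_ereal (\<phi> ?p) + 1/2 * (norm (?p - v))\<^sup>2 \<le> c * real_of_ereal (\<phi> z) + 1/2 * (norm (z - v))\<^sup>2"
    by (simp only: val d z ereal_less_eq)
qed

text \<open>In other words, \<open>v - p\<close> scaled by 1/c is a subgradient of
  \<open>\<phi>\<close> at p, tested on the domain. The slope fed into the variational inequality is
  that of the quadratic, \<open>(p - v) \<bullet> (z - p) / c\<close>.\<close>

lemma prox_variational:
  fixes v :: "'a::euclidean_space"
  assumes cc: "closed_convex_fun E \<phi>" and ne: "edom E \<phi> \<noteq> {}" and c: "c > 0" and z: "z \<in> edom E \<phi>"
  defines "p \<equiv> prox E (\<lambda>z. ereal c * \<phi> z) v"
  shows "c * real_of_ereal (\<phi> p) \<le> c * real_of_ereal (\<phi> z) + (p - v) \<bullet> (z - p)"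
proof -
  note m = prox_minimizes[OF cc ne c, where v = v, folded p_def]
  have "real_of_ereal (\<phi> p) \<le> real_of_ereal (\<phi> z) + (p - v) \<bullet> (z - p) / c"
  proof (rule variational_inequality[OF cc, where h = "\<lambda>w. 1/(2*c) * (norm (w - v))\<^sup>2" and q = "1/(2*c) * (norm (z - p))\<^sup>2"])
    show "p \<in> edom E \<phi>" "z \<in> edom E \<phi>" using m(1) z by auto
    fix w assume "w \<in> edom E \<phi>"
    from m(2)[OF this] have "(c * real_of_ereal (\<phi> p) + 1/2 * (norm (p - v))\<^sup>2) / c \<le> (c * real_of_ereal (\<phi> w) + 1/2 * (norm (w - v))\<^sup>2) / c"
      using c by (intro divide_right_mono) auto
    then show "real_of_ereal (\<phi> p) + 1/(2*c) * (norm (p - v))\<^sup>2 \<le> real_of_ereal (\<phi> w) + 1/(2*c) * (norm (w - v))\<^sup>2"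
      using c by (simp add: add_divide_distrib)
  next
    fix t :: real
    have "p + t *\<^sub>R (z - p) - v = (p - v) + t *\<^sub>R (z - p)" by simp
    then show "1/(2*c) * (norm (p + t *\<^sub>R (z - p) - v))\<^sup>2 =
      1/(2*c) * (norm (p - v))\<^sup>2 + t * ((p - v) \<bullet> (z - p) / c) + t\<^sup>2 * (1/(2*c) * (norm (z - p))\<^sup>2)"
      using c by (simp only: norm_add_scaleR_power2) (simp add: field_simps)
  qed
  from mult_left_mono[OF this, of c] c show ?thesis by (simp add: distrib_left)
qed

text \<open>Each variational inequality is tested at the other proximal point; in the sum
  \<open>\<phi>\<close> cancels and Cauchy-Schwarz remains. The resulting continuity makes the
  x-step measurable in its data.\<close>

lemma prox_nonexpansive:
  assumes cc: "closed_convex_fun E \<phi>" and ne: "edom E \<phi> \<noteq> {}" and c: "c > 0"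
  shows "norm (prox E (\<lambda>z. ereal c * \<phi> z) v - prox E (\<lambda>z. ereal c * \<phi> z) w) \<le> norm (v - w)"
proof -
  let ?p = "prox E (\<lambda>z. ereal c * \<phi> z) v" and ?q = "prox E (\<lambda>z. ereal c * \<phi> z) w"
  have "0 \<le> (?p - v) \<bullet> (?q - ?p) + (?q - w) \<bullet> (?p - ?q)"
    using prox_variational[OF cc ne c prox_edom[OF cc ne c], of v w]
      prox_variational[OF cc ne c prox_edom[OF cc ne c], of w v] by linarith
  then have "(norm (?p - ?q))\<^sup>2 \<le> (v - w) \<bullet> (?p - ?q)"
    by (simp add: power2_norm_eq_inner inner_simps inner_commute)
  also have "\<dots> \<le> norm (v - w) * norm (?p - ?q)" by (rule norm_cauchy_schwarz)
  finally show ?thesis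
    by (cases "?p = ?q") (auto simp: power2_eq_square)
qed

lemma prox_measurable:
  fixes \<phi> :: "'a::euclidean_space \<Rightarrow> ereal"
  assumes "closed_convex_fun E \<phi>" "edom E \<phi> \<noteq> {}" "c > 0"
  shows "prox E (\<lambda>z. ereal c * \<phi> z) \<in> borel_measurable borel"
proof (rule borel_measurable_continuous_onI)
  have "1-lipschitz_on UNIV (prox E (\<lambda>z. ereal c * \<phi> z))"
    using prox_nonexpansive[OF assms] by (intro lipschitz_onI) (auto simp: dist_norm)
  then show "continuous_on UNIV (prox E (\<lambda>z. ereal c * \<phi> z))"
    by (rule lipschitz_on_continuous_on)
qed

subsection \<open>Gradients on a subspace\<close>

lemma has_real_derivative_along_line:
  assumes E: "subspace E" and x: "x \<in> E" "d \<in> E"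
    and D: "(f has_derivative (\<lambda>h. a \<bullet> h)) (at (x + t *\<^sub>R d) within E)"
  shows "((\<lambda>t. f (x + t *\<^sub>R d)) has_real_derivative a \<bullet> d) (at t)"
proof -
  have "((\<lambda>t. f (x + t *\<^sub>R d)) has_derivative (\<lambda>t. a \<bullet> (t *\<^sub>R d))) (at t)"
  proof (rule has_derivative_in_compose[where g' = "\<lambda>h. a \<bullet> h" and f' = "\<lambda>t. t *\<^sub>R d"])
    show "((\<lambda>t. x + t *\<^sub>R d) has_derivative (\<lambda>t. t *\<^sub>R d)) (at t)"
      by (auto intro!: derivative_eq_intros)
    show "(f has_derivative (\<lambda>h. a \<bullet> h)) (at (x + t *\<^sub>R d) within range (\<lambda>t. x + t *\<^sub>R d))"
      by (rule has_derivative_subset[OF D]) (use E x in \<open>auto intro: subspace_add subspace_scale\<close>)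
  qed
  moreover have "(\<lambda>t. a \<bullet> (t *\<^sub>R d)) = (*) (a \<bullet> d)" by (auto simp: mult.commute)
  ultimately show ?thesis by (simp add: has_field_derivative_def)
qed

text \<open>A vector representing the derivative in the ambient space is arbitrary orthogonally to
  E. Its projection onto E represents the same derivative within E and is the only such vector in E,
  so the description in \<open>grad_on\<close> is well defined.\<close>

lemma has_derivative_grad_on:
  fixes f :: "'a::euclidean_space \<Rightarrow> real"
  assumes E: "subspace E" and x: "x \<in> E" and diff: "f differentiable (at x within E)"
  shows "grad_on E f x \<in> E" "(f has_derivative (\<lambda>h. grad_on E f x \<bullet> h)) (at x within E)"
proof -
  obtain D where D: "(f has_derivative D) (at x within E)" using diff by (auto simp: differentiable_def)
  then have lin: "linear D" by (rule has_derivative_linear)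
  define w where "w = (\<Sum>b\<in>Basis. D b *\<^sub>R b)"
  have Dw: "D h = w \<bullet> h" for h
  proof -
    have "D h = D (\<Sum>b\<in>Basis. (h \<bullet> b) *\<^sub>R b)" by (simp add: euclidean_representation)
    also have "\<dots> = (\<Sum>b\<in>Basis. (h \<bullet> b) * D b)"
      by (simp add: linear_sum[OF lin] linear_scale[OF lin])
    also have "\<dots> = w \<bullet> h" by (simp add: w_def inner_sum_left inner_commute[of _ h] inner_sum_right mult.commute)
    finally show ?thesis .
  qed
  obtain v z where vz: "v \<in> span E" "\<And>e. e \<in> span E \<Longrightarrow> orthogonal z e" "w = v + z"
    using orthogonal_subspace_decomp_exists[of E w] by blast
  have span: "span E = E" using E by (simp add: span_eq_iff)
  have restr: "(f has_derivative (\<lambda>h. u \<bullet> h)) (at x within E)" if "\<And>h. h \<in> E \<Longrightarrow> u \<bullet> h = w \<bullet> h" for u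
  proof -
    have "((\<lambda>y. (f y - f x - u \<bullet> (y - x)) /\<^sub>R norm (y - x)) \<longlongrightarrow> 0) (at x within E)"
    proof (rule Lim_transform_eventually)
      show "((\<lambda>y. (f y - f x - D (y - x)) /\<^sub>R norm (y - x)) \<longlongrightarrow> 0) (at x within E)"
        using D by (simp add: has_derivative_at_within)
      show "\<forall>\<^sub>F y in at x within E. (f y - f x - D (y - x)) /\<^sub>R norm (y - x) = (f y - f x - u \<bullet> (y - x)) /\<^sub>R norm (y - x)"
        using that x E by (auto simp: eventually_at_filter Dw subspace_diff)
    qed
    then show ?thesis by (simp add: has_derivative_at_within bounded_linear_inner_right)
  qed
  have v: "v \<in> E \<and> (f has_derivative (\<lambda>h. v \<bullet> h)) (at x within E)"
    using vz span by (auto intro!: restr simp: inner_simps orthogonal_def)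
  \<comment> \<open>Two candidates agree on all directions of E; their difference is such a
    direction, hence orthogonal to itself.\<close>
  have uniq: "u = v" if u: "u \<in> E" "(f has_derivative (\<lambda>h. u \<bullet> h)) (at x within E)" for u
  proof -
    have "((\<lambda>t. f (x + t *\<^sub>R (u - v))) has_real_derivative a \<bullet> (u - v)) (at 0)"
      if "(f has_derivative (\<lambda>h. a \<bullet> h)) (at x within E)" for a
      using has_real_derivative_along_line[OF E x subspace_diff[OF E u(1)], of v f a 0] v that by simp
    from DERIV_unique[OF this[OF u(2)] this] v have "(u - v) \<bullet> (u - v) = 0"
      by (simp add: inner_diff_left)
    then show ?thesis by simp
  qed
  have "grad_on E f x = v"
    unfolding grad_on_def by (rule the_equality) (use v uniq in auto)
  with v show "grad_on E f x \<in> E" "(f has_derivative (\<lambda>h. grad_on E f x \<bullet> h)) (at x within E)"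
    by auto
qed

text \<open>Convexity bounds every difference quotient from x towards z by \<open>f z - f x\<close>;
  the limit from the right is the directional derivative.\<close>

lemma gradient_inequality:
  fixes f :: "'a::euclidean_space \<Rightarrow> real"
  assumes E: "subspace E" and x: "x \<in> E" "z \<in> E" and diff: "f differentiable (at x within E)"
    and cc: "closed_convex_fun E (\<lambda>x. ereal (f x))"
  shows "f x + grad_on E f x \<bullet> (z - x) \<le> f z"
proof -
  let ?\<psi> = "\<lambda>t. f (x + t *\<^sub>R (z - x))"
  have "(?\<psi> has_real_derivative grad_on E f x \<bullet> (z - x)) (at 0)"
    using has_real_derivative_along_line[OF E x(1) subspace_diff[OF E x(2,1)], of f _ 0]
      has_derivative_grad_on(2)[OF E x(1) diff] by simp
  then have "((\<lambda>t. (?\<psi> t - f x) / t) \<longlongrightarrow> grad_on E f x \<bullet> (z - x)) (at_right 0)"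
    by (auto simp: has_field_derivative_iff intro: filterlim_at_split[THEN iffD1, THEN conjunct2])
  moreover have "\<forall>\<^sub>F t in at_right 0. (?\<psi> t - f x) / t \<le> f z - f x"
  proof (rule eventually_at_rightI[of 0 1])
    fix t :: real assume t: "t \<in> {0<..<1}"
    have "?\<psi> t \<le> f x + t * (f z - f x)"
      using closed_convex_fun_segment(2)[OF cc, of x z t] x t by (simp add: edom_def)
    then show "(?\<psi> t - f x) / t \<le> f z - f x" using t by (simp add: field_simps)
  qed simp
  ultimately have "grad_on E f x \<bullet> (z - x) \<le> f z - f x"
    by (rule tendsto_upperbound) simp
  then show ?thesis by simp
qed

text \<open>Along the segment \<open>\<psi>\<close> is f minus the linear and quadratic terms of the
  bound; the Lipschitz gradient makes its derivative nonpositive. U need not be convex, which is why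
  the segment appears as a hypothesis.\<close>

lemma descent_lemma:
  fixes f :: "'a::euclidean_space \<Rightarrow> real"
  assumes E: "subspace E" and U: "closed_segment x z \<subseteq> U" "U \<subseteq> E"
    and diff: "\<And>u. u \<in> U \<Longrightarrow> f differentiable (at u within E)"
    and lip: "L-lipschitz_on U (grad_on E f)"
  shows "f z \<le> f x + grad_on E f x \<bullet> (z - x) + L / 2 * (norm (z - x))\<^sup>2"
proof -
  let ?d = "z - x" and ?u = "\<lambda>t. x + t *\<^sub>R (z - x)"
  define \<psi> where "\<psi> t = f (?u t) - t * (grad_on E f x \<bullet> ?d) - L / 2 * t\<^sup>2 * (norm ?d)\<^sup>2" for t
  have xz: "x \<in> U" "z \<in> U" using U by auto
  have u: "?u t \<in> U" if "0 \<le> t" "t \<le> 1" for t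
  proof -
    have "?u t = (1 - t) *\<^sub>R x + t *\<^sub>R z" by (simp add: algebra_simps)
    then show ?thesis using that U by (auto simp: closed_segment_def)
  qed
  have dE: "?d \<in> E" using U xz E by (auto intro: subspace_diff)
  have D: "(\<psi> has_real_derivative grad_on E f (?u t) \<bullet> ?d - grad_on E f x \<bullet> ?d - L * t * (norm ?d)\<^sup>2) (at t)"
    if t: "0 \<le> t" "t \<le> 1" for t
  proof -
    have "((\<lambda>t. f (?u t)) has_real_derivative grad_on E f (?u t) \<bullet> ?d) (at t)"
      by (rule has_real_derivative_along_line[OF E _ dE])
         (use u[OF t] xz U in \<open>auto intro!: has_derivative_grad_on[OF E] diff\<close>)
    then show ?thesis unfolding \<psi>_def by (auto intro!: derivative_eq_intros)
  qed
  have "\<psi> 1 \<le> \<psi> 0"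
  proof (rule DERIV_nonpos_imp_nonincreasing[of 0 1])
    fix t :: real assume t: "0 \<le> t" "t \<le> 1"
    have "grad_on E f (?u t) \<bullet> ?d - grad_on E f x \<bullet> ?d \<le> norm (grad_on E f (?u t) - grad_on E f x) * norm ?d"
      using norm_cauchy_schwarz by (simp flip: inner_diff_left)
    also have "\<dots> \<le> (L * dist (?u t) x) * norm ?d"
      using lipschitz_onD[OF lip u[OF t] xz(1)] by (intro mult_right_mono) (auto simp: dist_norm)
    also have "\<dots> = L * t * (norm ?d)\<^sup>2" using t by (simp add: dist_norm power2_eq_square)
    finally show "\<exists>y. (\<psi> has_real_derivative y) (at t) \<and> y \<le> 0" using D[OF t] by force
  qed simp
  then show ?thesis by (simp add: \<psi>_def)
qed

subsection \<open>The quadratic subproblem\<close>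

lemma inner_transpose_mult:
  fixes A :: "real^'n::finite^'m::finite"
  shows "(transpose A *v u) \<bullet> v = u \<bullet> (A *v v)"
  by (simp add: dot_lmul_matrix transpose_matrix_vector)

lemma norm_matrix_vector_le: "norm (A *v v) \<le> spectral_norm A * norm (v :: real^'n::finite)"
  for A :: "real^'n^'m::finite"
  unfolding spectral_norm_def by (rule onorm) (rule matrix_vector_mul_bounded_linear)

lemma borel_measurable_vec_lambda:
  fixes v :: "'i::finite \<Rightarrow> 'a \<Rightarrow> 'b::euclidean_space"
  assumes "\<And>i. v i \<in> borel_measurable F"
  shows "(\<lambda>\<omega>. \<chi> i. v i \<omega>) \<in> borel_measurable F"
proof (rule borel_measurable_euclidean_space[THEN iffD2], rule)
  fix b :: "'b^'i" assume "b \<in> Basis"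
  then obtain i u where b: "b = axis i u" by (auto simp: Basis_vec_def)
  show "(\<lambda>\<omega>. (\<chi> i. v i \<omega>) \<bullet> b) \<in> borel_measurable F"
    unfolding b inner_axis vec_lambda_beta by (intro borel_measurable_inner assms borel_measurable_const)
qed

lemma borel_measurable_vec_component:
  fixes v :: "'a \<Rightarrow> 'b::euclidean_space^'i::finite"
  assumes "v \<in> borel_measurable F"
  shows "(\<lambda>\<omega>. v \<omega> $ i) \<in> borel_measurable F"
  by (rule borel_measurable_continuous_on[OF _ assms]) (intro continuous_intros)

text \<open>The vectors \<open>q i\<close> gather all that the y-step takes from the x-blocks and
  the multipliers, so that the dependence of the minimizer on this data can be studied
  separately.\<close>

definition y_subproblem ::
  "(real^'y \<Rightarrow> ereal) \<Rightarrow> ('i::finite \<Rightarrow> real^'y^'m) \<Rightarrow> ('i \<Rightarrow> real) \<Rightarrow> ('i \<Rightarrow> real^'m) \<Rightarrow> real^'y::finite \<Rightarrow> bool"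
  where "y_subproblem g B \<gamma> q = is_arg_min
     (\<lambda>z. g z + ereal (1/2 * (\<Sum>i\<in>UNIV. \<gamma> i * (norm (q i + B i *v z))\<^sup>2))) (\<lambda>z. True)"

text \<open>In the iteration \<open>\<gamma> i *\<^sub>R (q i + B i *v p)\<close> is the updated
  multiplier, so the inequality becomes the subgradient inequality of g for the new
  multipliers.\<close>

lemma y_subproblem_variational:
  fixes B :: "'i::finite \<Rightarrow> real^'y::finite^'m::finite"
  assumes cc: "closed_convex_fun UNIV g" and ne: "edom UNIV g \<noteq> {}" and p: "y_subproblem g B \<gamma> q p"
  shows "p \<in> edom UNIV g"
    and "z \<in> edom UNIV g \<Longrightarrow> real_of_ereal (g p) \<le> real_of_ereal (g z) +
      (\<Sum>i\<in>UNIV. \<gamma> i * ((q i + B i *v p) \<bullet> (B i *v (z - p))))"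
proof -
  let ?h = "\<lambda>z. 1/2 * (\<Sum>i\<in>UNIV. \<gamma> i * (norm (q i + B i *v z))\<^sup>2)"
  have le: "g p + ereal (?h p) \<le> g w + ereal (?h w)" for w
    using p unfolding y_subproblem_def is_arg_min_linorder by auto
  obtain w0 where w0: "w0 \<in> edom UNIV g" using ne by auto
  have "g p + ereal (?h p) < \<infinity>"
    by (rule le_less_trans[OF le[of w0]]) (subst closed_convex_fun_finite[OF cc w0], simp)
  then show d: "p \<in> edom UNIV g" by (auto simp: edom_def)
  assume z: "z \<in> edom UNIV g"
  show "real_of_ereal (g p) \<le> real_of_ereal (g z) +
      (\<Sum>i\<in>UNIV. \<gamma> i * ((q i + B i *v p) \<bullet> (B i *v (z - p))))"
  proof (rule variational_inequality[OF cc d z, where h = ?h and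
      q = "1/2 * (\<Sum>i\<in>UNIV. \<gamma> i * (norm (B i *v (z - p)))\<^sup>2)"])
    fix w assume w: "w \<in> edom UNIV g"
    show "real_of_ereal (g p) + ?h p \<le> real_of_ereal (g w) + ?h w"
    proof -
      obtain a a' where "g w = ereal a" "g p = ereal a'"
        using closed_convex_fun_finite[OF cc w] closed_convex_fun_finite[OF cc d] by blast
      with le[of w] show ?thesis by simp
    qed
  next
    fix t :: real
    have "q i + B i *v (p + t *\<^sub>R (z - p)) = (q i + B i *v p) + t *\<^sub>R (B i *v (z - p))" for i
      by (simp add: matrix_vector_right_distrib matrix_vector_mult_scaleR)
    then have "?h (p + t *\<^sub>R (z - p)) = 1/2 * (\<Sum>i\<in>UNIV. \<gamma> i * ((norm (q i + B i *v p))\<^sup>2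
        + t * (2 * ((q i + B i *v p) \<bullet> (B i *v (z - p)))) + t\<^sup>2 * (norm (B i *v (z - p)))\<^sup>2))"
      by (simp only: norm_add_scaleR_power2)
    also have "\<dots> = ?h p + t * (\<Sum>i\<in>UNIV. \<gamma> i * ((q i + B i *v p) \<bullet> (B i *v (z - p))))
        + t\<^sup>2 * (1/2 * (\<Sum>i\<in>UNIV. \<gamma> i * (norm (B i *v (z - p)))\<^sup>2))"
      by (simp add: sum_distrib_left sum.distrib[symmetric] algebra_simps)
    finally show "?h (p + t *\<^sub>R (z - p)) = \<dots>" .
  qed
qed

text \<open>As for the proximal map, each optimality condition is tested at the other minimizer.
  Young's inequality is applied block by block, so the weights \<open>\<gamma> i\<close> appear in
  the same way on both sides.\<close>

lemma y_subproblem_nonexpansive: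
  fixes B :: "'i::finite \<Rightarrow> real^'y::finite^'m::finite"
  assumes cc: "closed_convex_fun UNIV g" and ne: "edom UNIV g \<noteq> {}" and \<gamma>: "\<And>i. \<gamma> i > 0"
    and p: "y_subproblem g B \<gamma> q p" and p': "y_subproblem g B \<gamma> q' p'"
  shows "(\<Sum>i\<in>UNIV. \<gamma> i * (norm (B i *v p - B i *v p'))\<^sup>2) \<le> (\<Sum>i\<in>UNIV. \<gamma> i * (norm (q i - q' i))\<^sup>2)"
proof -
  note v = y_subproblem_variational[OF cc ne p] and v' = y_subproblem_variational[OF cc ne p']
  have "0 \<le> (\<Sum>i\<in>UNIV. \<gamma> i * ((q i + B i *v p) \<bullet> (B i *v (p' - p)))) +
      (\<Sum>i\<in>UNIV. \<gamma> i * ((q' i + B i *v p') \<bullet> (B i *v (p - p'))))"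
    using v(2)[OF v'(1)] v'(2)[OF v(1)] by linarith
  also have "\<dots> = (\<Sum>i\<in>UNIV. \<gamma> i * ((q i + B i *v p) \<bullet> (B i *v (p' - p)) + (q' i + B i *v p') \<bullet> (B i *v (p - p'))))"
    by (simp add: sum.distrib distrib_left)
  also have "\<dots> \<le> (\<Sum>i\<in>UNIV. \<gamma> i * (1/2 * (norm (q i - q' i))\<^sup>2 - 1/2 * (norm (B i *v p - B i *v p'))\<^sup>2))"
  proof (intro sum_mono mult_left_mono)
    fix i
    let ?a = "q i - q' i" and ?e = "B i *v p - B i *v p'"
    have "- (?a \<bullet> ?e) - (norm ?e)\<^sup>2 \<le> 1/2 * (norm ?a)\<^sup>2 - 1/2 * (norm ?e)\<^sup>2"
      using norm_add_scaleR_power2[of ?a 1 ?e, unfolded one_power2 mult_1]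
        zero_le_power2[of "norm (?a + 1 *\<^sub>R ?e)"] by linarith
    moreover have "(q i + B i *v p) \<bullet> (B i *v (p' - p)) + (q' i + B i *v p') \<bullet> (B i *v (p - p'))
       = - (?a \<bullet> ?e) - (norm ?e)\<^sup>2"
      unfolding power2_norm_eq_inner by (simp add: inner_simps inner_commute matrix_vector_mult_diff_distrib)
    ultimately show "(q i + B i *v p) \<bullet> (B i *v (p' - p)) + (q' i + B i *v p') \<bullet> (B i *v (p - p'))
       \<le> 1/2 * (norm ?a)\<^sup>2 - 1/2 * (norm ?e)\<^sup>2" by simp
    show "0 \<le> \<gamma> i" using \<gamma>[of i] by simp
  qed
  finally have "0 \<le> 1/2 * ((\<Sum>i\<in>UNIV. \<gamma> i * (norm (q i - q' i))\<^sup>2) - (\<Sum>i\<in>UNIV. \<gamma> i * (norm (B i *v p - B i *v p'))\<^sup>2))"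
    by (simp add: sum_distrib_left sum_subtractf algebra_simps flip: sum_divide_distrib)
  then show ?thesis by simp
qed

lemma norm_vec_power2: "(norm (v :: 'a::real_normed_vector^'i::finite))\<^sup>2 = (\<Sum>i\<in>UNIV. (norm (v $ i))\<^sup>2)"
  by (simp add: norm_vec_def L2_set_def sum_nonneg)

text \<open>The minimizer itself need not be unique or measurable in the data, but its images under the
  \<open>B i\<close> are Lipschitz in the data; only these images enter the next iteration.\<close>

lemma y_subproblem_measurable:
  fixes B :: "'i::finite \<Rightarrow> real^'y::finite^'m::finite"
  assumes cc: "closed_convex_fun UNIV g" and ne: "edom UNIV g \<noteq> {}" and \<gamma>: "\<And>i. \<gamma> i > 0"
    and q: "\<And>i. q i \<in> borel_measurable F"
    and p: "\<And>\<omega>. \<omega> \<in> space F \<Longrightarrow> y_subproblem g B \<gamma> (\<lambda>i. q i \<omega>) (p \<omega>)"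
  shows "(\<lambda>\<omega>. B j *v p \<omega>) \<in> borel_measurable F"
proof -
  \<comment> \<open>Scaling by \<open>sqrt (\<gamma> i)\<close> turns the weighted norm into the
    Euclidean one. S collects the data for which a minimizer exists; existence is known only for the
    data that occur on sample paths.\<close>
  define S where "S = {u::real^'m^'i. \<exists>z. y_subproblem g B \<gamma> (\<lambda>i. u $ i /\<^sub>R sqrt (\<gamma> i)) z}"
  define \<psi> where "\<psi> u = (\<chi> i. sqrt (\<gamma> i) *\<^sub>R (B i *v (SOME z. y_subproblem g B \<gamma> (\<lambda>i. u $ i /\<^sub>R sqrt (\<gamma> i)) z)))" for u :: "real^'m^'i"
  have *: "norm (\<psi> u - (\<chi> i. sqrt (\<gamma> i) *\<^sub>R (B i *v z))) \<le> norm (u - u')"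
    if u: "u \<in> S" and z: "y_subproblem g B \<gamma> (\<lambda>i. u' $ i /\<^sub>R sqrt (\<gamma> i)) z" for u u' z
  proof -
    define z0 where "z0 = (SOME z. y_subproblem g B \<gamma> (\<lambda>i. u $ i /\<^sub>R sqrt (\<gamma> i)) z)"
    have z0: "y_subproblem g B \<gamma> (\<lambda>i. u $ i /\<^sub>R sqrt (\<gamma> i)) z0"
      using u unfolding S_def z0_def by (auto intro: someI)
    have eq1: "\<gamma> i * (norm (u $ i /\<^sub>R sqrt (\<gamma> i) - u' $ i /\<^sub>R sqrt (\<gamma> i)))\<^sup>2 = (norm (u $ i - u' $ i))\<^sup>2" for i
    proof -
      have "u $ i /\<^sub>R sqrt (\<gamma> i) - u' $ i /\<^sub>R sqrt (\<gamma> i) = (u $ i - u' $ i) /\<^sub>R sqrt (\<gamma> i)"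
        by (simp add: scaleR_diff_right)
      then show ?thesis using \<gamma>[of i] by (simp add: power_mult_distrib power_inverse)
    qed
    have eq2: "(norm (sqrt (\<gamma> i) *\<^sub>R (B i *v z0) - sqrt (\<gamma> i) *\<^sub>R (B i *v z)))\<^sup>2 = \<gamma> i * (norm (B i *v z0 - B i *v z))\<^sup>2" for i
      using \<gamma>[of i] by (simp add: power_mult_distrib flip: scaleR_diff_right)
    have "(norm (\<psi> u - (\<chi> i. sqrt (\<gamma> i) *\<^sub>R (B i *v z))))\<^sup>2 \<le> (norm (u - u'))\<^sup>2"
      using y_subproblem_nonexpansive[OF cc ne \<gamma> z0 z]
      by (simp add: norm_vec_power2[where 'a = "real^'m"] \<psi>_def eq1 eq2 flip: z0_def)
    then show ?thesis by (rule power2_le_imp_le) simp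
  qed
  have "1-lipschitz_on S \<psi>"
  proof (rule lipschitz_onI)
    fix u u' assume "u \<in> S" "u' \<in> S"
    moreover from \<open>u' \<in> S\<close> have "y_subproblem g B \<gamma> (\<lambda>i. u' $ i /\<^sub>R sqrt (\<gamma> i)) (SOME z. y_subproblem g B \<gamma> (\<lambda>i. u' $ i /\<^sub>R sqrt (\<gamma> i)) z)"
      unfolding S_def by (auto intro: someI)
    ultimately show "dist (\<psi> u) (\<psi> u') \<le> 1 * dist u u'"
      using *[of u u'] by (simp add: dist_norm \<psi>_def)
  qed simp
  \<comment> \<open>S itself might fail to be Borel; its closure is Borel, and a Lipschitz map
    extends to it.\<close>
  then obtain \<psi>' where \<psi>': "1-lipschitz_on (closure S) \<psi>'" "\<And>u. u \<in> S \<Longrightarrow> \<psi>' u = \<psi> u"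
    using lipschitz_extend_closure by blast
  define u where "u \<omega> = (\<chi> i. sqrt (\<gamma> i) *\<^sub>R q i \<omega>)" for \<omega>
  have uq: "(\<lambda>i. u \<omega> $ i /\<^sub>R sqrt (\<gamma> i)) = (\<lambda>i. q i \<omega>)" for \<omega>
  proof
    fix i show "u \<omega> $ i /\<^sub>R sqrt (\<gamma> i) = q i \<omega>" using \<gamma>[of i] by (simp add: u_def)
  qed
  have uS: "u \<omega> \<in> S" if "\<omega> \<in> space F" for \<omega>
    using p[OF that] uq unfolding S_def by auto
  have eq: "B j *v p \<omega> = \<psi>' (u \<omega>) $ j /\<^sub>R sqrt (\<gamma> j)" if \<omega>: "\<omega> \<in> space F" for \<omega>
  proof -
    have "\<psi> (u \<omega>) = (\<chi> i. sqrt (\<gamma> i) *\<^sub>R (B i *v p \<omega>))"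
      using *[OF uS[OF \<omega>], of "u \<omega>" "p \<omega>"] p[OF \<omega>] by (simp add: uq)
    then show ?thesis using \<psi>'(2)[OF uS[OF \<omega>]] \<gamma>[of j] by simp
  qed
  have "u \<in> borel_measurable F"
    unfolding u_def by (intro borel_measurable_vec_lambda borel_measurable_scaleR borel_measurable_const q)
  moreover have "closed (closure S)" by simp
  moreover have "\<psi>' \<in> borel_measurable (restrict_space borel (closure S))"
    using lipschitz_on_continuous_on[OF \<psi>'(1)] by (rule borel_measurable_continuous_on_restrict)
  moreover have "u \<in> measurable F (restrict_space borel (closure S))"
    using calculation(1) uS closure_subset by (intro measurable_restrict_space2) auto
  ultimately have "(\<lambda>\<omega>. \<psi>' (u \<omega>)) \<in> borel_measurable F" by (auto intro: measurable_compose)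
  then have "(\<lambda>\<omega>. \<psi>' (u \<omega>) $ j /\<^sub>R sqrt (\<gamma> j)) \<in> borel_measurable F"
    by (intro borel_measurable_scaleR borel_measurable_const borel_measurable_vec_component)
  then show ?thesis by (subst measurable_cong[OF eq])
qed


subsection \<open>Deterministic analysis of one sample path\<close>

lemma sum_neq_MInfty:
  fixes h :: "'a \<Rightarrow> ereal"
  assumes "\<And>i. i \<in> S \<Longrightarrow> h i \<noteq> -\<infinity>"
  shows "sum h S \<noteq> -\<infinity>"
  using assms by (induct S rule: infinite_finite_induct) auto

locale spg_problem =
  fixes J :: "'i::finite \<Rightarrow> 'n::finite set" and K :: "'i \<Rightarrow> 'm::finite set"
    and g :: "real^'y::finite \<Rightarrow> ereal"
    and \<xi> :: "'i \<Rightarrow> real^'n \<Rightarrow> ereal" and f :: "'i \<Rightarrow> real^'n \<Rightarrow> real"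
    and U :: "'i \<Rightarrow> (real^'n) set" and L \<gamma> :: "'i \<Rightarrow> real"
    and A :: "'i \<Rightarrow> real^'n^'m" and B :: "'i \<Rightarrow> real^'y^'m" and b :: "'i \<Rightarrow> real^'m"
  assumes xi_closed_convex: "\<And>i. closed_convex_fun (coords (J i)) (\<xi> i)"
    and xi_proper: "\<And>i. edom (coords (J i)) (\<xi> i) \<noteq> {}"
    and f_closed_convex: "\<And>i. closed_convex_fun (coords (J i)) (\<lambda>x. ereal (f i x))"
    and U_sub: "\<And>i. U i \<subseteq> coords (J i)"
    and U_dom: "\<And>i. edom (coords (J i)) (\<xi> i) \<subseteq> U i"
    and f_diff: "\<And>i x. x \<in> U i \<Longrightarrow> f i differentiable (at x within coords (J i))"
    and f_lipschitz: "\<And>i. (L i)-lipschitz_on (U i) (grad_on (coords (J i)) (f i))"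
    and g_closed_convex: "closed_convex_fun UNIV g"
    and g_proper: "edom UNIV g \<noteq> {}"
    and A_dims: "\<And>i. matrix_on (K i) (J i) (A i)"
    and B_dims: "\<And>i. matrix_on (K i) UNIV (B i)"
    and b_dims: "\<And>i. b i \<in> coords (K i)"
    and gamma_pos: "\<And>i. \<gamma> i > 0"
begin

abbreviation "xdom i \<equiv> edom (coords (J i)) (\<xi> i)"
abbreviation "grad i \<equiv> grad_on (coords (J i)) (f i)"
abbreviation "res \<equiv> residual A B b"
abbreviation "\<xi>r i v \<equiv> real_of_ereal (\<xi> i v)"
abbreviation "gr v \<equiv> real_of_ereal (g v)"

text \<open>\<open>real_of_ereal\<close> sends infinite values to 0, so F represents the objective
  only at points satisfying \<open>finite_point\<close>.\<close>

definition F :: "real^'n^'i \<Rightarrow> real^'y \<Rightarrow> real" where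
  "F x y = gr y + (\<Sum>i\<in>UNIV. \<xi>r i (x $ i) + f i (x $ i))"

definition finite_point :: "real^'n^'i \<Rightarrow> real^'y \<Rightarrow> bool" where
  "finite_point x y \<longleftrightarrow> (\<forall>i. x $ i \<in> xdom i) \<and> y \<in> edom UNIV g"

lemma objective_finite: "finite_point x y \<Longrightarrow> objective g \<xi> f x y = ereal (F x y)"
proof -
  assume *: "finite_point x y"
  have "\<forall>i. \<exists>r. \<xi> i (x $ i) = ereal r"
    using closed_convex_fun_finite[OF xi_closed_convex] * unfolding finite_point_def by blast
  then obtain r where r: "\<And>i. \<xi> i (x $ i) = ereal (r i)" by metis
  obtain s where "g y = ereal s"
    using closed_convex_fun_finite[OF g_closed_convex] * unfolding finite_point_def by blast
  with r show ?thesis by (simp add: objective_def F_def)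
qed

lemma objective_infinite: "x \<in> block_coords J \<Longrightarrow> \<not> finite_point x y \<Longrightarrow> objective g \<xi> f x y = \<infinity>"
proof -
  assume x: "x \<in> block_coords J" and n: "\<not> finite_point x y"
  have ge: "\<xi> i (x $ i) \<noteq> -\<infinity>" for i
    using xi_closed_convex[of i] x by (auto simp: closed_convex_fun_def block_coords_def)
  have gg: "g y \<noteq> -\<infinity>" using g_closed_convex by (auto simp: closed_convex_fun_def)
  have *: "\<xi> i (x $ i) + ereal (f i (x $ i)) \<noteq> -\<infinity>" for i using ge[of i] by (cases "\<xi> i (x $ i)") auto
  then have s: "(\<Sum>i\<in>UNIV. \<xi> i (x $ i) + ereal (f i (x $ i))) \<noteq> -\<infinity>"
    by (intro sum_neq_MInfty) auto
  show ?thesis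
  proof (cases "y \<in> edom UNIV g")
    case False
    then show ?thesis using s by (auto simp: edom_def objective_def)
  next
    case True
    then obtain i where "x $ i \<notin> xdom i" using n by (auto simp: finite_point_def)
    then have "\<xi> i (x $ i) = \<infinity>" using x by (auto simp: edom_def block_coords_def)
    then have "(\<Sum>i\<in>UNIV. \<xi> i (x $ i) + ereal (f i (x $ i))) = \<infinity>"
      using * by (auto simp: sum_Pinfty)
    then show ?thesis using gg by (simp add: objective_def)
  qed
qed

lemma finite_point_block_coords: "finite_point x y \<Longrightarrow> x \<in> block_coords J"
  by (auto simp: finite_point_def block_coords_def edom_def)

lemma residual_coords: "residual A B b i v y \<in> coords (K i)"
  using A_dims[of i] B_dims[of i] b_dims[of i]
  by (auto simp: residual_def coords_def matrix_on_def matrix_vector_mult_def)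

text \<open>Comparison with any finite point forces the primal part into the domain, and maximality
  in the multiplier forces feasibility. The Lagrangian at the saddle point is then F itself, and the
  rest of the proof can work with real numbers.\<close>

lemma optimal_iff:
  "(xs, ys, ls) \<in> primal_dual_optimal J K g \<xi> f A B b \<longleftrightarrow>
     finite_point xs ys \<and> ls \<in> block_coords K \<and> (\<forall>i. res i (xs $ i) ys = 0) \<and>
     (\<forall>x y. finite_point x y \<longrightarrow> F xs ys \<le> F x y + (\<Sum>i\<in>UNIV. (ls $ i) \<bullet> res i (x $ i) y))"
  (is "?L \<longleftrightarrow> ?R")
proof
  assume opt: ?L
  then have xs: "xs \<in> block_coords J" and lsK: "ls \<in> block_coords K" and
    o1: "\<And>x y. x \<in> block_coords J \<Longrightarrow> lagrangian g \<xi> f A B b xs ys ls \<le> lagrangian g \<xi> f A B b x y ls" and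
    o2: "\<And>l. l \<in> block_coords K \<Longrightarrow> lagrangian g \<xi> f A B b xs ys l \<le> lagrangian g \<xi> f A B b xs ys ls"
    by (auto simp: primal_dual_optimal_def)
  have fin: "finite_point xs ys"
  proof (rule ccontr)
    assume n: "\<not> finite_point xs ys"
    have "\<forall>i. \<exists>v. v \<in> xdom i" using xi_proper by blast
    then obtain v where v: "\<And>i. v i \<in> xdom i" by metis
    obtain y where "y \<in> edom UNIV g" using g_proper by auto
    with v have fp: "finite_point (\<chi> i. v i) y" by (simp add: finite_point_def)
    from o1[OF finite_point_block_coords[OF fp], of y] show False
      using objective_infinite[OF xs n] objective_finite[OF fp] by (simp add: lagrangian_def)
  qed
  have r0: "res i (xs $ i) ys = 0" for i
  proof -
    \<comment> \<open>Moving the multiplier along the residual raises the Lagrangian by the squared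
      residual. The move is admissible since residuals lie in \<open>coords (K i)\<close>.\<close>
    let ?l = "\<chi> i. ls $ i + res i (xs $ i) ys"
    have "?l \<in> block_coords K"
      using lsK residual_coords by (auto simp: block_coords_def intro: subspace_add[OF subspace_coords])
    from o2[OF this] have "(\<Sum>i\<in>UNIV. res i (xs $ i) ys \<bullet> res i (xs $ i) ys) \<le> 0"
      by (simp add: lagrangian_def objective_finite[OF fin] inner_add_left sum.distrib)
    then have "(\<Sum>i\<in>UNIV. res i (xs $ i) ys \<bullet> res i (xs $ i) ys) = 0"
      by (intro antisym sum_nonneg) auto
    then show ?thesis by (subst (asm) sum_nonneg_eq_0_iff) auto
  qed
  moreover have "F xs ys \<le> F x y + (\<Sum>i\<in>UNIV. (ls $ i) \<bullet> res i (x $ i) y)" if fp: "finite_point x y" for x y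
    using o1[OF finite_point_block_coords[OF fp], of y] objective_finite[OF fp] objective_finite[OF fin] r0
    by (simp add: lagrangian_def)
  ultimately show ?R using fin lsK by blast
next
  assume R: ?R
  then have fin: "finite_point xs ys" and r0: "\<And>i. res i (xs $ i) ys = 0" by auto
  show ?L unfolding primal_dual_optimal_def
  proof (clarify, intro conjI ballI allI)
    show "xs \<in> block_coords J" using finite_point_block_coords[OF fin] .
    show "ls \<in> block_coords K" using R by auto
    fix x y assume x: "x \<in> block_coords J"
    show "lagrangian g \<xi> f A B b xs ys ls \<le> lagrangian g \<xi> f A B b x y ls"
    proof (cases "finite_point x y")
      case True
      then show ?thesis using R by (auto simp: lagrangian_def objective_finite r0)
    next
      case False
      then show ?thesis using objective_infinite[OF x] by (simp add: lagrangian_def)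
    qed
  qed (auto simp: lagrangian_def r0)
qed

text \<open>Jensen's inequality for each summand of F. The indices start at 1 because the starting
  x-blocks may lie outside the domains.\<close>

lemma F_average:
  assumes t: "t \<ge> (1::nat)" and fp: "\<And>k. k \<ge> 1 \<Longrightarrow> finite_point (x k) (y k)"
  shows "finite_point (avg x t) (avg y t)" "F (avg x t) (avg y t) \<le> (\<Sum>k=1..t. F (x k) (y k)) / real t"
proof -
  let ?S = "{1..t}"
  have avg: "avg s t = (\<Sum>k\<in>?S. (1/real t) *\<^sub>R s k)" for s :: "nat \<Rightarrow> 'z::real_vector"
    by (simp add: avg_def scaleR_sum_right)
  have w: "(\<Sum>k\<in>?S. 1/real t) = 1" using t by simp
  have w0: "0 \<le> 1 / real t" by simp
  have nth: "avg x t $ i = (\<Sum>k\<in>?S. (1/real t) *\<^sub>R (x k $ i))" for i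
    by (simp add: avg)
  have dx: "x k $ i \<in> xdom i" if "k \<in> ?S" for i k using fp[of k] that by (auto simp: finite_point_def)
  have dy: "y k \<in> edom UNIV g" if "k \<in> ?S" for k using fp[of k] that by (auto simp: finite_point_def)
  have X: "avg x t $ i \<in> xdom i" "\<xi>r i (avg x t $ i) \<le> (\<Sum>k\<in>?S. 1/real t * \<xi>r i (x k $ i))" for i
    unfolding nth by (intro closed_convex_fun_sum[OF xi_closed_convex _ w w0 dx]; simp)+
  have Y: "avg y t \<in> edom UNIV g" "gr (avg y t) \<le> (\<Sum>k\<in>?S. 1/real t * gr (y k))"
    unfolding avg by (intro closed_convex_fun_sum[OF g_closed_convex _ w w0 dy]; simp)+
  have df: "x k $ i \<in> edom (coords (J i)) (\<lambda>x. ereal (f i x))" if "k \<in> ?S" for i k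
    using dx[OF that] by (auto simp: edom_def)
  have Fx: "f i (avg x t $ i) \<le> (\<Sum>k\<in>?S. 1/real t * f i (x k $ i))" for i
    unfolding nth using closed_convex_fun_sum(2)[OF f_closed_convex _ w w0 df] by simp
  show "finite_point (avg x t) (avg y t)" using X(1) Y(1) by (auto simp: finite_point_def)
  have "F (avg x t) (avg y t) \<le> (\<Sum>k\<in>?S. 1/real t * gr (y k)) +
     (\<Sum>i\<in>UNIV. (\<Sum>k\<in>?S. 1/real t * \<xi>r i (x k $ i)) + (\<Sum>k\<in>?S. 1/real t * f i (x k $ i)))"
    unfolding F_def using X(2) Y(2) Fx by (intro add_mono sum_mono) auto
  also have "\<dots> = (\<Sum>k\<in>?S. 1/real t * (gr (y k) + (\<Sum>i\<in>UNIV. \<xi>r i (x k $ i) + f i (x k $ i))))"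
    unfolding sum.distrib[symmetric] by (subst sum.swap) (simp add: sum.distrib sum_distrib_left distrib_left flip: sum_divide_distrib)
  also have "\<dots> = (\<Sum>k=1..t. F (x k) (y k)) / real t"
    by (simp add: F_def sum_divide_distrib)
  finally show "F (avg x t) (avg y t) \<le> (\<Sum>k=1..t. F (x k) (y k)) / real t" .
qed

lemma residual_average:
  assumes t: "t \<ge> (1::nat)"
  shows "res i (avg x t $ i) (avg y t) = (1 / real t) *\<^sub>R (\<Sum>k=1..t. res i (x k $ i) (y k))"
proof -
  have "(\<Sum>k=1..t. res i (x k $ i) (y k)) = A i *v (\<Sum>k=1..t. x k $ i) + B i *v (\<Sum>k=1..t. y k) - real t *\<^sub>R b i"
    by (simp add: residual_def sum.distrib sum_subtractf matrix_vector_right_distrib linear_sum[OF matrix_vector_mul_linear] scaleR_conv_of_real sum_constant_scaleR)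
  then show ?thesis
    using t by (simp add: residual_def avg_def matrix_vector_mult_scaleR scaleR_add_right scaleR_diff_right)
qed

end

section \<open>One-step inequality along a sample path\<close>

text \<open>Here \<open>a\<close> and \<open>a'\<close> stand for the old and new x-error under
  \<open>A i\<close>, \<open>p\<close> and \<open>p'\<close> for the y-error under
  \<open>B i\<close>, and \<open>\<mu>\<close> for an arbitrary multiplier. The left side collects
  the multiplier terms of the x-step, the y-step and the residual. The x-step sees the old
  \<open>a\<close> and \<open>p\<close>, hence the differences on the right. The last inner product
  is the one whose sign comes from monotonicity of the subdifferential of g.\<close>

lemma admm_block_identity:
  fixes a a' p p' l \<mu> :: "'a::real_inner" and \<gamma> :: real
  assumes "\<gamma> > 0"
  defines "l' \<equiv> l + \<gamma> *\<^sub>R (a' + p')"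
  shows "- ((l + \<gamma> *\<^sub>R (a + p)) \<bullet> a') - l' \<bullet> p' + \<mu> \<bullet> (a' + p') =
     1/(2*\<gamma>) * ((norm (\<mu> - l))\<^sup>2 - (norm (\<mu> - l'))\<^sup>2 - (norm (l' - l))\<^sup>2)
     + \<gamma>/2 * ((norm (a' - a))\<^sup>2 + (norm a')\<^sup>2 - (norm a)\<^sup>2)
     + \<gamma>/2 * ((norm p)\<^sup>2 - (norm p')\<^sup>2 - (norm (p' - p))\<^sup>2) + (l' - l) \<bullet> (p' - p)"
proof -
  let ?r = "a' + p'"
  have "(norm (\<mu> - l'))\<^sup>2 = (norm ((\<mu> - l) + (- \<gamma>) *\<^sub>R ?r))\<^sup>2" by (simp add: l'_def algebra_simps)
  also have "\<dots> = (norm (\<mu> - l))\<^sup>2 - 2 * \<gamma> * ((\<mu> - l) \<bullet> ?r) + \<gamma>\<^sup>2 * (norm ?r)\<^sup>2"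
    by (simp only: norm_add_scaleR_power2) simp
  finally have e1: "(norm (\<mu> - l'))\<^sup>2 = (norm (\<mu> - l))\<^sup>2 - 2 * \<gamma> * ((\<mu> - l) \<bullet> ?r) + \<gamma>\<^sup>2 * (norm ?r)\<^sup>2" .
  have e2: "(norm (l' - l))\<^sup>2 = \<gamma>\<^sup>2 * (norm ?r)\<^sup>2" by (simp add: l'_def power_mult_distrib)
  have "(norm (\<mu> - l))\<^sup>2 - (norm (\<mu> - l'))\<^sup>2 - (norm (l' - l))\<^sup>2
      = 2 * \<gamma> * ((\<mu> - l) \<bullet> ?r - \<gamma> * (norm ?r)\<^sup>2)"
    unfolding e1 e2 by (simp add: right_diff_distrib power2_eq_square)
  then have "1/(2*\<gamma>) * ((norm (\<mu> - l))\<^sup>2 - (norm (\<mu> - l'))\<^sup>2 - (norm (l' - l))\<^sup>2)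
      = (\<mu> - l) \<bullet> ?r - \<gamma> * (norm ?r)\<^sup>2" using assms(1) by simp
  then show ?thesis
    unfolding l'_def power2_norm_eq_inner
    by (simp add: inner_simps inner_commute algebra_simps add_divide_distrib diff_divide_distrib)
qed

lemma inner_diff_eq_norms:
  fixes u v w :: "'a::real_inner"
  shows "(u - v) \<bullet> (w - u) = 1/2 * ((norm (v - w))\<^sup>2 - (norm (u - w))\<^sup>2 - (norm (u - v))\<^sup>2)"
  unfolding power2_norm_eq_inner by (simp add: inner_simps inner_commute algebra_simps)

text \<open>A single sample path: the samples are fixed values, so everything proved here is
  deterministic and randomness shows only through \<open>noise\<close>.\<close>

locale spg_path = spg_problem J K g \<xi> f U L \<gamma> A B b
  for J :: "'i::finite \<Rightarrow> 'n::finite set" and K :: "'i \<Rightarrow> 'm::finite set"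
    and g :: "real^'y::finite \<Rightarrow> ereal"
    and \<xi> :: "'i \<Rightarrow> real^'n \<Rightarrow> ereal" and f :: "'i \<Rightarrow> real^'n \<Rightarrow> real"
    and U :: "'i \<Rightarrow> (real^'n) set" and L \<gamma> :: "'i \<Rightarrow> real"
    and A :: "'i \<Rightarrow> real^'n^'m" and B :: "'i \<Rightarrow> real^'y^'m" and b :: "'i \<Rightarrow> real^'m" +
  fixes step :: "'i \<Rightarrow> nat \<Rightarrow> real" and G :: "'i \<Rightarrow> real^'n \<Rightarrow> 's \<Rightarrow> real^'n" and \<nu> :: "'i \<Rightarrow> nat \<Rightarrow> 's"
    and x :: "nat \<Rightarrow> real^'n^'i" and y :: "nat \<Rightarrow> real^'y" and l :: "nat \<Rightarrow> real^'m^'i"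
  assumes path: "spg_admm_path J g \<xi> A B b \<gamma> step G \<nu> x y l"
    and step_pos: "\<And>i k. step i k > 0"
    and x0_U: "\<And>i. x 0 $ i \<in> U i"
    and x0_segments: "\<And>i z. z \<in> edom (coords (J i)) (\<xi> i) \<Longrightarrow> closed_segment (x 0 $ i) z \<subseteq> U i"
    and l0_dims: "l 0 \<in> block_coords K"
    and l0_subdiff: "- (\<Sum>i\<in>UNIV. transpose (B i) *v (l 0 $ i)) \<in> subdiff g (y 0)"
begin

definition noise :: "'i \<Rightarrow> nat \<Rightarrow> real^'n" where
  "noise i k = G i (x k $ i) (\<nu> i k) - grad i (x k $ i)"

lemma x_step: "x (Suc k) $ i = prox (coords (J i)) (\<lambda>z. ereal (step i k) * \<xi> i z)
             (x k $ i - step i k *\<^sub>R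
               (G i (x k $ i) (\<nu> i k) + transpose (A i) *v (l k $ i + \<gamma> i *\<^sub>R res i (x k $ i) (y k))))"
  and l_step: "l (Suc k) $ i = l k $ i + \<gamma> i *\<^sub>R res i (x (Suc k) $ i) (y (Suc k))"
  and y_step: "y_subproblem g B \<gamma> (\<lambda>i. A i *v x (Suc k) $ i - b i + (1 / \<gamma> i) *\<^sub>R (l k $ i)) (y (Suc k))"
proof -
  have *: "(\<forall>i. x (Suc k) $ i = prox (coords (J i)) (\<lambda>z. ereal (step i k) * \<xi> i z)
             (x k $ i - step i k *\<^sub>R
               (G i (x k $ i) (\<nu> i k) + transpose (A i) *v (l k $ i + \<gamma> i *\<^sub>R res i (x k $ i) (y k)))))"
    "is_arg_min
          (\<lambda>z. g z + ereal (1/2 * (\<Sum>i\<in>UNIV. \<gamma> i *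
             (norm (residual A B b i (x (Suc k) $ i) z + (1 / \<gamma> i) *\<^sub>R (l k $ i)))\<^sup>2)))
          (\<lambda>z. True) (y (Suc k))"
    "\<forall>i. l (Suc k) $ i = l k $ i + \<gamma> i *\<^sub>R res i (x (Suc k) $ i) (y (Suc k))"
    using path unfolding spg_admm_path_def by blast+
  from * show "x (Suc k) $ i = prox (coords (J i)) (\<lambda>z. ereal (step i k) * \<xi> i z)
             (x k $ i - step i k *\<^sub>R
               (G i (x k $ i) (\<nu> i k) + transpose (A i) *v (l k $ i + \<gamma> i *\<^sub>R res i (x k $ i) (y k))))"
    "l (Suc k) $ i = l k $ i + \<gamma> i *\<^sub>R res i (x (Suc k) $ i) (y (Suc k))" by blast+
  have eq: "residual A B b i (x (Suc k) $ i) z + (1 / \<gamma> i) *\<^sub>R (l k $ i)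
     = (A i *v x (Suc k) $ i - b i + (1 / \<gamma> i) *\<^sub>R (l k $ i)) + B i *v z" for i z
    by (simp add: residual_def)
  show "y_subproblem g B \<gamma> (\<lambda>i. A i *v x (Suc k) $ i - b i + (1 / \<gamma> i) *\<^sub>R (l k $ i)) (y (Suc k))"
    using *(2) unfolding y_subproblem_def eq .
qed

lemma x_dom: "x (Suc k) $ i \<in> xdom i"
  unfolding x_step by (rule prox_edom[OF xi_closed_convex xi_proper step_pos])

lemma x_U: "x k $ i \<in> U i"
  using x_dom U_dom x0_U by (cases k) auto

lemma segment_U: "z \<in> xdom i \<Longrightarrow> closed_segment (x k $ i) z \<subseteq> U i"
proof (cases k)
  case (Suc k')
  assume "z \<in> xdom i"
  then have "closed_segment (x k $ i) z \<subseteq> xdom i"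
    using x_dom[of k' i] Suc by (intro closed_segment_subset convex_edom[OF xi_closed_convex]) auto
  then show ?thesis using U_dom by blast
qed (use x0_segments in auto)

lemma l_dims: "l k \<in> block_coords K"
proof (induction k)
  case (Suc k)
  then show ?case
    unfolding block_coords_def mem_Collect_eq l_step
    by (auto intro!: subspace_add[OF subspace_coords] subspace_scale[OF subspace_coords] residual_coords)
qed (rule l0_dims)

text \<open>For positive k this is optimality of the y-step with the multiplier update inserted; for
  k = 0 it is the assumption on the initial multiplier. Starting at 0 allows two consecutive
  inequalities to be paired at every iteration.\<close>

lemma subgradient_g:
  shows y_dom: "y k \<in> edom UNIV g"
    and "z \<in> edom UNIV g \<Longrightarrow> gr (y k) \<le> gr z + (\<Sum>i\<in>UNIV. l k $ i \<bullet> (B i *v (z - y k)))"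
proof -
  have "y k \<in> edom UNIV g \<and> (\<forall>z\<in>edom UNIV g. gr (y k) \<le> gr z + (\<Sum>i\<in>UNIV. l k $ i \<bullet> (B i *v (z - y k))))"
  proof (cases k)
    case 0
    let ?s = "\<lambda>z. (\<Sum>i\<in>UNIV. l 0 $ i \<bullet> (B i *v (z - y 0)))"
    have ineq: "g (y 0) - ereal (?s z) \<le> g z" for z
      using l0_subdiff unfolding subdiff_def
      by (simp add: inner_sum_left inner_transpose_mult minus_ereal_def sum_negf del: transpose_matrix_vector)
    obtain z0 where z0: "z0 \<in> edom UNIV g" using g_proper by auto
    with ineq[of z0] have d: "y 0 \<in> edom UNIV g" by (auto simp: edom_def)
    have "gr (y 0) \<le> gr z + ?s z" if zd: "z \<in> edom UNIV g" for z
    proof -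
      obtain r r' where "g z = ereal r" "g (y 0) = ereal r'"
        using closed_convex_fun_finite[OF g_closed_convex zd] closed_convex_fun_finite[OF g_closed_convex d] by blast
      then show ?thesis using ineq[of z] by simp
    qed
    then show ?thesis using d 0 by simp
  next
    case (Suc k')
    note v = y_subproblem_variational[OF g_closed_convex g_proper y_step[of k']]
    have eq: "\<gamma> i * ((A i *v x (Suc k') $ i - b i + (1 / \<gamma> i) *\<^sub>R l k' $ i + B i *v y (Suc k')) \<bullet> w) = l (Suc k') $ i \<bullet> w" for i w
    proof -
      have "l (Suc k') $ i = \<gamma> i *\<^sub>R (A i *v x (Suc k') $ i - b i + (1 / \<gamma> i) *\<^sub>R l k' $ i + B i *v y (Suc k'))"
        using gamma_pos[of i] by (simp add: l_step residual_def algebra_simps)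
      then show ?thesis by simp
    qed
    show ?thesis using v unfolding eq Suc by blast
  qed
  then show "y k \<in> edom UNIV g"
    and "z \<in> edom UNIV g \<Longrightarrow> gr (y k) \<le> gr z + (\<Sum>i\<in>UNIV. l k $ i \<bullet> (B i *v (z - y k)))" by auto
qed

text \<open>Two consecutive subgradient inequalities of g, each tested at the other point, add up to
  this sign. It removes the cross term left over by \<open>admm_block_identity\<close>.\<close>

lemma y_monotone: "(\<Sum>i\<in>UNIV. (l (Suc k) $ i - l k $ i) \<bullet> (B i *v (y (Suc k) - y k))) \<le> 0"
proof -
  have "0 \<le> (\<Sum>i\<in>UNIV. l k $ i \<bullet> (B i *v (y (Suc k) - y k))) + (\<Sum>i\<in>UNIV. l (Suc k) $ i \<bullet> (B i *v (y k - y (Suc k))))"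
    using subgradient_g(2)[OF y_dom, of k "Suc k"] subgradient_g(2)[OF y_dom, of "Suc k" k] by linarith
  then show ?thesis
    by (simp add: matrix_vector_mult_diff_distrib inner_simps sum_subtractf)
qed

lemma subgradient_xi:
  assumes z: "z \<in> xdom i"
  shows "\<xi>r i (x (Suc k) $ i) \<le> \<xi>r i z + 1 / step i k * ((x (Suc k) $ i - x k $ i) \<bullet> (z - x (Suc k) $ i))
     + (noise i k + grad i (x k $ i)) \<bullet> (z - x (Suc k) $ i)
     + (l k $ i + \<gamma> i *\<^sub>R res i (x k $ i) (y k)) \<bullet> (A i *v (z - x (Suc k) $ i))"
proof -
  let ?c = "step i k" and ?p = "x (Suc k) $ i"
  let ?w = "G i (x k $ i) (\<nu> i k) + transpose (A i) *v (l k $ i + \<gamma> i *\<^sub>R res i (x k $ i) (y k))"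
  have "?c * \<xi>r i ?p \<le> ?c * \<xi>r i z + (?p - (x k $ i - ?c *\<^sub>R ?w)) \<bullet> (z - ?p)"
    using prox_variational[OF xi_closed_convex xi_proper step_pos[of i k] z, where v = "x k $ i - ?c *\<^sub>R ?w", folded x_step] .
  also have "\<dots> = ?c * (\<xi>r i z + 1 / ?c * ((?p - x k $ i) \<bullet> (z - ?p)) + ?w \<bullet> (z - ?p))"
    using step_pos[of i k] by (simp add: inner_simps field_simps)
  finally have "\<xi>r i ?p \<le> \<xi>r i z + 1 / ?c * ((?p - x k $ i) \<bullet> (z - ?p)) + ?w \<bullet> (z - ?p)"
    using step_pos[of i k] by (simp only: mult_le_cancel_left_pos)
  then show ?thesis by (simp add: noise_def inner_add_left inner_transpose_mult del: transpose_matrix_vector)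
qed

text \<open>The smooth part passes from the new iterate to \<open>x k\<close> by the descent lemma
  and from there to z by convexity; the proximal part is \<open>subgradient_xi\<close> with the
  three-point identity. All terms in the exact gradient cancel and only the noise stays.\<close>

lemma block_descent:
  assumes z: "z \<in> xdom i"
  shows "\<xi>r i (x (Suc k) $ i) + f i (x (Suc k) $ i) \<le> \<xi>r i z + f i z
     + 1 / (2 * step i k) * ((norm (x k $ i - z))\<^sup>2 - (norm (x (Suc k) $ i - z))\<^sup>2 - (norm (x (Suc k) $ i - x k $ i))\<^sup>2)
     + L i / 2 * (norm (x (Suc k) $ i - x k $ i))\<^sup>2 - noise i k \<bullet> (x (Suc k) $ i - z)
     - (l k $ i + \<gamma> i *\<^sub>R res i (x k $ i) (y k)) \<bullet> (A i *v (x (Suc k) $ i - z))"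
proof -
  let ?p = "x (Suc k) $ i" and ?x = "x k $ i"
  have xE: "?x \<in> coords (J i)" "z \<in> coords (J i)" using x_U U_sub U_dom z by blast+
  have "f i ?p \<le> f i ?x + grad i ?x \<bullet> (?p - ?x) + L i / 2 * (norm (?p - ?x))\<^sup>2"
    by (rule descent_lemma[OF subspace_coords segment_U[OF x_dom] U_sub f_diff f_lipschitz])
  moreover have "f i ?x + grad i ?x \<bullet> (z - ?x) \<le> f i z"
    by (rule gradient_inequality[OF subspace_coords xE f_diff[OF x_U] f_closed_convex])
  moreover have "grad i ?x \<bullet> (?p - ?x) - grad i ?x \<bullet> (z - ?x) = - (grad i ?x \<bullet> (z - ?p))"
    by (simp add: inner_simps)
  moreover have "1 / step i k * ((?p - ?x) \<bullet> (z - ?p)) =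
     1 / (2 * step i k) * ((norm (?x - z))\<^sup>2 - (norm (?p - z))\<^sup>2 - (norm (?p - ?x))\<^sup>2)"
    by (subst inner_diff_eq_norms) simp
  moreover have "(noise i k + grad i ?x) \<bullet> (z - ?p) = - (noise i k \<bullet> (?p - z)) + grad i ?x \<bullet> (z - ?p)"
    by (simp add: inner_simps)
  moreover have "(l k $ i + \<gamma> i *\<^sub>R res i ?x (y k)) \<bullet> (A i *v (z - ?p))
      = - ((l k $ i + \<gamma> i *\<^sub>R res i ?x (y k)) \<bullet> (A i *v (?p - z)))"
    by (simp add: matrix_vector_mult_diff_distrib inner_simps)
  ultimately show ?thesis using subgradient_xi[OF z, of k] by linarith
qed

text \<open>What is left of \<open>1 / step i k\<close> as coefficient of the squared x-increment
  once the Lipschitz error and the term in \<open>A i\<close> are paid. The upper bound on the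
  constant steps says that it is positive; for the decreasing steps it equals
  \<open>1 + sqrt k\<close>.\<close>

definition margin :: "'i \<Rightarrow> nat \<Rightarrow> real" where
  "margin i k = 1 / step i k - \<gamma> i * (spectral_norm (A i))\<^sup>2 - L i"

text \<open>The Lyapunov function. Its two x-terms together are the squared Q-norm of the error
  divided by 2c, with the current step for c. Only the first term contains
  \<open>lam\<close>.\<close>

definition potential :: "real^'n^'i \<Rightarrow> real^'y \<Rightarrow> ('i \<Rightarrow> real^'m) \<Rightarrow> nat \<Rightarrow> real" where
  "potential xs ys lam k = (\<Sum>i\<in>UNIV. 1 / (2 * \<gamma> i) * (norm (lam i - l k $ i))\<^sup>2
     + 1 / (2 * step i k) * (norm (x k $ i - xs $ i))\<^sup>2
     - \<gamma> i / 2 * (norm (A i *v (x k $ i - xs $ i)))\<^sup>2 + \<gamma> i / 2 * (norm (B i *v (y k - ys)))\<^sup>2)"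

text \<open>The decrease in excess of the potential difference. Its x-part absorbs the noise;
  without noise the whole of it forces the increments of the iterates to zero.\<close>

definition drop_term :: "nat \<Rightarrow> real" where
  "drop_term k = (\<Sum>i\<in>UNIV. margin i k / 2 * (norm (x (Suc k) $ i - x k $ i))\<^sup>2
     + 1 / (2 * \<gamma> i) * (norm (l (Suc k) $ i - l k $ i))\<^sup>2 + \<gamma> i / 2 * (norm (B i *v (y (Suc k) - y k)))\<^sup>2)"

lemma x_finite: "finite_point (x (Suc k)) (y (Suc k))"
  using x_dom y_dom by (auto simp: finite_point_def)

lemma norm_matrix_power2_le: "\<gamma> i * (norm (A i *v v))\<^sup>2 \<le> \<gamma> i * (spectral_norm (A i))\<^sup>2 * (norm v)\<^sup>2"
proof -
  have "(norm (A i *v v))\<^sup>2 \<le> (spectral_norm (A i) * norm v)\<^sup>2"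
    by (intro power_mono norm_matrix_vector_le) auto
  then show ?thesis using gamma_pos[of i] by (simp add: power_mult_distrib mult.assoc)
qed

text \<open>The sum over the blocks of \<open>block_descent\<close> and
  \<open>admm_block_identity\<close>, together with the subgradient inequality of g at the new
  point. The potential at \<open>Suc k\<close> is formed with the new step, whence the term with the
  change of \<open>1 / step\<close>. On the right \<open>lam\<close> occurs only in the
  potentials.\<close>

lemma one_step:
  assumes fin: "finite_point xs ys" and r0: "\<And>i. res i (xs $ i) ys = 0"
  shows "F (x (Suc k)) (y (Suc k)) - F xs ys + (\<Sum>i\<in>UNIV. lam i \<bullet> res i (x (Suc k) $ i) (y (Suc k)))
    \<le> potential xs ys lam k - potential xs ys lam (Suc k)
      + (\<Sum>i\<in>UNIV. 1/2 * (1 / step i (Suc k) - 1 / step i k) * (norm (x (Suc k) $ i - xs $ i))\<^sup>2)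
      - drop_term k - (\<Sum>i\<in>UNIV. noise i k \<bullet> (x (Suc k) $ i - xs $ i))"
proof -
  let ?p = "\<lambda>i. x (Suc k) $ i" and ?x = "\<lambda>i. x k $ i" and ?l = "\<lambda>i. l k $ i" and ?l' = "\<lambda>i. l (Suc k) $ i"
  let ?a = "\<lambda>i. A i *v (?x i - xs $ i)" and ?a' = "\<lambda>i. A i *v (?p i - xs $ i)"
  let ?b = "\<lambda>i. B i *v (y k - ys)" and ?b' = "\<lambda>i. B i *v (y (Suc k) - ys)"
  have resk: "res i (?x i) (y k) = ?a i + ?b i" "res i (?p i) (y (Suc k)) = ?a' i + ?b' i" for i
    using r0[of i] by (simp_all add: residual_def matrix_vector_mult_diff_distrib algebra_simps)
  have dif: "?a' i - ?a i = A i *v (?p i - ?x i)" "?b' i - ?b i = B i *v (y (Suc k) - y k)" for i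
    by (simp_all add: matrix_vector_mult_diff_distrib)
  have l': "?l' i = ?l i + \<gamma> i *\<^sub>R (?a' i + ?b' i)" for i by (simp add: l_step resk)
  \<comment> \<open>The new multiplier enters because it is the one that yields a subgradient of g
    at the new y.\<close>
  have gB: "gr (y (Suc k)) \<le> gr ys - (\<Sum>i\<in>UNIV. ?l' i \<bullet> ?b' i)"
    using subgradient_g(2)[of ys "Suc k"] fin
    by (simp add: finite_point_def matrix_vector_mult_diff_distrib inner_simps sum_subtractf)
  have blk: "\<xi>r i (?p i) + f i (?p i) - (\<xi>r i (xs $ i) + f i (xs $ i)) - ?l' i \<bullet> ?b' i + lam i \<bullet> (?a' i + ?b' i)
    \<le> 1 / (2 * \<gamma> i) * ((norm (lam i - ?l i))\<^sup>2 - (norm (lam i - ?l' i))\<^sup>2)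
      + 1 / (2 * step i k) * ((norm (?x i - xs $ i))\<^sup>2 - (norm (?p i - xs $ i))\<^sup>2)
      - \<gamma> i / 2 * ((norm (?a i))\<^sup>2 - (norm (?a' i))\<^sup>2) + \<gamma> i / 2 * ((norm (?b i))\<^sup>2 - (norm (?b' i))\<^sup>2)
      - (margin i k / 2 * (norm (?p i - ?x i))\<^sup>2 + 1 / (2 * \<gamma> i) * (norm (?l' i - ?l i))\<^sup>2
           + \<gamma> i / 2 * (norm (B i *v (y (Suc k) - y k)))\<^sup>2)
      - noise i k \<bullet> (?p i - xs $ i) + (?l' i - ?l i) \<bullet> (B i *v (y (Suc k) - y k))" for i
  proof -
    have "xs $ i \<in> xdom i" using fin by (simp add: finite_point_def)
    from block_descent[OF this, of k]
      admm_block_identity[OF gamma_pos, of "?l i" i "?a i" "?b i" "?a' i" "?b' i" "lam i", folded l', unfolded dif]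
      norm_matrix_power2_le[of i "?p i - ?x i"]
    show ?thesis unfolding resk margin_def
      by (simp add: algebra_simps add_divide_distrib diff_divide_distrib)
  qed
  have "F (x (Suc k)) (y (Suc k)) - F xs ys + (\<Sum>i\<in>UNIV. lam i \<bullet> res i (x (Suc k) $ i) (y (Suc k)))
    \<le> (\<Sum>i\<in>UNIV. \<xi>r i (?p i) + f i (?p i) - (\<xi>r i (xs $ i) + f i (xs $ i)) - ?l' i \<bullet> ?b' i + lam i \<bullet> (?a' i + ?b' i))"
    using gB by (simp add: F_def resk sum.distrib sum_subtractf)
  also have "\<dots> \<le> (\<Sum>i\<in>UNIV. 1 / (2 * \<gamma> i) * ((norm (lam i - ?l i))\<^sup>2 - (norm (lam i - ?l' i))\<^sup>2)
      + 1 / (2 * step i k) * ((norm (?x i - xs $ i))\<^sup>2 - (norm (?p i - xs $ i))\<^sup>2)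
      - \<gamma> i / 2 * ((norm (?a i))\<^sup>2 - (norm (?a' i))\<^sup>2) + \<gamma> i / 2 * ((norm (?b i))\<^sup>2 - (norm (?b' i))\<^sup>2)
      - (margin i k / 2 * (norm (?p i - ?x i))\<^sup>2 + 1 / (2 * \<gamma> i) * (norm (?l' i - ?l i))\<^sup>2
           + \<gamma> i / 2 * (norm (B i *v (y (Suc k) - y k)))\<^sup>2)
      - noise i k \<bullet> (?p i - xs $ i) + (?l' i - ?l i) \<bullet> (B i *v (y (Suc k) - y k)))"
    by (intro sum_mono blk)
  also have "\<dots> = potential xs ys lam k - potential xs ys lam (Suc k)
      + (\<Sum>i\<in>UNIV. 1/2 * (1 / step i (Suc k) - 1 / step i k) * (norm (x (Suc k) $ i - xs $ i))\<^sup>2)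
      - drop_term k - (\<Sum>i\<in>UNIV. noise i k \<bullet> (x (Suc k) $ i - xs $ i))
      + (\<Sum>i\<in>UNIV. (?l' i - ?l i) \<bullet> (B i *v (y (Suc k) - y k)))"
    unfolding potential_def drop_term_def sum_subtractf[symmetric] sum.distrib[symmetric]
    by (intro sum.cong refl) (simp add: algebra_simps)
  finally show ?thesis using y_monotone[of k] by linarith
qed

end

section \<open>Splitting the noise and the ergodic bounds\<close>

lemma sum_matrix_vector_mult:
  fixes M :: "'i \<Rightarrow> real^'n::finite^'m::finite"
  shows "(\<Sum>i\<in>S. M i) *v v = (\<Sum>i\<in>S. M i *v v)"
  by (induct S rule: infinite_finite_induct) (auto simp: matrix_vector_mult_add_rdistrib)

lemma inner_gram: "v \<bullet> ((transpose M ** M) *v v) = (norm (M *v v))\<^sup>2"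
  for M :: "real^'n::finite^'m::finite"
  unfolding matrix_vector_mul_assoc[symmetric] power2_norm_eq_inner
  by (subst inner_commute) (rule inner_transpose_mult)

lemma qform_identity_minus_gram:
  fixes M :: "real^'n::finite^'m::finite"
  shows "qform (mat 1 - a *\<^sub>R (transpose M ** M)) v = (norm v)\<^sup>2 - a * (norm (M *v v))\<^sup>2"
  by (simp add: qform_def matrix_vector_mult_diff_rdistrib inner_diff_right power2_norm_eq_inner
      scaleR_matrix_vector_assoc[symmetric] inner_gram[unfolded power2_norm_eq_inner])

lemma qform_gram_sum:
  fixes M :: "'i \<Rightarrow> real^'n::finite^'m::finite"
  shows "qform (\<Sum>i\<in>S. a i *\<^sub>R (transpose (M i) ** M i)) v = (\<Sum>i\<in>S. a i * (norm (M i *v v))\<^sup>2)"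
  by (simp add: qform_def sum_matrix_vector_mult inner_sum_right scaleR_matrix_vector_assoc[symmetric] inner_gram)

lemma norm_diff_power2_le: "(norm (u - v))\<^sup>2 \<le> 2 * ((norm u)\<^sup>2 + (norm v)\<^sup>2)" for u v :: "'a::real_inner"
  using norm_add_scaleR_power2[of u 1 v, unfolded one_power2 mult_1]
    norm_add_scaleR_power2[of u "-1" v] zero_le_power2[of "norm (u + 1 *\<^sub>R v)"] by simp

context spg_path
begin

text \<open>The noise is paired with \<open>x k\<close>, which depends on earlier samples only, so
  that this linear part can have mean zero; the squared noise pays for the passage from the new
  iterate to \<open>x k\<close>.\<close>

definition err :: "real^'n^'i \<Rightarrow> 'i \<Rightarrow> nat \<Rightarrow> real" where
  "err xs i k = 1 / (2 * margin i k) * (norm (noise i k))\<^sup>2 - noise i k \<bullet> (x k $ i - xs $ i)"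

text \<open>Split the new error at \<open>x k\<close> and apply Young's inequality to the increment
  with weight \<open>margin i k\<close>, which is exactly what \<open>drop_term\<close> makes
  available.\<close>

lemma noise_le_err:
  assumes m: "margin i k > 0"
  shows "- (noise i k \<bullet> (x (Suc k) $ i - xs $ i)) - margin i k / 2 * (norm (x (Suc k) $ i - x k $ i))\<^sup>2 \<le> err xs i k"
proof -
  let ?d = "x (Suc k) $ i - x k $ i" and ?m = "margin i k"
  have "0 \<le> (norm (noise i k + ?m *\<^sub>R ?d))\<^sup>2" by simp
  then have "0 \<le> 1 / (2 * ?m) * ((norm (noise i k))\<^sup>2 + ?m * (2 * (noise i k \<bullet> ?d)) + ?m\<^sup>2 * (norm ?d)\<^sup>2)"
    using m by (simp only: norm_add_scaleR_power2) simp
  also have "\<dots> = 1 / (2 * ?m) * (norm (noise i k))\<^sup>2 + noise i k \<bullet> ?d + ?m / 2 * (norm ?d)\<^sup>2"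
    using m by (simp add: field_simps power2_eq_square)
  finally show ?thesis by (simp add: err_def inner_simps)
qed

text \<open>The margin differs from \<open>1 / step\<close> minus the spectral term by the Lipschitz
  constant \<open>L i\<close>, which is nonnegative. Hence the x-part of the potential controls the
  distance.\<close>

lemma margin_bound:
  assumes "margin i k \<ge> 0"
  shows "margin i k / 2 * (norm v)\<^sup>2 \<le> 1 / (2 * step i k) * (norm v)\<^sup>2 - \<gamma> i / 2 * (norm (A i *v v))\<^sup>2"
proof -
  have "0 \<le> L i" using f_lipschitz[of i] by (simp add: lipschitz_on_def)
  then have "0 \<le> L i / 2 * (norm v)\<^sup>2" by simp
  then show ?thesis using norm_matrix_power2_le[of i v]
    by (simp add: margin_def algebra_simps diff_divide_distrib)
qed

lemma potential_lower:
  assumes "\<And>i. margin i k \<ge> 0"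
  shows "(\<Sum>i\<in>UNIV. margin i k / 2 * (norm (x k $ i - xs $ i))\<^sup>2 + 1 / (2 * \<gamma> i) * (norm (lam i - l k $ i))\<^sup>2
     + \<gamma> i / 2 * (norm (B i *v (y k - ys)))\<^sup>2) \<le> potential xs ys lam k"
  unfolding potential_def
proof (rule sum_mono)
  fix i
  show "margin i k / 2 * (norm (x k $ i - xs $ i))\<^sup>2 + 1 / (2 * \<gamma> i) * (norm (lam i - l k $ i))\<^sup>2
     + \<gamma> i / 2 * (norm (B i *v (y k - ys)))\<^sup>2 \<le> 1 / (2 * \<gamma> i) * (norm (lam i - l k $ i))\<^sup>2
     + 1 / (2 * step i k) * (norm (x k $ i - xs $ i))\<^sup>2
     - \<gamma> i / 2 * (norm (A i *v (x k $ i - xs $ i)))\<^sup>2 + \<gamma> i / 2 * (norm (B i *v (y k - ys)))\<^sup>2"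
    using margin_bound[OF assms, of i "x k $ i - xs $ i"] by linarith
qed

lemma potential_nonneg:
  assumes "\<And>i. margin i k \<ge> 0"
  shows "0 \<le> potential xs ys lam k"
proof (rule order_trans[OF _ potential_lower[OF assms]], intro sum_nonneg add_nonneg_nonneg mult_nonneg_nonneg)
  show "0 \<le> margin i k / 2" "0 \<le> 1 / (2 * \<gamma> i)" "0 \<le> \<gamma> i / 2" for i
    using assms[of i] gamma_pos[of i] by auto
qed auto

text \<open>The functions \<open>s i\<close> account for the changes of the inverse steps: they are
  0 for constant steps and \<open>D\<^sup>2 / 2 * sqrt k\<close> for the decreasing ones. The final
  potential is dropped since it is nonnegative.\<close>

lemma telescoped_sum:
  assumes fin: "finite_point xs ys" and r0: "\<And>i. res i (xs $ i) ys = 0"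
    and m: "\<And>i k. margin i k > 0"
    and s: "\<And>i k. 1/2 * (1 / step i (Suc k) - 1 / step i k) * (norm (x (Suc k) $ i - xs $ i))\<^sup>2 \<le> s i (Suc k) - s i k"
  shows "(\<Sum>k<t. F (x (Suc k)) (y (Suc k)) - F xs ys + (\<Sum>i\<in>UNIV. lam i \<bullet> res i (x (Suc k) $ i) (y (Suc k))))
    \<le> potential xs ys lam 0 + (\<Sum>i\<in>UNIV. s i t - s i 0) + (\<Sum>k<t. \<Sum>i\<in>UNIV. err xs i k)"
proof -
  have one: "F (x (Suc k)) (y (Suc k)) - F xs ys + (\<Sum>i\<in>UNIV. lam i \<bullet> res i (x (Suc k) $ i) (y (Suc k)))
    \<le> (potential xs ys lam k - potential xs ys lam (Suc k)) + (\<Sum>i\<in>UNIV. s i (Suc k) - s i k) + (\<Sum>i\<in>UNIV. err xs i k)" for k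
  proof -
    have "- drop_term k - (\<Sum>i\<in>UNIV. noise i k \<bullet> (x (Suc k) $ i - xs $ i))
      \<le> (\<Sum>i\<in>UNIV. - (noise i k \<bullet> (x (Suc k) $ i - xs $ i)) - margin i k / 2 * (norm (x (Suc k) $ i - x k $ i))\<^sup>2)"
      unfolding drop_term_def sum_negf[symmetric] sum_subtractf[symmetric]
    proof (rule sum_mono)
      fix i
      have "0 \<le> 1 / (2 * \<gamma> i) * (norm (l (Suc k) $ i - l k $ i))\<^sup>2" "0 \<le> \<gamma> i / 2 * (norm (B i *v (y (Suc k) - y k)))\<^sup>2"
        using gamma_pos[of i] by auto
      then show "- (margin i k / 2 * (norm (x (Suc k) $ i - x k $ i))\<^sup>2 + 1 / (2 * \<gamma> i) * (norm (l (Suc k) $ i - l k $ i))\<^sup>2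
          + \<gamma> i / 2 * (norm (B i *v (y (Suc k) - y k)))\<^sup>2) - noise i k \<bullet> (x (Suc k) $ i - xs $ i)
        \<le> - (noise i k \<bullet> (x (Suc k) $ i - xs $ i)) - margin i k / 2 * (norm (x (Suc k) $ i - x k $ i))\<^sup>2"
        by linarith
    qed
    also have "\<dots> \<le> (\<Sum>i\<in>UNIV. err xs i k)" by (intro sum_mono noise_le_err m)
    finally have a: "- drop_term k - (\<Sum>i\<in>UNIV. noise i k \<bullet> (x (Suc k) $ i - xs $ i)) \<le> (\<Sum>i\<in>UNIV. err xs i k)" .
    have b: "(\<Sum>i\<in>UNIV. 1/2 * (1 / step i (Suc k) - 1 / step i k) * (norm (x (Suc k) $ i - xs $ i))\<^sup>2)
       \<le> (\<Sum>i\<in>UNIV. s i (Suc k) - s i k)" by (intro sum_mono s)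
    show ?thesis using one_step[OF fin r0, of k lam] a b by linarith
  qed
  have "(\<Sum>k<t. F (x (Suc k)) (y (Suc k)) - F xs ys + (\<Sum>i\<in>UNIV. lam i \<bullet> res i (x (Suc k) $ i) (y (Suc k))))
    \<le> (\<Sum>k<t. (potential xs ys lam k - potential xs ys lam (Suc k)) + (\<Sum>i\<in>UNIV. s i (Suc k) - s i k) + (\<Sum>i\<in>UNIV. err xs i k))"
    by (intro sum_mono one)
  also have "\<dots> = (\<Sum>k<t. potential xs ys lam k - potential xs ys lam (Suc k)) + (\<Sum>i\<in>UNIV. \<Sum>k<t. s i (Suc k) - s i k)
     + (\<Sum>k<t. \<Sum>i\<in>UNIV. err xs i k)"
    by (simp only: sum.distrib sum.swap[of _ "UNIV" "{..<t}"])
  also have "\<dots> = potential xs ys lam 0 - potential xs ys lam t + (\<Sum>i\<in>UNIV. s i t - s i 0) + (\<Sum>k<t. \<Sum>i\<in>UNIV. err xs i k)"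
    by (simp only: sum_lessThan_telescope sum_lessThan_telescope')
  finally show ?thesis using potential_nonneg[of t xs ys lam] m by (simp add: less_imp_le)
qed

text \<open>The squared norm of a difference is at most twice the sum of the squares; this 2 cancels
  the half in \<open>1 / (2 * \<gamma> i)\<close>, and the bound on \<open>lam\<close> contributes
  the 4.\<close>

lemma potential_le_rate_const:
  assumes "\<And>i. norm (lam i) \<le> 2 * norm (ls $ i)"
  shows "potential xs ys lam 0 \<le> rate_const A B \<gamma> (x 0) (y 0) (l 0) xs ys ls (\<lambda>i. step i 0)"
proof -
  have "potential xs ys lam 0 \<le> (\<Sum>i\<in>UNIV. 1 / \<gamma> i * (4 * (norm (ls $ i))\<^sup>2 + (norm (l 0 $ i))\<^sup>2)
     + (1 / (2 * step i 0) * (norm (xs $ i - x 0 $ i))\<^sup>2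
     - \<gamma> i / 2 * (norm (A i *v (xs $ i - x 0 $ i)))\<^sup>2) + \<gamma> i / 2 * (norm (B i *v (ys - y 0)))\<^sup>2)"
    unfolding potential_def
  proof (rule sum_mono)
    fix i
    have "(norm (lam i))\<^sup>2 \<le> (2 * norm (ls $ i))\<^sup>2" by (intro power_mono assms) simp
    then have "(norm (lam i - l 0 $ i))\<^sup>2 \<le> 2 * (4 * (norm (ls $ i))\<^sup>2 + (norm (l 0 $ i))\<^sup>2)"
      using norm_diff_power2_le[of "lam i" "l 0 $ i"] by (simp add: power_mult_distrib)
    then have "1 / (2 * \<gamma> i) * (norm (lam i - l 0 $ i))\<^sup>2 \<le> 1 / (2 * \<gamma> i) * (2 * (4 * (norm (ls $ i))\<^sup>2 + (norm (l 0 $ i))\<^sup>2))"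
      using gamma_pos[of i] by (intro mult_left_mono) auto
    also have "\<dots> = 1 / \<gamma> i * (4 * (norm (ls $ i))\<^sup>2 + (norm (l 0 $ i))\<^sup>2)"
      using gamma_pos[of i] by (simp add: field_simps)
    finally have 1: "1 / (2 * \<gamma> i) * (norm (lam i - l 0 $ i))\<^sup>2 \<le> \<dots>" .
    have 2: "norm (M *v (u - v)) = norm (M *v (v - u))" for M :: "real^'d::finite^'m" and u v
      by (simp add: matrix_vector_mult_diff_distrib norm_minus_commute)
    show "1 / (2 * \<gamma> i) * (norm (lam i - l 0 $ i))\<^sup>2 + 1 / (2 * step i 0) * (norm (x 0 $ i - xs $ i))\<^sup>2
      - \<gamma> i / 2 * (norm (A i *v (x 0 $ i - xs $ i)))\<^sup>2 + \<gamma> i / 2 * (norm (B i *v (y 0 - ys)))\<^sup>2 \<le>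
     1 / \<gamma> i * (4 * (norm (ls $ i))\<^sup>2 + (norm (l 0 $ i))\<^sup>2)
     + (1 / (2 * step i 0) * (norm (xs $ i - x 0 $ i))\<^sup>2
     - \<gamma> i / 2 * (norm (A i *v (xs $ i - x 0 $ i)))\<^sup>2) + \<gamma> i / 2 * (norm (B i *v (ys - y 0)))\<^sup>2"
      using 1 by (simp only: 2[of _ "x 0 $ i"] 2[of _ "y 0"] norm_minus_commute[of "x 0 $ i"])
  qed
  also have "\<dots> = rate_const A B \<gamma> (x 0) (y 0) (l 0) xs ys ls (\<lambda>i. step i 0)"
  proof -
    have "1 / (2 * step i 0) * qform (mat 1 - (step i 0 * \<gamma> i) *\<^sub>R (transpose (A i) ** A i)) v
      = 1 / (2 * step i 0) * (norm v)\<^sup>2 - \<gamma> i / 2 * (norm (A i *v v))\<^sup>2" for i v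
      using step_pos[of i 0] by (simp add: qform_identity_minus_gram field_simps)
    then show ?thesis
      unfolding rate_const_def by (simp add: qform_gram_sum sum.distrib sum_divide_distrib)
  qed
  finally show ?thesis .
qed

lemma ergodic_bound:
  assumes opt: "(xs, ys, ls) \<in> primal_dual_optimal J K g \<xi> f A B b"
    and m: "\<And>i k. margin i k > 0"
    and s: "\<And>i k. 1/2 * (1 / step i (Suc k) - 1 / step i k) * (norm (x (Suc k) $ i - xs $ i))\<^sup>2 \<le> s i (Suc k) - s i k"
    and t: "t \<ge> 1"
  defines "R \<equiv> rate_const A B \<gamma> (x 0) (y 0) (l 0) xs ys ls (\<lambda>i. step i 0) + (\<Sum>i\<in>UNIV. s i t - s i 0)
     + (\<Sum>k<t. \<Sum>i\<in>UNIV. err xs i k)"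
  shows "\<bar>objective g \<xi> f (avg x t) (avg y t) - objective g \<xi> f xs ys\<bar> \<le> ereal (R / real t)"
    and "(\<Sum>i\<in>UNIV. norm (ls $ i) * norm (res i (avg x t $ i) (avg y t))) \<le> R / real t"
proof -
  from opt have fin: "finite_point xs ys" and r0: "\<And>i. res i (xs $ i) ys = 0"
    and sad: "\<And>x y. finite_point x y \<Longrightarrow> F xs ys \<le> F x y + (\<Sum>i\<in>UNIV. (ls $ i) \<bullet> res i (x $ i) y)"
    by (auto simp: optimal_iff)
  have fk: "finite_point (x k) (y k)" if "k \<ge> 1" for k using x_finite[of "k - 1"] that by simp
  note av = F_average[where x = x and y = y, OF t fk]
  let ?F = "F (avg x t) (avg y t)" and ?r = "\<lambda>i. res i (avg x t $ i) (avg y t)"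
  let ?N = "\<Sum>i\<in>UNIV. norm (ls $ i) * norm (?r i)"
  \<comment> \<open>The multiplier is universally quantified here, so it may be built afterwards
    from the averaged residual itself.\<close>
  have main: "?F - F xs ys + (\<Sum>i\<in>UNIV. lam i \<bullet> ?r i) \<le> R / real t"
    if lam: "\<And>i. norm (lam i) \<le> 2 * norm (ls $ i)" for lam
  proof -
    have "(\<Sum>k<t. F (x (Suc k)) (y (Suc k)) - F xs ys + (\<Sum>i\<in>UNIV. lam i \<bullet> res i (x (Suc k) $ i) (y (Suc k)))) \<le> R"
      using telescoped_sum[OF fin r0 m s, of lam t] potential_le_rate_const[OF lam, of xs ys] by (simp add: R_def)
    moreover have "(\<Sum>k<t. F (x (Suc k)) (y (Suc k)) - F xs ys + (\<Sum>i\<in>UNIV. lam i \<bullet> res i (x (Suc k) $ i) (y (Suc k))))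
       = (\<Sum>k=1..t. F (x k) (y k)) - real t * F xs ys + real t * (\<Sum>i\<in>UNIV. lam i \<bullet> ?r i)"
    proof -
      have "real t * (\<Sum>i\<in>UNIV. lam i \<bullet> ?r i) = (\<Sum>i\<in>UNIV. \<Sum>k=1..t. lam i \<bullet> res i (x k $ i) (y k))"
        using t by (simp add: residual_average[OF t] sum_distrib_left inner_sum_right)
      also have "\<dots> = (\<Sum>k=1..t. \<Sum>i\<in>UNIV. lam i \<bullet> res i (x k $ i) (y k))" by (rule sum.swap)
      finally show ?thesis by (simp add: sum.distrib sum_subtractf sum.atLeast1_atMost_eq)
    qed
    ultimately have "((\<Sum>k=1..t. F (x k) (y k)) - real t * F xs ys + real t * (\<Sum>i\<in>UNIV. lam i \<bullet> ?r i)) / real t \<le> R / real t"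
      by (intro divide_right_mono) auto
    moreover have "F (avg x t) (avg y t) \<le> (\<Sum>k=1..t. F (x k) (y k)) / real t" using av(2) by simp
    ultimately show ?thesis using t by (simp add: add_divide_distrib diff_divide_distrib)
  qed
  have "- ?N \<le> (\<Sum>i\<in>UNIV. - (ls $ i \<bullet> ?r i)) + 0 \<and> (\<Sum>i\<in>UNIV. ls $ i \<bullet> ?r i) \<le> ?N"
    unfolding sum_negf by (auto intro!: sum_mono norm_cauchy_schwarz)
  then have low: "F xs ys - ?N \<le> ?F" using sad[OF av(1)] by linarith
  \<comment> \<open>Since \<open>sgn 0 = 0\<close>, a block with zero residual contributes 0 on both
    sides.\<close>
  have "(\<Sum>i\<in>UNIV. ((2 * norm (ls $ i)) *\<^sub>R sgn (?r i)) \<bullet> ?r i) = 2 * ?N"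
  proof -
    have e: "((2 * norm (ls $ i)) *\<^sub>R sgn (?r i)) \<bullet> ?r i = 2 * (norm (ls $ i) * norm (?r i))" for i
      by (cases "?r i = 0") (simp_all add: sgn_div_norm dot_square_norm power2_eq_square)
    show ?thesis unfolding e sum_distrib_left ..
  qed
  moreover have "?F - F xs ys + (\<Sum>i\<in>UNIV. ((2 * norm (ls $ i)) *\<^sub>R sgn (?r i)) \<bullet> ?r i) \<le> R / real t"
    by (rule main) (simp add: norm_sgn)
  \<comment> \<open>Of the two copies of \<open>?N\<close> one is consumed by the saddle inequality
    \<open>low\<close>; the other is bounded.\<close>
  ultimately have N: "?N \<le> R / real t" using low by linarith
  then show "?N \<le> R / real t" .
  \<comment> \<open>The zero multiplier gives the upper bound on the gap; the lower bound combines
    \<open>low\<close> with the residual bound.\<close>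
  have "?F - F xs ys \<le> R / real t" using main[of "\<lambda>_. 0"] by simp
  then have "\<bar>?F - F xs ys\<bar> \<le> R / real t" using low N by linarith
  then show "\<bar>objective g \<xi> f (avg x t) (avg y t) - objective g \<xi> f xs ys\<bar> \<le> ereal (R / real t)"
    by (simp add: objective_finite[OF fin] objective_finite[OF av(1)])
qed

end

subsection \<open>Convergence without noise\<close>

text \<open>Cesaro means: the first N terms contribute \<open>C / n\<close>, the later ones at most
  \<open>e / 2\<close>.\<close>

lemma tendsto_avg:
  fixes s :: "nat \<Rightarrow> 'a::real_normed_vector"
  assumes "s \<longlonglongrightarrow> w"
  shows "avg s \<longlonglongrightarrow> w"
proof (rule LIMSEQ_I)
  fix e :: real assume e: "e > 0"
  obtain N where N: "\<And>k. k \<ge> N \<Longrightarrow> norm (s k - w) < e / 2"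
    using LIMSEQ_D[OF assms, of "e/2"] e by auto
  define C where "C = (\<Sum>k=1..N. norm (s k - w))"
  obtain N' :: nat where N': "N' > 2 * C / e" using reals_Archimedean2 by blast
  show "\<exists>n0. \<forall>n\<ge>n0. norm (avg s n - w) < e"
  proof (intro exI allI impI)
    fix n assume n: "n \<ge> max (Suc N) (Suc N')"
    then have n0: "real n > 0" by auto
    have "avg s n - w = (1 / real n) *\<^sub>R (\<Sum>k=1..n. s k - w)"
      using n0 by (simp add: avg_def sum_subtractf scaleR_diff_right sum_constant_scaleR)
    then have "norm (avg s n - w) \<le> (1 / real n) * (\<Sum>k=1..n. norm (s k - w))"
      using n0 by (simp add: divide_right_mono norm_sum)
    also have "(\<Sum>k=1..n. norm (s k - w)) = C + (\<Sum>k=Suc N..n. norm (s k - w))"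
      unfolding C_def using n sum.ub_add_nat[of 1 N "\<lambda>k. norm (s k - w)" "n - N"] by simp
    also have "(\<Sum>k=Suc N..n. norm (s k - w)) \<le> (\<Sum>k=Suc N..n. e / 2)"
      using N by (intro sum_mono) (auto intro: less_imp_le)
    also have "\<dots> \<le> real n * (e / 2)" using e by (simp add: mult_right_mono)
    also have "(1 / real n) * (C + real n * (e / 2)) = C / real n + e / 2" using n0 by (simp add: field_simps)
    also have "C / real n < e / 2"
    proof -
      have "2 * C / e < real n" using N' n by linarith
      then show ?thesis using e n0 by (simp add: field_simps)
    qed
    finally show "norm (avg s n - w) < e" using n0 by (simp add: mult_left_mono divide_right_mono)
  qed
qed

text \<open>A bounded monotone sequence converges, so its limit is visible on a subsequence. This
  upgrades subsequential convergence of the iterates to full convergence.\<close>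

lemma decseq_subseq_tendsto_zero:
  fixes p :: "nat \<Rightarrow> real"
  assumes "decseq p" "\<And>k. 0 \<le> p k" "strict_mono \<tau>" "(p \<circ> \<tau>) \<longlonglongrightarrow> 0"
  shows "p \<longlonglongrightarrow> 0"
proof -
  obtain L where "p \<longlonglongrightarrow> L" using decseq_convergent[OF assms(1) allI[OF assms(2)]] by blast
  with LIMSEQ_subseq_LIMSEQ[OF this assms(3)] assms(4) show ?thesis
    using LIMSEQ_unique by blast
qed

context spg_path
begin

text \<open>For constant steps this is \<open>drop_term\<close> when applied to an increment, and a
  lower bound of the potential when applied to an error. In the y-component it is in general only
  the square of a seminorm.\<close>

definition weighted_norm2 :: "(real^'n^'i) \<times> (real^'y) \<times> (real^'m^'i) \<Rightarrow> real" where
  "weighted_norm2 = (\<lambda>(u, v, w). \<Sum>i\<in>UNIV. margin i 0 / 2 * (norm (u $ i))\<^sup>2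
     + 1 / (2 * \<gamma> i) * (norm (w $ i))\<^sup>2 + \<gamma> i / 2 * (norm (B i *v v))\<^sup>2)"

text \<open>Full column rank makes the joint map of v to all \<open>B i *v v\<close> injective,
  hence bounded below by some \<open>\<beta>\<close> in finite dimension. The constant
  \<open>\<kappa>\<close> is the smallest of finitely many positive coefficients.\<close>

lemma weighted_norm2_lower:
  assumes m: "\<And>i. margin i 0 > 0" and rank: "rank (stacked B) = CARD('y)"
  obtains \<kappa> where "\<kappa> > 0" "\<And>p. \<kappa> * (norm p)\<^sup>2 \<le> weighted_norm2 p"
proof -
  define \<kappa> where "\<kappa> = Min (range (\<lambda>i. min (margin i 0 / 2) (min (1 / (2 * \<gamma> i)) (\<gamma> i / 2))))"
  have \<kappa>: "\<kappa> > 0" unfolding \<kappa>_def using m gamma_pos by (subst Min_gr_iff) auto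
  have \<kappa>_le: "\<kappa> \<le> min (margin i 0 / 2) (min (1 / (2 * \<gamma> i)) (\<gamma> i / 2))" for i
    unfolding \<kappa>_def by (rule Min_le) auto
  let ?T = "\<lambda>v. (\<chi> i. B i *v v) :: real^'m^'i"
  have lin: "linear ?T"
    by (rule linearI) (simp_all add: vec_eq_iff matrix_vector_right_distrib matrix_vector_mult_scaleR)
  have inj: "inj ?T"
  proof (rule injI)
    fix u v assume "?T u = ?T v"
    then have "B i *v u = B i *v v" for i by (simp add: vec_eq_iff)
    then have "(B i *v u) $ j = (B i *v v) $ j" for i j by simp
    then have "stacked B *v u = stacked B *v v"
      by (simp add: vec_eq_iff stacked_def matrix_vector_mult_def)
    moreover have "inj ((*v) (stacked B))" using rank by (simp add: full_rank_injective)
    ultimately show "u = v" by (auto dest: injD)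
  qed
  obtain \<beta> where \<beta>: "\<beta> > 0" "\<And>v. \<beta> * norm v \<le> norm (?T v)"
    using linear_inj_bounded_below_pos[OF lin inj] by blast
  show thesis
  proof (rule that)
    show "\<kappa> * min 1 (\<beta>\<^sup>2) > 0" using \<kappa> \<beta> by simp
    fix p :: "(real^'n^'i) \<times> (real^'y) \<times> (real^'m^'i)"
    obtain u v w where p: "p = (u, v, w)" by (cases p) auto
    have n: "(norm p)\<^sup>2 = (norm u)\<^sup>2 + (norm w)\<^sup>2 + (norm v)\<^sup>2" by (simp add: p norm_Pair)
    have "\<beta>\<^sup>2 * (norm v)\<^sup>2 \<le> (norm (?T v))\<^sup>2"
      using power_mono[OF \<beta>(2)[of v], of 2] \<beta>(1) by (simp add: power_mult_distrib)
    moreover have "min 1 (\<beta>\<^sup>2) * (norm v)\<^sup>2 \<le> \<beta>\<^sup>2 * (norm v)\<^sup>2" by (intro mult_right_mono) auto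
    moreover have "min 1 (\<beta>\<^sup>2) * (norm u)\<^sup>2 \<le> 1 * (norm u)\<^sup>2" "min 1 (\<beta>\<^sup>2) * (norm w)\<^sup>2 \<le> 1 * (norm w)\<^sup>2"
      by (intro mult_right_mono; simp)+
    ultimately have "min 1 (\<beta>\<^sup>2) * (norm p)\<^sup>2 \<le> (norm u)\<^sup>2 + (norm w)\<^sup>2 + (norm (?T v))\<^sup>2"
      unfolding n distrib_left by linarith
    then have "\<kappa> * (min 1 (\<beta>\<^sup>2) * (norm p)\<^sup>2) \<le> \<kappa> * ((norm u)\<^sup>2 + (norm w)\<^sup>2 + (norm (?T v))\<^sup>2)"
      using \<kappa> by (intro mult_left_mono) auto
    also have "\<dots> = (\<Sum>i\<in>UNIV. \<kappa> * (norm (u $ i))\<^sup>2 + \<kappa> * (norm (w $ i))\<^sup>2 + \<kappa> * (norm (B i *v v))\<^sup>2)"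
      by (simp add: norm_vec_power2[where 'a = "real^'n"] norm_vec_power2[where 'a = "real^'m"] sum.distrib sum_distrib_left distrib_left)
    also have "\<dots> \<le> weighted_norm2 p"
      unfolding weighted_norm2_def p prod.case
      using \<kappa>_le by (intro sum_mono add_mono mult_right_mono) auto
    finally show "\<kappa> * min 1 (\<beta>\<^sup>2) * (norm p)\<^sup>2 \<le> weighted_norm2 p" by (simp add: mult.assoc)
  qed
qed

text \<open>The subgradient inequalities of the two minimization steps survive the limit by lower
  semicontinuity, and the common limit of consecutive multipliers gives feasibility. Together with
  the gradient inequality for f they yield the saddle condition.\<close>

lemma limit_optimal:
  assumes c: "\<And>i k. step i k = c i" and nz: "\<And>i k. noise i k = 0"
    and lim: "(\<lambda>n. x (\<tau> n)) \<longlonglongrightarrow> xh" "(\<lambda>n. y (\<tau> n)) \<longlonglongrightarrow> yh" "(\<lambda>n. l (\<tau> n)) \<longlonglongrightarrow> lh"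
    and lim': "(\<lambda>n. x (Suc (\<tau> n))) \<longlonglongrightarrow> xh" "(\<lambda>n. y (Suc (\<tau> n))) \<longlonglongrightarrow> yh" "(\<lambda>n. l (Suc (\<tau> n))) \<longlonglongrightarrow> lh"
  shows "(xh, yh, lh) \<in> primal_dual_optimal J K g \<xi> f A B b"
proof -
  have Xl: "(\<lambda>n. x (\<tau> n) $ i) \<longlonglongrightarrow> xh $ i" "(\<lambda>n. x (Suc (\<tau> n)) $ i) \<longlonglongrightarrow> xh $ i"
    "(\<lambda>n. l (\<tau> n) $ i) \<longlonglongrightarrow> lh $ i" "(\<lambda>n. l (Suc (\<tau> n)) $ i) \<longlonglongrightarrow> lh $ i" for i
    by (intro tendsto_vec_nth lim lim')+
  have mv: "(\<lambda>n. M *v u n) \<longlonglongrightarrow> M *v u'" if "u \<longlonglongrightarrow> u'" for M :: "real^'d::finite^'e::finite" and u u'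
    using that by (rule bounded_linear.tendsto[OF matrix_vector_mul_bounded_linear])
  have resl: "(\<lambda>n. res i (x (\<tau> n) $ i) (y (\<tau> n))) \<longlonglongrightarrow> res i (xh $ i) yh"
    "(\<lambda>n. res i (x (Suc (\<tau> n)) $ i) (y (Suc (\<tau> n)))) \<longlonglongrightarrow> res i (xh $ i) yh" for i
    unfolding residual_def by (intro tendsto_intros mv Xl lim lim')+
  have r0: "res i (xh $ i) yh = 0" for i
  proof -
    have "(\<lambda>n. l (Suc (\<tau> n)) $ i - l (\<tau> n) $ i) \<longlonglongrightarrow> lh $ i - lh $ i" by (intro tendsto_diff Xl)
    moreover have "(\<lambda>n. l (Suc (\<tau> n)) $ i - l (\<tau> n) $ i) \<longlonglongrightarrow> \<gamma> i *\<^sub>R res i (xh $ i) yh"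
      unfolding l_step add_diff_cancel_left' by (intro tendsto_intros resl)
    ultimately have "\<gamma> i *\<^sub>R res i (xh $ i) yh = lh $ i - lh $ i" by (rule LIMSEQ_unique[rotated])
    then show ?thesis using gamma_pos[of i] by simp
  qed
  have step_lim: "xh $ i \<in> xdom i"
    "z \<in> xdom i \<Longrightarrow> \<xi>r i (xh $ i) \<le> \<xi>r i z + grad i (xh $ i) \<bullet> (z - xh $ i) + lh $ i \<bullet> (A i *v (z - xh $ i))" for i z
  proof -
    have "Cauchy (\<lambda>n. grad i (x (\<tau> n) $ i))"
      by (rule uniformly_continuous_on_Cauchy[OF lipschitz_on_uniformly_continuous[OF f_lipschitz]
            LIMSEQ_imp_Cauchy[OF Xl(1)] x_U])
    then have "convergent (\<lambda>n. grad i (x (\<tau> n) $ i))" by (rule Cauchy_convergent)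
    then obtain d where d: "(\<lambda>n. grad i (x (\<tau> n) $ i)) \<longlonglongrightarrow> d" by (auto simp: convergent_def)
    have lsc: "xh $ i \<in> coords (J i) \<and> \<xi> i (xh $ i) \<le> ereal (\<xi>r i z + d \<bullet> (z - xh $ i) + lh $ i \<bullet> (A i *v (z - xh $ i)))"
      if z: "z \<in> xdom i" for z
    proof -
      let ?R = "\<lambda>n. \<xi>r i z + 1 / c i * ((x (Suc (\<tau> n)) $ i - x (\<tau> n) $ i) \<bullet> (z - x (Suc (\<tau> n)) $ i))
        + grad i (x (\<tau> n) $ i) \<bullet> (z - x (Suc (\<tau> n)) $ i)
        + (l (\<tau> n) $ i + \<gamma> i *\<^sub>R res i (x (\<tau> n) $ i) (y (\<tau> n))) \<bullet> (A i *v (z - x (Suc (\<tau> n)) $ i))"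
      have 1: "x (Suc (\<tau> n)) $ i \<in> coords (J i)" for n using x_dom by (auto simp: edom_def)
      have 2: "\<xi> i (x (Suc (\<tau> n)) $ i) \<le> ereal (?R n)" for n
      proof -
        obtain r where "\<xi> i (x (Suc (\<tau> n)) $ i) = ereal r"
          using closed_convex_fun_finite[OF xi_closed_convex x_dom] by blast
        then show ?thesis using subgradient_xi[OF z, of "\<tau> n"] by (simp add: nz c)
      qed
      have "?R \<longlonglongrightarrow> \<xi>r i z + 1 / c i * ((xh $ i - xh $ i) \<bullet> (z - xh $ i)) + d \<bullet> (z - xh $ i)
        + (lh $ i + \<gamma> i *\<^sub>R res i (xh $ i) yh) \<bullet> (A i *v (z - xh $ i))"
        by (intro tendsto_intros mv Xl resl d)
      then show ?thesis using closed_convex_fun_lsc[OF xi_closed_convex 1 2 Xl(2)] by (simp add: r0)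
    qed
    obtain z0 where z0: "z0 \<in> xdom i" using xi_proper by blast
    from lsc[OF z0] show xd: "xh $ i \<in> xdom i" by (auto simp: edom_def)
    have cont: "continuous_on (U i) (grad i)" using f_lipschitz by (rule lipschitz_on_continuous_on)
    have xu: "xh $ i \<in> U i" using xd U_dom by blast
    have "(\<lambda>n. grad i (x (\<tau> n) $ i)) \<longlonglongrightarrow> grad i (xh $ i)"
      by (rule continuous_on_tendsto_compose[OF cont Xl(1) xu]) (simp add: x_U)
    then have deq: "d = grad i (xh $ i)" using d LIMSEQ_unique by blast
    assume z: "z \<in> xdom i"
    obtain r where "\<xi> i (xh $ i) = ereal r"
      using closed_convex_fun_finite[OF xi_closed_convex xd] by blast
    with lsc[OF z] show "\<xi>r i (xh $ i) \<le> \<xi>r i z + grad i (xh $ i) \<bullet> (z - xh $ i) + lh $ i \<bullet> (A i *v (z - xh $ i))"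
      by (simp add: deq)
  qed
  have y_lim: "yh \<in> edom UNIV g \<and> (z \<in> edom UNIV g \<longrightarrow> gr yh \<le> gr z + (\<Sum>i\<in>UNIV. lh $ i \<bullet> (B i *v (z - yh))))" for z
  proof -
    have lsc: "g yh \<le> ereal (gr z + (\<Sum>i\<in>UNIV. lh $ i \<bullet> (B i *v (z - yh))))" if z: "z \<in> edom UNIV g" for z
    proof (rule closed_convex_fun_lsc(2)[OF g_closed_convex UNIV_I _ lim(2)])
      fix n
      obtain r where "g (y (\<tau> n)) = ereal r"
        using closed_convex_fun_finite[OF g_closed_convex y_dom] by blast
      then show "g (y (\<tau> n)) \<le> ereal (gr z + (\<Sum>i\<in>UNIV. l (\<tau> n) $ i \<bullet> (B i *v (z - y (\<tau> n)))))"
        using subgradient_g(2)[OF z, of "\<tau> n"] by simp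
      show "(\<lambda>n. gr z + (\<Sum>i\<in>UNIV. l (\<tau> n) $ i \<bullet> (B i *v (z - y (\<tau> n))))) \<longlonglongrightarrow> gr z + (\<Sum>i\<in>UNIV. lh $ i \<bullet> (B i *v (z - yh)))"
        by (intro tendsto_intros mv Xl lim)
    qed
    obtain z0 where z0: "z0 \<in> edom UNIV g" using g_proper by blast
    from lsc[OF z0] have yd: "yh \<in> edom UNIV g" by (auto simp: edom_def)
    obtain r where "g yh = ereal r" using closed_convex_fun_finite[OF g_closed_convex yd] by blast
    with yd lsc[of z] show ?thesis by auto
  qed
  have closedK: "closed (block_coords K)"
  proof -
    have "block_coords K = (\<Inter>i. (\<lambda>v. v $ i) -` coords (K i))" by (auto simp: block_coords_def)
    also have "closed \<dots>"
      by (intro closed_INT ballI continuous_closed_vimage closed_coords continuous_intros)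
    finally show ?thesis .
  qed
  have fin: "finite_point xh yh" using step_lim(1) y_lim by (auto simp: finite_point_def)
  moreover have "lh \<in> block_coords K"
    using closed_sequentially[OF closedK _ lim(3)] l_dims by blast
  moreover have "F xh yh \<le> F z v + (\<Sum>i\<in>UNIV. (lh $ i) \<bullet> res i (z $ i) v)" if fp: "finite_point z v" for z v
  proof -
    have zd: "z $ i \<in> xdom i" for i using fp by (simp add: finite_point_def)
    have "gr yh \<le> gr v + (\<Sum>i\<in>UNIV. lh $ i \<bullet> (B i *v (v - yh)))"
      using y_lim[of v] fp by (simp add: finite_point_def)
    moreover have "(\<Sum>i\<in>UNIV. \<xi>r i (xh $ i) + f i (xh $ i)) \<le> (\<Sum>i\<in>UNIV. (\<xi>r i (z $ i) + f i (z $ i)) + lh $ i \<bullet> (A i *v (z $ i - xh $ i)))"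
    proof (rule sum_mono)
      fix i
      have "xh $ i \<in> U i" "xh $ i \<in> coords (J i)" "z $ i \<in> coords (J i)"
        using step_lim(1) zd U_dom by (auto simp: edom_def)
      then have "f i (xh $ i) + grad i (xh $ i) \<bullet> (z $ i - xh $ i) \<le> f i (z $ i)"
        by (intro gradient_inequality[OF subspace_coords _ _ f_diff f_closed_convex])
      then show "\<xi>r i (xh $ i) + f i (xh $ i) \<le> (\<xi>r i (z $ i) + f i (z $ i)) + lh $ i \<bullet> (A i *v (z $ i - xh $ i))"
        using step_lim(2)[OF zd, of i] by linarith
    qed
    moreover have "lh $ i \<bullet> res i (z $ i) v = lh $ i \<bullet> (A i *v (z $ i - xh $ i)) + lh $ i \<bullet> (B i *v (v - yh))" for i
    proof -
      have "res i (z $ i) v = A i *v (z $ i - xh $ i) + B i *v (v - yh)"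
        using r0[of i] by (simp add: residual_def matrix_vector_mult_diff_distrib algebra_simps)
      then show ?thesis by (simp add: inner_add_right)
    qed
    ultimately show ?thesis by (simp add: F_def sum.distrib)
  qed
  ultimately show ?thesis unfolding optimal_iff using r0 by blast
qed

text \<open>Monotonicity holds for the potential of every saddle point. Applied to the given one it
  yields boundedness and vanishing increments, hence an optimal cluster point; applied to that
  cluster point, whose potential tends to 0 along the subsequence, it yields convergence.\<close>

lemma converges:
  assumes c: "\<And>i k. step i k = c i" and nz: "\<And>i k. noise i k = 0" and m: "\<And>i. margin i 0 > 0"
    and rank: "rank (stacked B) = CARD('y)"
    and opt: "(xs, ys, ls) \<in> primal_dual_optimal J K g \<xi> f A B b"
  obtains w where "w \<in> primal_dual_optimal J K g \<xi> f A B b" "(\<lambda>k. (x k, y k, l k)) \<longlonglongrightarrow> w"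
proof -
  let ?w = "\<lambda>k. (x k, y k, l k)"
  obtain \<kappa> where \<kappa>: "\<kappa> > 0" "\<And>p. \<kappa> * (norm p)\<^sup>2 \<le> weighted_norm2 p"
    using weighted_norm2_lower[OF m rank] by blast
  have mk: "margin i k = margin i 0" for i k by (simp add: margin_def c)
  \<comment> \<open>The multiplier slot is filled with the dual part of the triple: for an optimal
    triple the saddle inequality then makes the left side of \<open>one_step\<close>
    nonnegative.\<close>
  define P where "P = (\<lambda>(xs, ys, ls) k. potential xs ys (\<lambda>i. ls $ i) k)"
  have low: "\<kappa> * (norm (?w k - w))\<^sup>2 \<le> P w k" for w k
  proof -
    obtain xs ys ls where w: "w = (xs, ys, ls)" by (cases w) auto
    have "weighted_norm2 (?w k - w) \<le> P w k"
    proof -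
      have e: "norm (ls $ i - l k $ i) = norm (l k $ i - ls $ i)" for i by (rule norm_minus_commute)
      have "margin i k \<ge> 0" for i using m[of i] by (simp add: mk[of _ k])
      from potential_lower[OF this, of xs "\<lambda>i. ls $ i" ys] show ?thesis
        unfolding e mk[of _ k] by (simp add: w P_def weighted_norm2_def)
    qed
    then show ?thesis using \<kappa>(2)[of "?w k - w"] by linarith
  qed
  have fejer: "P w (Suc k) + \<kappa> * (norm (?w (Suc k) - ?w k))\<^sup>2 \<le> P w k"
    if w: "w \<in> primal_dual_optimal J K g \<xi> f A B b" for w k
  proof -
    obtain xs ys ls where we: "w = (xs, ys, ls)" by (cases w) auto
    from w have fin: "finite_point xs ys" and r0: "\<And>i. res i (xs $ i) ys = 0"
      and sad: "\<And>x y. finite_point x y \<Longrightarrow> F xs ys \<le> F x y + (\<Sum>i\<in>UNIV. (ls $ i) \<bullet> res i (x $ i) y)"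
      by (auto simp: optimal_iff we)
    have "drop_term k = weighted_norm2 (?w (Suc k) - ?w k)"
      by (simp add: drop_term_def weighted_norm2_def mk[of _ k])
    then show ?thesis
      using one_step[OF fin r0, of k "\<lambda>i. ls $ i"] sad[OF x_finite[of k]] \<kappa>(2)[of "?w (Suc k) - ?w k"]
      by (simp add: we P_def nz c)
  qed
  have dec: "decseq (P w)" if "w \<in> primal_dual_optimal J K g \<xi> f A B b" for w
  proof (rule decseq_SucI)
    fix k
    have "0 \<le> \<kappa> * (norm (?w (Suc k) - ?w k))\<^sup>2" using \<kappa>(1) by simp
    then show "P w (Suc k) \<le> P w k" using fejer[OF that, of k] by linarith
  qed
  have P0: "0 \<le> P w k" for w k
  proof -
    have "0 \<le> \<kappa> * (norm (?w k - w))\<^sup>2" using \<kappa>(1) by simp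
    then show ?thesis using low[of k w] by linarith
  qed
  let ?s = "(xs, ys, ls)"
  have "bounded (range ?w)"
  proof (rule boundedI, clarify)
    fix k
    have "\<kappa> * (norm (?w k - ?s))\<^sup>2 \<le> P ?s 0" using low[of k ?s] decseqD[OF dec[OF opt], of 0 k] by simp
    then have "(norm (?w k - ?s))\<^sup>2 \<le> P ?s 0 / \<kappa>" using \<kappa>(1) by (simp add: field_simps)
    then have "norm (?w k - ?s) \<le> sqrt (P ?s 0 / \<kappa>)" by (rule real_le_rsqrt)
    then show "norm (?w k) \<le> norm ?s + sqrt (P ?s 0 / \<kappa>)" using norm_triangle_sub[of "?w k" ?s] by linarith
  qed
  then obtain w \<tau> where \<tau>: "strict_mono (\<tau> :: nat \<Rightarrow> nat)" "(?w \<circ> \<tau>) \<longlonglongrightarrow> w"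
    using bounded_imp_convergent_subsequence by blast
  have dif: "(\<lambda>k. ?w (Suc k) - ?w k) \<longlonglongrightarrow> 0"
  proof -
    obtain q where q: "P ?s \<longlonglongrightarrow> q" using decseq_convergent[OF dec[OF opt] allI[OF P0]] by blast
    have "(\<lambda>k. (P ?s k - P ?s (Suc k)) / \<kappa>) \<longlonglongrightarrow> (q - q) / \<kappa>"
      using \<kappa>(1) by (intro tendsto_intros q LIMSEQ_Suc[OF q]) auto
    then have lim0: "(\<lambda>k. (P ?s k - P ?s (Suc k)) / \<kappa>) \<longlonglongrightarrow> 0" by simp
    have "(\<lambda>k. (norm (?w (Suc k) - ?w k))\<^sup>2) \<longlonglongrightarrow> 0"
    proof (rule tendsto_sandwich[OF _ _ tendsto_const lim0])
      have "(norm (?w (Suc k) - ?w k))\<^sup>2 \<le> (P ?s k - P ?s (Suc k)) / \<kappa>" for k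
        using fejer[OF opt, of k] \<kappa>(1) by (simp add: field_simps)
      then show "\<forall>\<^sub>F k in sequentially. (norm (?w (Suc k) - ?w k))\<^sup>2 \<le> (P ?s k - P ?s (Suc k)) / \<kappa>"
        by simp
    qed simp
    then have "(\<lambda>k. sqrt ((norm (?w (Suc k) - ?w k))\<^sup>2)) \<longlonglongrightarrow> sqrt 0" by (rule tendsto_real_sqrt)
    then show ?thesis by (intro tendsto_norm_zero_cancel[of "\<lambda>k. ?w (Suc k) - ?w k"]) simp
  qed
  have l1: "(\<lambda>n. ?w (\<tau> n)) \<longlonglongrightarrow> w" using \<tau>(2) by (simp add: o_def)
  have "(\<lambda>n. ?w (\<tau> n) + (?w (Suc (\<tau> n)) - ?w (\<tau> n))) \<longlonglongrightarrow> w + 0"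
    using LIMSEQ_subseq_LIMSEQ[OF dif \<tau>(1)] by (intro tendsto_add l1) (simp add: o_def)
  then have l2: "(\<lambda>n. ?w (Suc (\<tau> n))) \<longlonglongrightarrow> w" by simp
  obtain xh yh lh where w: "w = (xh, yh, lh)" by (cases w) auto
  note cl = tendsto_fst[OF l1, unfolded w fst_conv] tendsto_fst[OF tendsto_snd[OF l1], unfolded w fst_conv snd_conv]
    tendsto_snd[OF tendsto_snd[OF l1], unfolded w snd_conv]
  note cl' = tendsto_fst[OF l2, unfolded w fst_conv] tendsto_fst[OF tendsto_snd[OF l2], unfolded w fst_conv snd_conv]
    tendsto_snd[OF tendsto_snd[OF l2], unfolded w snd_conv]
  have wopt: "w \<in> primal_dual_optimal J K g \<xi> f A B b"
    unfolding w by (rule limit_optimal[OF c nz cl cl'])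
  have mv: "(\<lambda>n. M *v u n) \<longlonglongrightarrow> M *v u'" if "u \<longlonglongrightarrow> u'" for M :: "real^'d::finite^'e::finite" and u u'
    using that by (rule bounded_linear.tendsto[OF matrix_vector_mul_bounded_linear])
  have "(\<lambda>n. P w (\<tau> n)) \<longlonglongrightarrow> (\<Sum>i\<in>UNIV. 1 / (2 * \<gamma> i) * (norm (lh $ i - lh $ i))\<^sup>2
     + 1 / (2 * c i) * (norm (xh $ i - xh $ i))\<^sup>2
     - \<gamma> i / 2 * (norm (A i *v (xh $ i - xh $ i)))\<^sup>2 + \<gamma> i / 2 * (norm (B i *v (yh - yh)))\<^sup>2)"
    unfolding w P_def prod.case potential_def c
    by (intro tendsto_intros mv cl)
  then have "(P w \<circ> \<tau>) \<longlonglongrightarrow> 0" by (simp add: o_def)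
  then have "P w \<longlonglongrightarrow> 0" by (rule decseq_subseq_tendsto_zero[OF dec[OF wopt] P0 \<tau>(1)])
  then have "(\<lambda>k. sqrt (P w k / \<kappa>)) \<longlonglongrightarrow> sqrt (0 / \<kappa>)" using \<kappa>(1) by (intro tendsto_intros) auto
  then have "(\<lambda>k. sqrt (P w k / \<kappa>)) \<longlonglongrightarrow> 0" by simp
  then have "(\<lambda>k. ?w k - w) \<longlonglongrightarrow> 0"
  proof (rule Lim_null_comparison[rotated])
    have "norm (?w k - w) \<le> sqrt (P w k / \<kappa>)" for k
      using low[of k w] \<kappa>(1) by (intro real_le_rsqrt) (simp add: field_simps)
    then show "\<forall>\<^sub>F k in sequentially. norm (?w k - w) \<le> sqrt (P w k / \<kappa>)" by simp
  qed
  then have "?w \<longlonglongrightarrow> w" by (rule LIM_zero_cancel)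
  with wopt show thesis by (rule that)
qed

end

subsection \<open>Independence of the iterates from fresh samples\<close>

locale stochastic_spg = spg_problem J K g \<xi> f U L \<gamma> A B b + prob_space M
  for J :: "'i::finite \<Rightarrow> 'n::finite set" and K :: "'i \<Rightarrow> 'm::finite set"
    and g :: "real^'y::finite \<Rightarrow> ereal"
    and \<xi> :: "'i \<Rightarrow> real^'n \<Rightarrow> ereal" and f :: "'i \<Rightarrow> real^'n \<Rightarrow> real"
    and U :: "'i \<Rightarrow> (real^'n) set" and L \<gamma> :: "'i \<Rightarrow> real"
    and A :: "'i \<Rightarrow> real^'n^'m" and B :: "'i \<Rightarrow> real^'y^'m" and b :: "'i \<Rightarrow> real^'m"
    and M :: "'w measure" +
  fixes P :: "'s measure"
    and \<nu> :: "'i \<Rightarrow> nat \<Rightarrow> 'w \<Rightarrow> 's"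
    and G :: "'i \<Rightarrow> real^'n \<Rightarrow> 's \<Rightarrow> real^'n"
    and \<sigma> :: real
    and step :: "'i \<Rightarrow> nat \<Rightarrow> real"
    and X :: "nat \<Rightarrow> 'w \<Rightarrow> real^'n^'i"
    and Y :: "nat \<Rightarrow> 'w \<Rightarrow> real^'y"
    and \<Lambda> :: "nat \<Rightarrow> 'w \<Rightarrow> real^'m^'i"
    and x0 :: "real^'n^'i" and y0 :: "real^'y" and l0 :: "real^'m^'i"
  assumes prob_P: "prob_space P"
    and nu_meas: "\<And>i k. \<nu> i k \<in> measurable M P"
    and nu_distr: "\<And>i k. distr M P (\<nu> i k) = P"
    and nu_indep: "indep_vars (\<lambda>_. P) (\<lambda>(i, k). \<nu> i k) UNIV"
    and G_meas: "\<And>i. (\<lambda>(x, s). G i x s) \<in> borel_measurable (restrict_space borel (U i) \<Otimes>\<^sub>M P)"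
    and G_mean: "\<And>i x. x \<in> U i \<Longrightarrow> has_bochner_integral P (G i x) (grad i x)"
    and G_var: "\<And>i x. x \<in> U i \<Longrightarrow>
                  (\<integral>\<^sup>+s. ennreal ((norm (G i x s - grad i x))\<^sup>2) \<partial>P) \<le> ennreal (\<sigma>\<^sup>2)"
    and step_pos: "\<And>i k. step i k > 0"
    and x0_U: "\<And>i. x0 $ i \<in> U i"
    and x0_segments: "\<And>i x. x \<in> xdom i \<Longrightarrow> closed_segment (x0 $ i) x \<subseteq> U i"
    and l0_dims: "l0 \<in> block_coords K"
    and l0_subdiff: "- (\<Sum>i\<in>UNIV. transpose (B i) *v (l0 $ i)) \<in> subdiff g y0"
    and init: "\<And>\<omega>. \<omega> \<in> space M \<Longrightarrow> X 0 \<omega> = x0 \<and> Y 0 \<omega> = y0 \<and> \<Lambda> 0 \<omega> = l0"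
    and iteration: "\<And>\<omega>. \<omega> \<in> space M \<Longrightarrow>
                      spg_admm_path J g \<xi> A B b \<gamma> step G (\<lambda>i k. \<nu> i k \<omega>)
                        (\<lambda>k. X k \<omega>) (\<lambda>k. Y k \<omega>) (\<lambda>k. \<Lambda> k \<omega>)"
    and Y_meas: "\<And>k. Y k \<in> borel_measurable M"
begin

lemma sample_path:
  assumes "\<omega> \<in> space M"
  shows "spg_path J K g \<xi> f U L \<gamma> A B b step G (\<lambda>i k. \<nu> i k \<omega>) (\<lambda>k. X k \<omega>) (\<lambda>k. Y k \<omega>) (\<lambda>k. \<Lambda> k \<omega>)"
  using iteration[OF assms] init[OF assms] step_pos x0_U x0_segments l0_dims l0_subdiff
  by unfold_locales auto

definition past :: "nat \<Rightarrow> 'w \<Rightarrow> 'i \<times> nat \<Rightarrow> 's" where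
  "past k \<omega> = restrict (\<lambda>p. (case p of (i, j) \<Rightarrow> \<nu> i j) \<omega>) (UNIV \<times> {..<k})"

text \<open>The sigma-algebra of all samples drawn before iteration k, written as a pull-back from a
  product space so that independence of disjoint groups of samples applies directly.\<close>

definition history :: "nat \<Rightarrow> 'w measure" where
  "history k = vimage_algebra (space M) (past k) (PiM (UNIV \<times> {..<k}) (\<lambda>_. P))"

lemma space_history [simp]: "space (history k) = space M"
  by (simp add: history_def)

lemma nu_space: "\<omega> \<in> space M \<Longrightarrow> \<nu> i k \<omega> \<in> space P"
  using nu_meas[of i k] by (auto simp: measurable_def)

lemma nu_history: "j < k \<Longrightarrow> \<nu> i j \<in> measurable (history k) P"
proof -
  assume j: "j < k"
  have "past k \<in> measurable (history k) (PiM (UNIV \<times> {..<k}) (\<lambda>_. P))"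
    unfolding history_def by (rule measurable_vimage_algebra1) (auto simp: past_def space_PiM PiE_def extensional_def nu_space split: if_splits)
  then have "(\<lambda>\<omega>. past k \<omega> (i, j)) \<in> measurable (history k) P"
    by (rule measurable_compose) (use j in \<open>auto intro!: measurable_component_singleton\<close>)
  moreover have "(\<lambda>\<omega>. past k \<omega> (i, j)) = \<nu> i j" using j by (auto simp: past_def)
  ultimately show ?thesis by simp
qed

lemma history_mono: "Z \<in> measurable (history k) S \<Longrightarrow> Z \<in> measurable (history (Suc k)) S"
proof -
  assume Z: "Z \<in> measurable (history k) S"
  have "past k \<in> measurable (history (Suc k)) (PiM (UNIV \<times> {..<k}) (\<lambda>_. P))"
    unfolding past_def by (rule measurable_restrict) (auto intro!: nu_history)
  then have "sets (history k) \<subseteq> sets (history (Suc k))"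
    unfolding history_def[of k] by (intro sets_image_in_sets) auto
  then show ?thesis using Z by (auto simp: measurable_def)
qed

lemma history_measurable: "Z \<in> measurable (history k) S \<Longrightarrow> Z \<in> measurable M S"
proof -
  assume Z: "Z \<in> measurable (history k) S"
  have "past k \<in> measurable M (PiM (UNIV \<times> {..<k}) (\<lambda>_. P))"
    unfolding past_def by (rule measurable_restrict) (auto intro!: nu_meas)
  then have "sets (history k) \<subseteq> sets M"
    unfolding history_def by (intro sets_image_in_sets) auto
  then show ?thesis using Z by (auto simp: measurable_def)
qed

text \<open>\<open>past k\<close> and \<open>\<nu> i k\<close> use disjoint index sets of the
  independent family, so the sigma-algebras they generate are independent.\<close>

lemma indep_history:
  assumes C: "C \<in> sets (history k)" and E: "E \<in> sets P"
  shows "prob (C \<inter> (\<nu> i k -` E \<inter> space M)) = prob C * measure P E"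
proof -
  let ?N = "PiM (UNIV \<times> {..<k}) (\<lambda>_. P)" and ?T = "PiM {(i, k)} (\<lambda>_. P)"
  \<comment> \<open>The fresh sample is viewed as a family over a one-point index set, the form in
    which grouping of independent variables delivers it.\<close>
  let ?r = "\<lambda>\<omega>. restrict (\<lambda>p. (case p of (i, j) \<Rightarrow> \<nu> i j) \<omega>) {(i, k)}"
  have "indep_var ?N (past k) ?T ?r"
    unfolding past_def by (rule indep_var_restrict[OF nu_indep]) auto
  then have ind: "indep_set (sigma_sets (space M) {past k -` A \<inter> space M | A. A \<in> sets ?N})
      (sigma_sets (space M) {?r -` A \<inter> space M | A. A \<in> sets ?T})"
    by (simp add: indep_var_eq)
  have C': "C \<in> sigma_sets (space M) {past k -` A \<inter> space M | A. A \<in> sets ?N}"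
    using C by (simp add: history_def sets_vimage_algebra)
  have "(\<lambda>h. h (i, k)) -` E \<inter> space ?T \<in> sets ?T"
    using measurable_sets[OF measurable_component_singleton[of "(i, k)" "{(i, k)}" "\<lambda>_. P"] E] by simp
  moreover have "\<nu> i k -` E \<inter> space M = ?r -` ((\<lambda>h. h (i, k)) -` E \<inter> space ?T) \<inter> space M"
    by (auto simp: space_PiM nu_space)
  ultimately have "\<nu> i k -` E \<inter> space M \<in> sigma_sets (space M) {?r -` A \<inter> space M | A. A \<in> sets ?T}"
    by (intro sigma_sets.Basic) blast
  from indep_setD[OF ind C' this]
  have "prob (C \<inter> (\<nu> i k -` E \<inter> space M)) = prob C * prob (\<nu> i k -` E \<inter> space M)" .
  also have "prob (\<nu> i k -` E \<inter> space M) = measure (distr M P (\<nu> i k)) E"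
    using measure_distr[OF nu_meas E, of i k] by simp
  finally show ?thesis by (simp add: nu_distr)
qed

lemma X_U: "\<omega> \<in> space M \<Longrightarrow> X k \<omega> $ i \<in> U i"
  by (rule spg_path.x_U[OF sample_path])

lemma borel_measurable_matrix_vector_mult:
  "v \<in> borel_measurable N \<Longrightarrow> (\<lambda>\<omega>. D *v v \<omega>) \<in> borel_measurable N" for D :: "real^'d::finite^'e::finite"
  by (rule borel_measurable_continuous_on[OF linear_continuous_on[OF matrix_vector_mul_bounded_linear]])

text \<open>Induction along the iteration. The selected minimizer \<open>Y k\<close> might depend
  even on later samples, so adaptedness is claimed only for its images under the \<open>B i\<close>;
  the residuals, and with them the next iterates, see nothing else.\<close>

lemma adapted:
  shows "(\<lambda>\<omega>. X k \<omega> $ i) \<in> borel_measurable (history k)"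
    and "(\<lambda>\<omega>. \<Lambda> k \<omega> $ i) \<in> borel_measurable (history k)"
    and "(\<lambda>\<omega>. B i *v Y k \<omega>) \<in> borel_measurable (history k)"
proof -
  have "(\<forall>i. (\<lambda>\<omega>. X k \<omega> $ i) \<in> borel_measurable (history k)) \<and>
    (\<forall>i. (\<lambda>\<omega>. \<Lambda> k \<omega> $ i) \<in> borel_measurable (history k)) \<and>
    (\<forall>i. (\<lambda>\<omega>. B i *v Y k \<omega>) \<in> borel_measurable (history k))"
  proof (induction k)
    case 0
    have "(\<lambda>\<omega>. X 0 \<omega> $ i) \<in> borel_measurable (history 0) \<longleftrightarrow> (\<lambda>\<omega>. x0 $ i) \<in> borel_measurable (history 0)"
      "(\<lambda>\<omega>. \<Lambda> 0 \<omega> $ i) \<in> borel_measurable (history 0) \<longleftrightarrow> (\<lambda>\<omega>. l0 $ i) \<in> borel_measurable (history 0)"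
      "(\<lambda>\<omega>. B i *v Y 0 \<omega>) \<in> borel_measurable (history 0) \<longleftrightarrow> (\<lambda>\<omega>. B i *v y0) \<in> borel_measurable (history 0)" for i
      by (intro measurable_cong; simp add: init)+
    then show ?case by simp
  next
    case (Suc k)
    note IH = history_mono[OF Suc.IH[THEN conjunct1, rule_format]]
      history_mono[OF Suc.IH[THEN conjunct2, THEN conjunct1, rule_format]]
      history_mono[OF Suc.IH[THEN conjunct2, THEN conjunct2, rule_format]]
    have X: "(\<lambda>\<omega>. X (Suc k) \<omega> $ i) \<in> borel_measurable (history (Suc k))" for i
    proof -
      have "(\<lambda>\<omega>. (X k \<omega> $ i, \<nu> i k \<omega>)) \<in> measurable (history (Suc k)) (restrict_space borel (U i) \<Otimes>\<^sub>M P)"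
        by (intro measurable_Pair measurable_restrict_space2 IH nu_history) (auto simp: X_U)
      from measurable_compose[OF this G_meas]
      have G: "(\<lambda>\<omega>. G i (X k \<omega> $ i) (\<nu> i k \<omega>)) \<in> borel_measurable (history (Suc k))" by simp
      have "(\<lambda>\<omega>. prox (coords (J i)) (\<lambda>z. ereal (step i k) * \<xi> i z) (X k \<omega> $ i - step i k *\<^sub>R
               (G i (X k \<omega> $ i) (\<nu> i k \<omega>) +
                transpose (A i) *v (\<Lambda> k \<omega> $ i + \<gamma> i *\<^sub>R residual A B b i (X k \<omega> $ i) (Y k \<omega>)))))
            \<in> borel_measurable (history (Suc k))"
        unfolding residual_def
        by (intro measurable_compose[OF _ prox_measurable[OF xi_closed_convex xi_proper step_pos]]
            borel_measurable_diff borel_measurable_add borel_measurable_scaleR borel_measurable_const G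
            borel_measurable_matrix_vector_mult IH)
      then show ?thesis
        by (rule measurable_cong[THEN iffD1, rotated]) (simp add: spg_path.x_step[OF sample_path])
    qed
    have BY: "(\<lambda>\<omega>. B i *v Y (Suc k) \<omega>) \<in> borel_measurable (history (Suc k))" for i
    proof (rule y_subproblem_measurable[OF g_closed_convex g_proper gamma_pos])
      show "(\<lambda>\<omega>. A i *v X (Suc k) \<omega> $ i - b i + (1 / \<gamma> i) *\<^sub>R (\<Lambda> k \<omega> $ i)) \<in> borel_measurable (history (Suc k))" for i
        by (intro borel_measurable_diff borel_measurable_add borel_measurable_scaleR borel_measurable_const
            borel_measurable_matrix_vector_mult IH X)
      show "y_subproblem g B \<gamma> (\<lambda>i. A i *v X (Suc k) \<omega> $ i - b i + (1 / \<gamma> i) *\<^sub>R (\<Lambda> k \<omega> $ i)) (Y (Suc k) \<omega>)"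
        if "\<omega> \<in> space (history (Suc k))" for \<omega>
        using spg_path.y_step[OF sample_path] that by simp
    qed
    have L: "(\<lambda>\<omega>. \<Lambda> (Suc k) \<omega> $ i) \<in> borel_measurable (history (Suc k))" for i
    proof -
      have "(\<lambda>\<omega>. \<Lambda> k \<omega> $ i + \<gamma> i *\<^sub>R residual A B b i (X (Suc k) \<omega> $ i) (Y (Suc k) \<omega>)) \<in> borel_measurable (history (Suc k))"
        unfolding residual_def
        by (intro borel_measurable_diff borel_measurable_add borel_measurable_scaleR borel_measurable_const
            borel_measurable_matrix_vector_mult IH X BY)
      then show ?thesis
        by (rule measurable_cong[THEN iffD1, rotated]) (simp add: spg_path.l_step[OF sample_path])
    qed
    show ?case using X BY L by blast
  qed
  then show "(\<lambda>\<omega>. X k \<omega> $ i) \<in> borel_measurable (history k)"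
    "(\<lambda>\<omega>. \<Lambda> k \<omega> $ i) \<in> borel_measurable (history k)"
    "(\<lambda>\<omega>. B i *v Y k \<omega>) \<in> borel_measurable (history k)" by auto
qed

section \<open>Mean and variance of the oracle error at the iterates\<close>

abbreviation Z :: "'i \<Rightarrow> nat \<Rightarrow> 'w \<Rightarrow> real^'n" where "Z i k \<omega> \<equiv> X k \<omega> $ i"
abbreviation S :: "'i \<Rightarrow> (real^'n) measure" where "S i \<equiv> restrict_space borel (U i)"

text \<open>The oracle error as a function of a frozen point and a sample, so that the sample can be
  integrated out first.\<close>

definition dev :: "'i \<Rightarrow> real^'n \<Rightarrow> 's \<Rightarrow> real^'n" where
  "dev i v s = G i v s - grad i v"

lemma Z_S: "Z i k \<in> measurable (history k) (S i)"
  using adapted(1) by (intro measurable_restrict_space2) (auto simp: X_U)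

lemma joint_measurable: "(\<lambda>\<omega>. (Z i k \<omega>, \<nu> i k \<omega>)) \<in> measurable M (S i \<Otimes>\<^sub>M P)"
  by (intro measurable_Pair history_measurable[OF Z_S] nu_meas)

text \<open>Adaptedness and \<open>indep_history\<close> give the product formula on rectangles,
  which determines the law since both factors are sigma-finite.\<close>

lemma joint_distr: "distr M (S i \<Otimes>\<^sub>M P) (\<lambda>\<omega>. (Z i k \<omega>, \<nu> i k \<omega>)) = distr M (S i) (Z i k) \<Otimes>\<^sub>M P"
proof (rule pair_measure_eqI[symmetric])
  note Z = history_measurable[OF Z_S[of k i]]
  interpret P: prob_space P by (rule prob_P)
  interpret D: prob_space "distr M (S i) (Z i k)" by (rule prob_space_distr[OF Z])
  show "sigma_finite_measure (distr M (S i) (Z i k))" "sigma_finite_measure P" by unfold_locales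
  show "sets (distr M (S i) (Z i k) \<Otimes>\<^sub>M P) = sets (distr M (S i \<Otimes>\<^sub>M P) (\<lambda>\<omega>. (Z i k \<omega>, \<nu> i k \<omega>)))"
    by (simp cong: sets_pair_measure_cong)
  fix C E assume "C \<in> sets (distr M (S i) (Z i k))" and E: "E \<in> sets P"
  then have C: "C \<in> sets (S i)" by simp
  have eq: "(Z i k -` C \<inter> space M) \<inter> (\<nu> i k -` E \<inter> space M) = (\<lambda>\<omega>. (Z i k \<omega>, \<nu> i k \<omega>)) -` (C \<times> E) \<inter> space M"
    by auto
  have "Z i k -` C \<inter> space M \<in> sets (history k)" using measurable_sets[OF Z_S C] by simp
  from indep_history[OF this E, of i]
  have "prob ((\<lambda>\<omega>. (Z i k \<omega>, \<nu> i k \<omega>)) -` (C \<times> E) \<inter> space M) = prob (Z i k -` C \<inter> space M) * measure P E"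
    unfolding eq .
  then show "emeasure (distr M (S i) (Z i k)) C * emeasure P E = emeasure (distr M (S i \<Otimes>\<^sub>M P) (\<lambda>\<omega>. (Z i k \<omega>, \<nu> i k \<omega>))) (C \<times> E)"
    using C E by (simp add: emeasure_distr[OF Z] emeasure_distr[OF joint_measurable] emeasure_eq_measure P.emeasure_eq_measure ennreal_mult)
qed

lemma dev_measurable: "(\<lambda>(v, s). dev i v s) \<in> borel_measurable (S i \<Otimes>\<^sub>M P)"
proof -
  have "grad i \<in> borel_measurable (S i)"
    by (rule borel_measurable_continuous_on_restrict[OF lipschitz_on_continuous_on[OF f_lipschitz]])
  then have "(\<lambda>p. grad i (fst p)) \<in> borel_measurable (S i \<Otimes>\<^sub>M P)"
    by (rule measurable_compose[OF measurable_fst])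
  with G_meas show ?thesis by (simp add: dev_def case_prod_beta')
qed

text \<open>The oracle bound speaks of deterministic points. Under the product law the sample is
  integrated first with the point frozen, by Tonelli.\<close>

lemma second_moment:
  shows "(\<integral>\<^sup>+\<omega>. ennreal ((norm (dev i (Z i k \<omega>) (\<nu> i k \<omega>)))\<^sup>2) \<partial>M) \<le> ennreal (\<sigma>\<^sup>2)"
proof -
  interpret P: prob_space P by (rule prob_P)
  let ?D = "distr M (S i) (Z i k)"
  interpret D: prob_space ?D by (intro prob_space_distr history_measurable[OF Z_S])
  let ?h = "\<lambda>p. ennreal ((norm (dev i (fst p) (snd p)))\<^sup>2)"
  have h: "?h \<in> borel_measurable (S i \<Otimes>\<^sub>M P)" using dev_measurable[of i] by (simp add: case_prod_beta')
  have "(\<integral>\<^sup>+\<omega>. ennreal ((norm (dev i (Z i k \<omega>) (\<nu> i k \<omega>)))\<^sup>2) \<partial>M) = (\<integral>\<^sup>+p. ?h p \<partial>distr M (S i \<Otimes>\<^sub>M P) (\<lambda>\<omega>. (Z i k \<omega>, \<nu> i k \<omega>)))"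
    by (subst nn_integral_distr[OF joint_measurable]) (use h in simp_all)
  also have "\<dots> = (\<integral>\<^sup>+v. \<integral>\<^sup>+s. ?h (v, s) \<partial>P \<partial>?D)"
    unfolding joint_distr using h by (intro P.nn_integral_fst[symmetric]) simp
  also have "\<dots> \<le> (\<integral>\<^sup>+v. ennreal (\<sigma>\<^sup>2) \<partial>?D)"
    using G_var by (intro nn_integral_mono) (auto simp: dev_def space_restrict_space)
  also have "\<dots> = ennreal (\<sigma>\<^sup>2)" using D.emeasure_space_1 by simp
  finally show ?thesis .
qed

lemma dev_borel: "(\<lambda>\<omega>. dev i (Z i k \<omega>) (\<nu> i k \<omega>)) \<in> borel_measurable M"
  using measurable_compose[OF joint_measurable dev_measurable] by simp

lemma integrable_dev_power2: "integrable M (\<lambda>\<omega>. (norm (dev i (Z i k \<omega>) (\<nu> i k \<omega>)))\<^sup>2)"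
proof (rule integrableI_bounded)
  show "(\<lambda>\<omega>. (norm (dev i (Z i k \<omega>) (\<nu> i k \<omega>)))\<^sup>2) \<in> borel_measurable M" using dev_borel[of i k] by simp
  show "(\<integral>\<^sup>+\<omega>. ennreal (norm ((norm (dev i (Z i k \<omega>) (\<nu> i k \<omega>)))\<^sup>2)) \<partial>M) < \<infinity>"
    using second_moment[of i k] by (auto intro: le_less_trans)
qed

lemma expectation_dev_power2: "expectation (\<lambda>\<omega>. (norm (dev i (Z i k \<omega>) (\<nu> i k \<omega>)))\<^sup>2) \<le> \<sigma>\<^sup>2"
  using second_moment[of i k] nn_integral_eq_integral[OF integrable_dev_power2[of i k]] by simp

text \<open>With the point frozen the sample integral vanishes. Fubini requires integrability first,
  and this is where the bound R on the distance enters.\<close>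

lemma expectation_dev_inner:
  assumes R: "\<And>\<omega>. \<omega> \<in> space M \<Longrightarrow> norm (Z i k \<omega> - u) \<le> R"
  shows "integrable M (\<lambda>\<omega>. dev i (Z i k \<omega>) (\<nu> i k \<omega>) \<bullet> (Z i k \<omega> - u))"
    and "expectation (\<lambda>\<omega>. dev i (Z i k \<omega>) (\<nu> i k \<omega>) \<bullet> (Z i k \<omega> - u)) = 0"
proof -
  interpret P: prob_space P by (rule prob_P)
  let ?D = "distr M (S i) (Z i k)"
  interpret D: prob_space ?D by (intro prob_space_distr history_measurable[OF Z_S])
  interpret DP: pair_sigma_finite ?D P ..
  let ?h = "\<lambda>p. dev i (fst p) (snd p) \<bullet> (fst p - u)"
  have idm: "(\<lambda>v. v) \<in> borel_measurable (S i)" by (rule measurable_restrict_space1) simp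
  have h: "?h \<in> borel_measurable (S i \<Otimes>\<^sub>M P)"
    using dev_measurable[of i] measurable_compose[OF measurable_fst idm]
    by (intro borel_measurable_inner borel_measurable_diff borel_measurable_const) (simp_all add: case_prod_beta')
  show int: "integrable M (\<lambda>\<omega>. dev i (Z i k \<omega>) (\<nu> i k \<omega>) \<bullet> (Z i k \<omega> - u))"
  proof (rule Bochner_Integration.integrable_bound)
    \<comment> \<open>The dominating function comes from
      \<open>norm d \<le> 1 + (norm d)\<^sup>2\<close>, which reduces integrability to the second
      moment.\<close>
    show "integrable M (\<lambda>\<omega>. R * (1 + (norm (dev i (Z i k \<omega>) (\<nu> i k \<omega>)))\<^sup>2))"
      using integrable_dev_power2[of i k] by simp
    show "(\<lambda>\<omega>. dev i (Z i k \<omega>) (\<nu> i k \<omega>) \<bullet> (Z i k \<omega> - u)) \<in> borel_measurable M"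
      using measurable_compose[OF joint_measurable h] by simp
    show "AE \<omega> in M. norm (dev i (Z i k \<omega>) (\<nu> i k \<omega>) \<bullet> (Z i k \<omega> - u)) \<le> norm (R * (1 + (norm (dev i (Z i k \<omega>) (\<nu> i k \<omega>)))\<^sup>2))"
    proof (rule AE_I2)
      fix \<omega> assume \<omega>: "\<omega> \<in> space M"
      let ?d = "dev i (Z i k \<omega>) (\<nu> i k \<omega>)"
      have R0: "0 \<le> R" using order_trans[OF norm_ge_zero R[OF \<omega>]] .
      have "norm (?d \<bullet> (Z i k \<omega> - u)) \<le> norm ?d * norm (Z i k \<omega> - u)" by (simp add: Cauchy_Schwarz_ineq2)
      also have "\<dots> \<le> norm ?d * R" by (intro mult_left_mono R \<omega>) simp
      also have "norm ?d \<le> 1 + (norm ?d)\<^sup>2"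
        using zero_le_square[of "norm ?d - 1/2"] by (simp add: algebra_simps power2_eq_square)
      then have "norm ?d * R \<le> R * (1 + (norm ?d)\<^sup>2)" using R0 by (simp add: mult.commute[of R] mult_right_mono)
      finally show "norm (?d \<bullet> (Z i k \<omega> - u)) \<le> norm (R * (1 + (norm ?d)\<^sup>2))" using R0 by simp
    qed
  qed
  have "integrable (distr M (S i \<Otimes>\<^sub>M P) (\<lambda>\<omega>. (Z i k \<omega>, \<nu> i k \<omega>))) ?h"
    by (subst integrable_distr_eq[OF joint_measurable h]) (simp add: int)
  then have inth: "integrable (?D \<Otimes>\<^sub>M P) ?h" by (simp only: joint_distr)
  have "expectation (\<lambda>\<omega>. dev i (Z i k \<omega>) (\<nu> i k \<omega>) \<bullet> (Z i k \<omega> - u)) =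
     integral\<^sup>L (distr M (S i \<Otimes>\<^sub>M P) (\<lambda>\<omega>. (Z i k \<omega>, \<nu> i k \<omega>))) ?h"
    by (subst integral_distr[OF joint_measurable h]) simp
  also have "\<dots> = (\<integral>v. (\<integral>s. ?h (v, s) \<partial>P) \<partial>?D)"
    unfolding joint_distr by (rule DP.integral_fst'[OF inth, symmetric])
  also have "\<dots> = (\<integral>v. 0 \<partial>?D)"
  proof (rule Bochner_Integration.integral_cong[OF refl])
    fix v assume "v \<in> space ?D"
    then have v: "v \<in> U i" by (simp add: space_restrict_space)
    have "has_bochner_integral P (\<lambda>_. grad i v) (grad i v)"
      by (simp add: has_bochner_integral_iff P.prob_space)
    with G_mean[OF v] have "has_bochner_integral P (\<lambda>s. (G i v s - grad i v) \<bullet> (v - u)) ((grad i v - grad i v) \<bullet> (v - u))"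
      by (intro has_bochner_integral_inner_left has_bochner_integral_diff)
    then show "(\<integral>s. ?h (v, s) \<partial>P) = 0" by (simp add: dev_def has_bochner_integral_iff)
  qed
  finally show "expectation (\<lambda>\<omega>. dev i (Z i k \<omega>) (\<nu> i k \<omega>) \<bullet> (Z i k \<omega> - u)) = 0" by simp
qed

lemma noise_eq_dev:
  assumes "\<omega> \<in> space M"
  shows "spg_path.noise J f G (\<lambda>i k. \<nu> i k \<omega>) (\<lambda>k. X k \<omega>) i k = dev i (Z i k \<omega>) (\<nu> i k \<omega>)"
  by (simp add: spg_path.noise_def[OF sample_path[OF assms]] dev_def)

text \<open>At a fixed point the oracle is exact off a null set that may depend on the point; the
  second moment at the random iterate removes this dependence. Countability of blocks and iterations
  leaves a single null set.\<close>

lemma no_noise: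
  assumes "\<sigma> = 0"
  shows "AE \<omega> in M. \<forall>i k. dev i (Z i k \<omega>) (\<nu> i k \<omega>) = 0"
proof -
  have "AE \<omega> in M. dev i (Z i k \<omega>) (\<nu> i k \<omega>) = 0" for i k
  proof -
    have "(\<integral>\<^sup>+\<omega>. ennreal ((norm (dev i (Z i k \<omega>) (\<nu> i k \<omega>)))\<^sup>2) \<partial>M) = 0"
      using second_moment[of i k] assms by simp
    then have "AE \<omega> in M. ennreal ((norm (dev i (Z i k \<omega>) (\<nu> i k \<omega>)))\<^sup>2) = 0"
      by (subst (asm) nn_integral_0_iff_AE) (use dev_borel[of i k] in simp_all)
    then show ?thesis by eventually_elim simp
  qed
  then show ?thesis by (simp add: AE_all_countable)
qed

end

subsection \<open>The two step size regimes\<close>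

text \<open>Each summand is at most \<open>2 * (sqrt (k + 1) - sqrt k)\<close>, by rationalizing the
  difference, and these bounds telescope.\<close>

lemma sum_inverse_sqrt_le: "(\<Sum>k<t. 1 / (1 + sqrt (real k))) \<le> 2 * sqrt (real t)"
proof (induction t)
  case (Suc t)
  let ?a = "sqrt (real t)" and ?b = "sqrt (real (Suc t))"
  have ab: "0 \<le> ?a" "?a \<le> ?b" "?b \<le> 1 + ?a"
    by (auto intro: real_le_lsqrt simp: power2_sum)
  have "1 = (?b - ?a) * (?b + ?a)" by (simp add: algebra_simps)
  also have "\<dots> \<le> (?b - ?a) * (2 * (1 + ?a))" using ab by (intro mult_left_mono) auto
  also have "\<dots> = 2 * (?b - ?a) * (1 + ?a)" by (simp only: ac_simps)
  finally have "1 / (1 + ?a) \<le> 2 * (?b - ?a)" using ab by (subst pos_divide_le_eq) linarith+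
  from add_mono[OF Suc this] show ?case by (simp add: right_diff_distrib)
qed simp

text \<open>The quantity q may be 0; then \<open>1 / ereal q\<close> is infinite and does not
  restrict c, whereas division by 0 in the reals gives 0. The conclusion divides by c
  instead.\<close>

lemma less_inverse_of_ereal_less:
  assumes "0 < c" "ereal c < 1 / ereal q" "0 \<le> q"
  shows "q < 1 / c"
proof (cases "q = 0")
  case False
  then have "c < 1 / q" using assms by (simp add: one_ereal_def)
  then show ?thesis using False assms by (simp add: field_simps)
qed (use assms in simp)

context stochastic_spg
begin

lemma L_nonneg: "0 \<le> L i"
  using f_lipschitz[of i] by (simp add: lipschitz_on_def)

lemma deterministic_case:
  assumes \<sigma>: "\<sigma> = 0" and c: "\<And>i. 0 < c i \<and> ereal (c i) < 1 / ereal (L i + \<gamma> i * (spectral_norm (A i))\<^sup>2)"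
    and st: "\<And>i k. step i k = c i"
    and opt: "(xs, ys, ls) \<in> primal_dual_optimal J K g \<xi> f A B b"
  shows "AE \<omega> in M. \<forall>t\<ge>1.
           \<bar>objective g \<xi> f (avg (\<lambda>k. X k \<omega>) t) (avg (\<lambda>k. Y k \<omega>) t) - objective g \<xi> f xs ys\<bar>
             \<le> ereal (rate_const A B \<gamma> x0 y0 l0 xs ys ls c / real t) \<and>
           (\<Sum>i\<in>UNIV. norm (ls $ i) *
              norm (residual A B b i (avg (\<lambda>k. X k \<omega>) t $ i) (avg (\<lambda>k. Y k \<omega>) t)))
             \<le> rate_const A B \<gamma> x0 y0 l0 xs ys ls c / real t"
    and "rank (stacked B) = CARD('y) \<Longrightarrow>
           (AE \<omega> in M. \<exists>w \<in> primal_dual_optimal J K g \<xi> f A B b.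
              (\<lambda>k. (X k \<omega>, Y k \<omega>, \<Lambda> k \<omega>)) \<longlonglongrightarrow> w \<and>
              avg (\<lambda>k. (X k \<omega>, Y k \<omega>, \<Lambda> k \<omega>)) \<longlonglongrightarrow> w)"
proof -
  have margin: "spg_path.margin L \<gamma> A step i k > 0" if \<omega>: "\<omega> \<in> space M" for \<omega> i k
  proof -
    have "0 \<le> L i + \<gamma> i * (spectral_norm (A i))\<^sup>2"
      using L_nonneg[of i] gamma_pos[of i] by (simp add: less_imp_le)
    from less_inverse_of_ereal_less[OF _ _ this, of "c i"] c[of i] show ?thesis
      by (simp add: spg_path.margin_def[OF sample_path[OF \<omega>]] st)
  qed
  \<comment> \<open>One null set serves all blocks and iterations, so the pathwise results apply
    outside it for all t at once.\<close>
  have good: "AE \<omega> in M. \<omega> \<in> space M \<and> (\<forall>i k. spg_path.noise J f G (\<lambda>i k. \<nu> i k \<omega>) (\<lambda>k. X k \<omega>) i k = 0)"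
    using no_noise[OF \<sigma>] AE_space by eventually_elim (simp add: noise_eq_dev)
  show "AE \<omega> in M. \<forall>t\<ge>1.
           \<bar>objective g \<xi> f (avg (\<lambda>k. X k \<omega>) t) (avg (\<lambda>k. Y k \<omega>) t) - objective g \<xi> f xs ys\<bar>
             \<le> ereal (rate_const A B \<gamma> x0 y0 l0 xs ys ls c / real t) \<and>
           (\<Sum>i\<in>UNIV. norm (ls $ i) *
              norm (residual A B b i (avg (\<lambda>k. X k \<omega>) t $ i) (avg (\<lambda>k. Y k \<omega>) t)))
             \<le> rate_const A B \<gamma> x0 y0 l0 xs ys ls c / real t"
    using good
  proof eventually_elim
    case (elim \<omega>)
    then have \<omega>: "\<omega> \<in> space M" and nz: "\<And>i k. spg_path.noise J f G (\<lambda>i k. \<nu> i k \<omega>) (\<lambda>k. X k \<omega>) i k = 0" by auto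
    interpret p: spg_path J K g \<xi> f U L \<gamma> A B b step G "\<lambda>i k. \<nu> i k \<omega>" "\<lambda>k. X k \<omega>" "\<lambda>k. Y k \<omega>" "\<lambda>k. \<Lambda> k \<omega>"
      by (rule sample_path[OF \<omega>])
    show ?case
      using p.ergodic_bound[OF opt margin[OF \<omega>], of "\<lambda>_ _. 0"] init[OF \<omega>]
      by (simp add: st p.err_def nz)
  qed
  assume rank: "rank (stacked B) = CARD('y)"
  show "AE \<omega> in M. \<exists>w \<in> primal_dual_optimal J K g \<xi> f A B b.
              (\<lambda>k. (X k \<omega>, Y k \<omega>, \<Lambda> k \<omega>)) \<longlonglongrightarrow> w \<and>
              avg (\<lambda>k. (X k \<omega>, Y k \<omega>, \<Lambda> k \<omega>)) \<longlonglongrightarrow> w"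
    using good
  proof eventually_elim
    case (elim \<omega>)
    then have \<omega>: "\<omega> \<in> space M" and nz: "\<And>i k. spg_path.noise J f G (\<lambda>i k. \<nu> i k \<omega>) (\<lambda>k. X k \<omega>) i k = 0" by auto
    from spg_path.converges[OF sample_path[OF \<omega>] st nz margin[OF \<omega>] rank opt]
    show ?case using tendsto_avg by blast
  qed
qed

text \<open>The pathwise ergodic bound is integrated. Per block the step changes telescope to
  \<open>D\<^sup>2 / 2 * sqrt t\<close> and the expected errors sum to at most
  \<open>\<sigma>\<^sup>2 * sqrt t\<close>; division by t produces C' / sqrt t.\<close>

lemma stochastic_case:
  assumes bdd: "\<And>i. bounded (xdom i)"
    and D: "D = (MAX i. diameter (xdom i))"
    and c: "\<And>i. c i = inverse (L i + \<gamma> i * (spectral_norm (A i))\<^sup>2 + 1)"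
    and C: "C = rate_const A B \<gamma> x0 y0 l0 xs ys ls c"
    and C': "C' = real CARD('i) * (D\<^sup>2 / 2 + \<sigma>\<^sup>2)"
    and st: "\<And>i k. step i k = inverse (1 / c i + sqrt (real k))"
    and opt: "(xs, ys, ls) \<in> primal_dual_optimal J K g \<xi> f A B b"
    and t: "t \<ge> 1"
  shows "(\<integral>\<^sup>+\<omega>. e2ennreal
                \<bar>objective g \<xi> f (avg (\<lambda>k. X k \<omega>) t) (avg (\<lambda>k. Y k \<omega>) t)
                  - objective g \<xi> f xs ys\<bar> \<partial>M)
             \<le> ennreal (C' / sqrt (real t) + C / real t)"
    and "(\<Sum>i\<in>UNIV. ennreal (norm (ls $ i)) *
              (\<integral>\<^sup>+\<omega>. ennreal
                 (norm (residual A B b i (avg (\<lambda>k. X k \<omega>) t $ i) (avg (\<lambda>k. Y k \<omega>) t))) \<partial>M))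
             \<le> ennreal (C' / sqrt (real t) + C / real t)"
proof -
  let ?q = "\<lambda>i. L i + \<gamma> i * (spectral_norm (A i))\<^sup>2 + 1"
  have q: "?q i > 0" for i using L_nonneg[of i] gamma_pos[of i] by (simp add: add_nonneg_pos less_imp_le)
  have inv_step: "1 / step i k = ?q i + sqrt (real k)" for i k by (simp add: st c inverse_eq_divide)
  have step0: "step i 0 = c i" for i by (simp add: st)
  have margin: "spg_path.margin L \<gamma> A step i k = 1 + sqrt (real k)" if \<omega>: "\<omega> \<in> space M" for \<omega> i k
    by (simp add: spg_path.margin_def[OF sample_path[OF \<omega>]] inv_step)
  have xs: "xs $ i \<in> xdom i" for i using opt by (simp add: optimal_iff finite_point_def)
  have diam: "norm (u - v) \<le> D" if "u \<in> xdom i" "v \<in> xdom i" for u v i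
  proof -
    have "norm (u - v) \<le> diameter (xdom i)"
      using diameter_bounded_bound[OF bdd that] by (simp add: dist_norm)
    also have "\<dots> \<le> D" unfolding D by (rule Max_ge) auto
    finally show ?thesis .
  qed
  have XD: "norm (Z i (Suc k) \<omega> - xs $ i) \<le> D" if "\<omega> \<in> space M" for i k \<omega>
    by (rule diam[OF spg_path.x_dom[OF sample_path[OF that]] xs])
  have D0: "0 \<le> D" using diam[OF xs xs] by simp
  \<comment> \<open>For k = 0 the starting point may lie outside the domain, where D is no bound.
    This weaker bound only secures integrability and does not enter the rate.\<close>
  have bound: "norm (Z i k \<omega> - xs $ i) \<le> D + norm (x0 $ i - xs $ i)" if "\<omega> \<in> space M" for i k \<omega>
    using XD[OF that, of "k - 1" i] D0 init[OF that] by (cases k) (auto intro: add_increasing2)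
  define err where "err i k \<omega> = 1 / (2 * (1 + sqrt (real k))) * (norm (dev i (Z i k \<omega>) (\<nu> i k \<omega>)))\<^sup>2
     - dev i (Z i k \<omega>) (\<nu> i k \<omega>) \<bullet> (Z i k \<omega> - xs $ i)" for i k \<omega>
  \<comment> \<open>One integrable majorant, valid on every path, for both the objective gap and the
    weighted residuals.\<close>
  define W where "W \<omega> = (C + (\<Sum>i\<in>(UNIV::'i set). D\<^sup>2 / 2 * sqrt (real t)) + (\<Sum>k<t. \<Sum>i\<in>UNIV. err i k \<omega>)) / real t" for \<omega>
  have pathwise: "\<bar>objective g \<xi> f (avg (\<lambda>k. X k \<omega>) t) (avg (\<lambda>k. Y k \<omega>) t) - objective g \<xi> f xs ys\<bar> \<le> ereal (W \<omega>)"
    "(\<Sum>i\<in>UNIV. norm (ls $ i) * norm (residual A B b i (avg (\<lambda>k. X k \<omega>) t $ i) (avg (\<lambda>k. Y k \<omega>) t))) \<le> W \<omega>"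
    if \<omega>: "\<omega> \<in> space M" for \<omega>
  proof -
    interpret p: spg_path J K g \<xi> f U L \<gamma> A B b step G "\<lambda>i k. \<nu> i k \<omega>" "\<lambda>k. X k \<omega>" "\<lambda>k. Y k \<omega>" "\<lambda>k. \<Lambda> k \<omega>"
      by (rule sample_path[OF \<omega>])
    have e: "p.err xs i k = err i k \<omega>" for i k
      by (simp add: p.err_def err_def noise_eq_dev[OF \<omega>] margin[OF \<omega>])
    have m: "p.margin i k > 0" for i k by (simp add: margin[OF \<omega>] add_pos_nonneg)
    \<comment> \<open>Only iterates of index at least 1 occur here, so D bounds their distance to
      the optimal block.\<close>
    have s: "1/2 * (1 / step i (Suc k) - 1 / step i k) * (norm (X (Suc k) \<omega> $ i - xs $ i))\<^sup>2
        \<le> D\<^sup>2 / 2 * sqrt (real (Suc k)) - D\<^sup>2 / 2 * sqrt (real k)" for i k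
    proof -
      have "(norm (X (Suc k) \<omega> $ i - xs $ i))\<^sup>2 \<le> D\<^sup>2" by (intro power_mono XD \<omega>) simp
      then have "1/2 * (sqrt (real (Suc k)) - sqrt (real k)) * (norm (X (Suc k) \<omega> $ i - xs $ i))\<^sup>2
        \<le> 1/2 * (sqrt (real (Suc k)) - sqrt (real k)) * D\<^sup>2"
        by (intro mult_left_mono) auto
      also have "\<dots> = D\<^sup>2 / 2 * sqrt (real (Suc k)) - D\<^sup>2 / 2 * sqrt (real k)" by (simp add: algebra_simps diff_divide_distrib)
      finally show ?thesis unfolding inv_step by simp
    qed
    show "\<bar>objective g \<xi> f (avg (\<lambda>k. X k \<omega>) t) (avg (\<lambda>k. Y k \<omega>) t) - objective g \<xi> f xs ys\<bar> \<le> ereal (W \<omega>)"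
      using p.ergodic_bound(1)[OF opt m, of "\<lambda>i k. D\<^sup>2 / 2 * sqrt (real k)", OF s t] init[OF \<omega>]
      unfolding W_def C e step0 by simp
    show "(\<Sum>i\<in>UNIV. norm (ls $ i) * norm (residual A B b i (avg (\<lambda>k. X k \<omega>) t $ i) (avg (\<lambda>k. Y k \<omega>) t))) \<le> W \<omega>"
      using p.ergodic_bound(2)[OF opt m, of "\<lambda>i k. D\<^sup>2 / 2 * sqrt (real k)", OF s t] init[OF \<omega>]
      unfolding W_def C e step0 by simp
  qed
  have int_err: "integrable M (err i k)" and E_err: "expectation (err i k) \<le> 1/2 * \<sigma>\<^sup>2 * (1 / (1 + sqrt (real k)))" for i k
  proof -
    note 1 = integrable_dev_power2[of i k] and 2 = expectation_dev_inner[OF bound, of i k]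
    show "integrable M (err i k)" unfolding err_def using 1 2(1) by simp
    have "expectation (err i k) = 1 / (2 * (1 + sqrt (real k))) * expectation (\<lambda>\<omega>. (norm (dev i (Z i k \<omega>) (\<nu> i k \<omega>)))\<^sup>2)"
      unfolding err_def using 1 2 by simp
    also have "\<dots> \<le> 1 / (2 * (1 + sqrt (real k))) * \<sigma>\<^sup>2"
      by (intro mult_left_mono expectation_dev_power2) simp
    finally show "expectation (err i k) \<le> 1/2 * \<sigma>\<^sup>2 * (1 / (1 + sqrt (real k)))" by simp
  qed
  have W_int: "integrable M W" unfolding W_def using int_err by (intro integrable_divide_zero) simp
  have W_nonneg: "0 \<le> W \<omega>" if "\<omega> \<in> space M" for \<omega>
    using pathwise(2)[OF that] by (rule order_trans[rotated]) (auto intro!: sum_nonneg)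
  have "expectation W = (C + real CARD('i) * (D\<^sup>2 / 2 * sqrt (real t)) + (\<Sum>k<t. \<Sum>i\<in>UNIV. expectation (err i k))) / real t"
    unfolding W_def using int_err by (simp add: prob_space)
  also have "\<dots> \<le> (C + real CARD('i) * (D\<^sup>2 / 2 * sqrt (real t)) + real CARD('i) * \<sigma>\<^sup>2 * sqrt (real t)) / real t"
  proof (intro divide_right_mono add_left_mono)
    have "(\<Sum>k<t. \<Sum>i\<in>(UNIV::'i set). expectation (err i k)) \<le> (\<Sum>k<t. \<Sum>i\<in>(UNIV::'i set). 1/2 * \<sigma>\<^sup>2 * (1 / (1 + sqrt (real k))))"
      by (intro sum_mono E_err)
    also have "\<dots> = real CARD('i) * (1/2 * \<sigma>\<^sup>2) * (\<Sum>k<t. 1 / (1 + sqrt (real k)))"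
      by (simp add: sum_distrib_left)
    also have "\<dots> \<le> real CARD('i) * (1/2 * \<sigma>\<^sup>2) * (2 * sqrt (real t))"
      by (intro mult_left_mono sum_inverse_sqrt_le) simp
    finally show "(\<Sum>k<t. \<Sum>i\<in>(UNIV::'i set). expectation (err i k)) \<le> real CARD('i) * \<sigma>\<^sup>2 * sqrt (real t)" by simp
  qed simp
  also have "\<dots> = (C + C' * sqrt (real t)) / real t" by (simp add: C' algebra_simps)
  also have "\<dots> = C' / sqrt (real t) + C / real t"
  proof -
    have "sqrt (real t) / real t = 1 / sqrt (real t)" using t by (simp add: real_div_sqrt field_simps)
    then show ?thesis by (simp add: add_divide_distrib) (metis times_divide_eq_right mult.right_neutral)
  qed
  finally have EW: "expectation W \<le> C' / sqrt (real t) + C / real t" .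
  have "(\<integral>\<^sup>+\<omega>. ennreal (W \<omega>) \<partial>M) = ennreal (expectation W)"
    by (rule nn_integral_eq_integral[OF W_int]) (use W_nonneg in auto)
  then have nW: "(\<integral>\<^sup>+\<omega>. ennreal (W \<omega>) \<partial>M) \<le> ennreal (C' / sqrt (real t) + C / real t)"
    using EW by (simp add: ennreal_leI)
  \<comment> \<open>The nonnegative integral is monotone under pointwise comparison, so
    measurability of the objective gap does not have to be established.\<close>
  have "(\<integral>\<^sup>+\<omega>. e2ennreal \<bar>objective g \<xi> f (avg (\<lambda>k. X k \<omega>) t) (avg (\<lambda>k. Y k \<omega>) t) - objective g \<xi> f xs ys\<bar> \<partial>M)
    \<le> (\<integral>\<^sup>+\<omega>. ennreal (W \<omega>) \<partial>M)"
    using e2ennreal_mono[OF pathwise(1)] by (intro nn_integral_mono) (simp add: e2ennreal_ereal)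
  then show "(\<integral>\<^sup>+\<omega>. e2ennreal \<bar>objective g \<xi> f (avg (\<lambda>k. X k \<omega>) t) (avg (\<lambda>k. Y k \<omega>) t) - objective g \<xi> f xs ys\<bar> \<partial>M)
    \<le> ennreal (C' / sqrt (real t) + C / real t)" using nW by (rule order_trans)
  let ?r = "\<lambda>i \<omega>. residual A B b i (avg (\<lambda>k. X k \<omega>) t $ i) (avg (\<lambda>k. Y k \<omega>) t)"
  \<comment> \<open>For the residuals measurability does matter: the sum over the blocks has to be
    moved inside the integral before W can be applied.\<close>
  have meas: "(\<lambda>\<omega>. ennreal (norm (?r i \<omega>))) \<in> borel_measurable M" for i
  proof -
    have 1: "(\<lambda>\<omega>. avg (\<lambda>k. X k \<omega>) t $ i) \<in> borel_measurable M"
      using history_measurable[OF adapted(1)] by (simp add: avg_def)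
    have 2: "(\<lambda>\<omega>. avg (\<lambda>k. Y k \<omega>) t) \<in> borel_measurable M"
      using Y_meas by (simp add: avg_def)
    have "?r i \<in> borel_measurable M"
      unfolding residual_def
      by (intro borel_measurable_diff borel_measurable_add borel_measurable_const borel_measurable_matrix_vector_mult 1 2)
    then show ?thesis by measurable
  qed
  have "(\<Sum>i\<in>UNIV. ennreal (norm (ls $ i)) * (\<integral>\<^sup>+\<omega>. ennreal (norm (?r i \<omega>)) \<partial>M))
     = (\<integral>\<^sup>+\<omega>. (\<Sum>i\<in>UNIV. ennreal (norm (ls $ i)) * ennreal (norm (?r i \<omega>))) \<partial>M)"
    using meas by (simp add: nn_integral_sum nn_integral_cmult)
  also have "\<dots> = (\<integral>\<^sup>+\<omega>. ennreal (\<Sum>i\<in>UNIV. norm (ls $ i) * norm (?r i \<omega>)) \<partial>M)"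
    by (simp add: ennreal_mult'[symmetric] sum_ennreal)
  also have "\<dots> \<le> (\<integral>\<^sup>+\<omega>. ennreal (W \<omega>) \<partial>M)"
    by (intro nn_integral_mono ennreal_leI pathwise(2))
  finally show "(\<Sum>i\<in>UNIV. ennreal (norm (ls $ i)) * (\<integral>\<^sup>+\<omega>. ennreal (norm (?r i \<omega>)) \<partial>M))
    \<le> ennreal (C' / sqrt (real t) + C / real t)" using nW by (rule order_trans)
qed

end

theorem theorem5:
  fixes J :: "'i::finite \<Rightarrow> 'n::finite set"
    and K :: "'i \<Rightarrow> 'm::finite set"
    and g :: "real^'y::finite \<Rightarrow> ereal"
    and \<xi> :: "'i \<Rightarrow> real^'n \<Rightarrow> ereal"
    and f :: "'i \<Rightarrow> real^'n \<Rightarrow> real"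
    and U :: "'i \<Rightarrow> (real^'n) set"
    and L \<gamma> :: "'i \<Rightarrow> real"
    and A :: "'i \<Rightarrow> real^'n^'m"
    and B :: "'i \<Rightarrow> real^'y^'m"
    and b :: "'i \<Rightarrow> real^'m"
    and M :: "'w measure"
    and P :: "'s measure"
    and \<nu> :: "'i \<Rightarrow> nat \<Rightarrow> 'w \<Rightarrow> 's"
    and G :: "'i \<Rightarrow> real^'n \<Rightarrow> 's \<Rightarrow> real^'n"
    and \<sigma> :: real
    and step :: "'i \<Rightarrow> nat \<Rightarrow> real"
    and X :: "nat \<Rightarrow> 'w \<Rightarrow> real^'n^'i"
    and Y :: "nat \<Rightarrow> 'w \<Rightarrow> real^'y"
    and \<Lambda> :: "nat \<Rightarrow> 'w \<Rightarrow> real^'m^'i"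
    and x0 xs :: "real^'n^'i"
    and y0 ys :: "real^'y"
    and l0 ls :: "real^'m^'i"
  assumes xi_closed_convex: "\<And>i. closed_convex_fun (coords (J i)) (\<xi> i)"
    and xi_proper: "\<And>i. edom (coords (J i)) (\<xi> i) \<noteq> {}"
    and f_closed_convex: "\<And>i. closed_convex_fun (coords (J i)) (\<lambda>x. ereal (f i x))"
    and U_open: "\<And>i. openin (top_of_set (coords (J i))) (U i)"
    and U_dom: "\<And>i. edom (coords (J i)) (\<xi> i) \<subseteq> U i"
    and f_diff: "\<And>i x. x \<in> U i \<Longrightarrow> f i differentiable (at x within coords (J i))"
    and f_lipschitz: "\<And>i. (L i)-lipschitz_on (U i) (grad_on (coords (J i)) (f i))"
    and g_closed_convex: "closed_convex_fun UNIV g"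
    and g_proper: "edom UNIV g \<noteq> {}"
    and A_dims: "\<And>i. matrix_on (K i) (J i) (A i)"
    and B_dims: "\<And>i. matrix_on (K i) UNIV (B i)"
    and b_dims: "\<And>i. b i \<in> coords (K i)"
    and gamma_pos: "\<And>i. \<gamma> i > 0"
    and prob_M: "prob_space M"
    and prob_P: "prob_space P"
    and nu_meas: "\<And>i k. \<nu> i k \<in> measurable M P"
    and nu_distr: "\<And>i k. distr M P (\<nu> i k) = P"
    and nu_indep: "prob_space.indep_vars M (\<lambda>_. P) (\<lambda>(i, k). \<nu> i k) UNIV"
    and sigma_nonneg: "\<sigma> \<ge> 0"
    and G_dims: "\<And>i x s. x \<in> coords (J i) \<Longrightarrow> s \<in> space P \<Longrightarrow> G i x s \<in> coords (J i)"
    and G_meas: "\<And>i. (\<lambda>(x, s). G i x s) \<in>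
                   borel_measurable (restrict_space borel (U i) \<Otimes>\<^sub>M P)"
    and G_mean: "\<And>i x. x \<in> U i \<Longrightarrow>
                   has_bochner_integral P (G i x) (grad_on (coords (J i)) (f i) x)"
    and G_var: "\<And>i x. x \<in> U i \<Longrightarrow>
                  (\<integral>\<^sup>+s. ennreal ((norm (G i x s - grad_on (coords (J i)) (f i) x))\<^sup>2) \<partial>P)
                    \<le> ennreal (\<sigma>\<^sup>2)"
    and step_pos: "\<And>i k. step i k > 0"
    and x0_U: "\<And>i. x0 $ i \<in> U i"
    and x0_segments: "\<And>i x. x \<in> edom (coords (J i)) (\<xi> i) \<Longrightarrow> closed_segment (x0 $ i) x \<subseteq> U i"
    and l0_dims: "l0 \<in> block_coords K"
    and l0_subdiff: "- (\<Sum>i\<in>UNIV. transpose (B i) *v (l0 $ i)) \<in> subdiff g y0"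
    and init: "\<And>\<omega>. \<omega> \<in> space M \<Longrightarrow> X 0 \<omega> = x0 \<and> Y 0 \<omega> = y0 \<and> \<Lambda> 0 \<omega> = l0"
    and iteration: "\<And>\<omega>. \<omega> \<in> space M \<Longrightarrow>
                      spg_admm_path J g \<xi> A B b \<gamma> step G (\<lambda>i k. \<nu> i k \<omega>)
                        (\<lambda>k. X k \<omega>) (\<lambda>k. Y k \<omega>) (\<lambda>k. \<Lambda> k \<omega>)"
    and Y_meas: "\<And>k. Y k \<in> borel_measurable M"
    and optimal: "(xs, ys, ls) \<in> primal_dual_optimal J K g \<xi> f A B b"
  shows
    "(\<forall>c. \<sigma> = 0 \<longrightarrow>
        (\<forall>i. 0 < c i \<and> ereal (c i) < 1 / ereal (L i + \<gamma> i * (spectral_norm (A i))\<^sup>2)) \<longrightarrow>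
        (\<forall>i k. step i k = c i) \<longrightarrow>
        (AE \<omega> in M. \<forall>t\<ge>1.
           \<bar>objective g \<xi> f (avg (\<lambda>k. X k \<omega>) t) (avg (\<lambda>k. Y k \<omega>) t) - objective g \<xi> f xs ys\<bar>
             \<le> ereal (rate_const A B \<gamma> x0 y0 l0 xs ys ls c / real t) \<and>
           (\<Sum>i\<in>UNIV. norm (ls $ i) *
              norm (residual A B b i (avg (\<lambda>k. X k \<omega>) t $ i) (avg (\<lambda>k. Y k \<omega>) t)))
             \<le> rate_const A B \<gamma> x0 y0 l0 xs ys ls c / real t) \<and>
        (rank (stacked B) = CARD('y) \<longrightarrow>
           (AE \<omega> in M. \<exists>w \<in> primal_dual_optimal J K g \<xi> f A B b.
              (\<lambda>k. (X k \<omega>, Y k \<omega>, \<Lambda> k \<omega>)) \<longlonglongrightarrow> w \<and>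
              avg (\<lambda>k. (X k \<omega>, Y k \<omega>, \<Lambda> k \<omega>)) \<longlonglongrightarrow> w)))
     \<and>
     (\<forall>c C C' D. \<sigma> > 0 \<longrightarrow>
        (\<forall>i. bounded (edom (coords (J i)) (\<xi> i))) \<longrightarrow>
        D = (MAX i. diameter (edom (coords (J i)) (\<xi> i))) \<longrightarrow>
        (\<forall>i. c i = inverse (L i + \<gamma> i * (spectral_norm (A i))\<^sup>2 + 1)) \<longrightarrow>
        C = rate_const A B \<gamma> x0 y0 l0 xs ys ls c \<longrightarrow>
        C' = real CARD('i) * (D\<^sup>2 / 2 + \<sigma>\<^sup>2) \<longrightarrow>
        (\<forall>i k. step i k = inverse (1 / c i + sqrt (real k))) \<longrightarrow>
        (\<forall>t\<ge>1.
           (\<integral>\<^sup>+\<omega>. e2ennreal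
                \<bar>objective g \<xi> f (avg (\<lambda>k. X k \<omega>) t) (avg (\<lambda>k. Y k \<omega>) t)
                  - objective g \<xi> f xs ys\<bar> \<partial>M)
             \<le> ennreal (C' / sqrt (real t) + C / real t) \<and>
           (\<Sum>i\<in>UNIV. ennreal (norm (ls $ i)) *
              (\<integral>\<^sup>+\<omega>. ennreal
                 (norm (residual A B b i (avg (\<lambda>k. X k \<omega>) t $ i) (avg (\<lambda>k. Y k \<omega>) t))) \<partial>M))
             \<le> ennreal (C' / sqrt (real t) + C / real t)))"
proof -
  have U_sub: "U i \<subseteq> coords (J i)" for i by (rule openin_imp_subset[OF U_open])
  have sp: "spg_problem J K g \<xi> f U L \<gamma> A B b"
    by (rule spg_problem.intro; fact xi_closed_convex xi_proper f_closed_convex U_sub U_dom f_diff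
        f_lipschitz g_closed_convex g_proper A_dims B_dims b_dims gamma_pos)
  have ax: "stochastic_spg_axioms J K g \<xi> f U \<gamma> A B b M P \<nu> G \<sigma> step X Y \<Lambda> x0 y0 l0"
    by (rule stochastic_spg_axioms.intro; fact prob_P nu_meas nu_distr nu_indep G_meas G_mean G_var
        step_pos x0_U x0_segments l0_dims l0_subdiff init iteration Y_meas)
  interpret stochastic_spg J K g \<xi> f U L \<gamma> A B b M P \<nu> G \<sigma> step X Y \<Lambda> x0 y0 l0
    by (rule stochastic_spg.intro[OF sp prob_M ax])
  show ?thesis
    using deterministic_case[OF _ _ _ optimal] stochastic_case[OF _ _ _ _ _ _ optimal]
    by (intro conjI allI impI) blast+
qed

end
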